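(* Let $d\ge 2$ and let $S\subset\mathbb{R}^d$ be a smooth embedded hypersurface (a $(d-1)$-dimensional submanifold, possibly with boundary $\partial S$) whose interior $\operatorname{Int}S$ has non-vanishing Gaussian curvature at every point. Let $$D:=S\times\mathbb{R}=\{(x,h)\,:\,x\in S,\ h\in\mathbb{R}\}\subset\mathbb{R}^{d+1}$$ be the cylinder generated by $S$. Then $\dim_F(D)=d-1$.
   Context: For a Borel set $A\subset\mathbb{R}^n$, $\mathcal{M}(A)$ denotes the set of nonzero finite (positive) Borel measures $\mu$ on $\mathbb{R}^n$ supported on $A$. The Fourier transform of $\mu$ is $\widehat{\mu}(\xi)=\int e^{-2\pi i x\cdot\xi}\,d\mu(x)$. The Fourier dimension of $A$ is $$\dim_F(A):=\sup\Big\{s\in[0,n]\,:\,\exists\,\mu\in\mathcal{M}(A)\text{ with }\sup_{\xi\in\mathbb{R}^n}|\xi|^{s/2}|\widehat{\mu}(\xi)|<\infty\Big\}.$$ *)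

theory Defs
  imports "HOL-Analysis.Analysis"
begin

definition fourier_transform :: "'a::euclidean_space measure \<Rightarrow> 'a \<Rightarrow> complex" where
  "fourier_transform M \<xi> = integral\<^sup>L M (\<lambda>x. cis (- (2 * pi * (x \<bullet> \<xi>))))"

definition finite_measures_on :: "'a::euclidean_space set \<Rightarrow> 'a measure set" where
  "finite_measures_on A = {M. sets M = sets borel \<and> emeasure M UNIV \<noteq> 0 \<and>
      emeasure M UNIV < \<infinity> \<and> (AE x in M. x \<in> A)}"

definition fourier_dim :: "'a::euclidean_space set \<Rightarrow> real" where
  "fourier_dim A = Sup {s. 0 \<le> s \<and> s \<le> real DIM('a) \<and>
      (\<exists>M \<in> finite_measures_on A. \<exists>C. \<forall>\<xi>. norm \<xi> powr (s / 2) * norm (fourier_transform M \<xi>) \<le> C)}"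

fun Ck_on :: "nat \<Rightarrow> ('a::real_normed_vector \<Rightarrow> 'b::real_normed_vector) \<Rightarrow> 'a set \<Rightarrow> bool" where
  "Ck_on 0 f U = continuous_on U f"
| "Ck_on (Suc k) f U = (f differentiable_on U \<and>
      (\<forall>v. Ck_on k (\<lambda>x. frechet_derivative f (at x) v) U))"

definition smooth_on :: "('a::real_normed_vector \<Rightarrow> 'b::real_normed_vector) \<Rightarrow> 'a set \<Rightarrow> bool" where
  "smooth_on f U \<longleftrightarrow> (\<forall>k. Ck_on k f U)"

definition pd :: "(real^'m \<Rightarrow> real^'n) \<Rightarrow> real^'m \<Rightarrow> 'm \<Rightarrow> real^'n" where
  "pd \<phi> u i = frechet_derivative \<phi> (at u) (axis i 1)"

definition pd2 :: "(real^'m \<Rightarrow> real^'n) \<Rightarrow> real^'m \<Rightarrow> 'm \<Rightarrow> 'm \<Rightarrow> real^'n" where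
  "pd2 \<phi> u i j = frechet_derivative (\<lambda>w. pd \<phi> w i) (at u) (axis j 1)"

definition first_fundamental_form :: "(real^'m \<Rightarrow> real^'n) \<Rightarrow> real^'m \<Rightarrow> real^'m^'m" where
  "first_fundamental_form \<phi> u = (\<chi> i j. pd \<phi> u i \<bullet> pd \<phi> u j)"

definition second_fundamental_form ::
  "(real^'m \<Rightarrow> real^'n) \<Rightarrow> real^'n \<Rightarrow> real^'m \<Rightarrow> real^'m^'m" where
  "second_fundamental_form \<phi> N u = (\<chi> i j. pd2 \<phi> u i j \<bullet> N)"

definition gauss_curvature :: "(real^'m \<Rightarrow> real^'n) \<Rightarrow> real^'n \<Rightarrow> real^'m \<Rightarrow> real" where
  "gauss_curvature \<phi> N u = det (second_fundamental_form \<phi> N u) / det (first_fundamental_form \<phi> u)"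

definition unit_normal :: "(real^'m \<Rightarrow> real^'n) \<Rightarrow> real^'m \<Rightarrow> real^'n \<Rightarrow> bool" where
  "unit_normal \<phi> u N \<longleftrightarrow> norm N = 1 \<and> (\<forall>i. N \<bullet> pd \<phi> u i = 0)"

text \<open>Admissible model domains: whole space (interior charts) or a closed half-space
  (boundary charts).\<close>
definition model_space :: "(real^'m) set \<Rightarrow> bool" where
  "model_space P \<longleftrightarrow> P = UNIV \<or> (\<exists>k. P = {u. 0 \<le> u $ k})"

definition hs_chart :: "(real^'n) set \<Rightarrow> (real^'m \<Rightarrow> real^'n) \<Rightarrow> (real^'m) set \<Rightarrow> (real^'m) set \<Rightarrow> bool" where
  "hs_chart S \<phi> W P \<longleftrightarrow> open W \<and> smooth_on \<phi> W \<and>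
     (\<forall>u\<in>W. inj (frechet_derivative \<phi> (at u))) \<and>
     (\<exists>\<psi>. homeomorphism (W \<inter> P) (\<phi> ` (W \<inter> P)) \<phi> \<psi>) \<and>
     (\<exists>V. open V \<and> \<phi> ` (W \<inter> P) = S \<inter> V)"

text \<open>S is a smooth embedded hypersurface, possibly with boundary
  (parameter space real^'m, with CARD('n) = CARD('m) + 1 assumed separately).\<close>
definition smooth_hypersurface :: "('m::finite) itself \<Rightarrow> (real^'n) set \<Rightarrow> bool" where
  "smooth_hypersurface (_ :: ('m::finite) itself) S \<longleftrightarrow>
     (\<forall>p\<in>S. \<exists>(\<phi> :: real^'m \<Rightarrow> real^'n) W P. model_space P \<and> hs_chart S \<phi> W P \<and> p \<in> \<phi> ` (W \<inter> P))"

text \<open>Non-vanishing Gaussian curvature at every point of the manifold interior Int S,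
  i.e. at every point covered by an interior chart (model space the whole R^m).\<close>
definition nonvanishing_gauss_interior :: "('m::finite) itself \<Rightarrow> (real^'n) set \<Rightarrow> bool" where
  "nonvanishing_gauss_interior (_ :: ('m::finite) itself) S \<longleftrightarrow>
     (\<forall>(\<phi> :: real^'m \<Rightarrow> real^'n) W. hs_chart S \<phi> W UNIV \<longrightarrow>
        (\<forall>u\<in>W. \<forall>N. unit_normal \<phi> u N \<longrightarrow> gauss_curvature \<phi> N u \<noteq> 0))"

end

theory Submission
  imports Defs "HOL-Probability.Characteristic_Functions"
begin

text \<open>
  Upper bound: a measure on the cylinder with decay exponent \<open>s\<close> projects to a measure \<open>\<sigma>\<close> on \<open>S\<close> with
  the same decay. Integrating the square of its Fourier transform over a ball of radius about \<open>1 / r\<close>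
  shows that \<open>\<sigma> \<times> \<sigma>\<close> gives mass \<open>O(r\<^sup>s)\<close> to the set of pairs at distance at most \<open>r\<close>. A compact piece of
  \<open>S\<close> splits into \<open>O(r\<^bsup>-(d-1)\<^esup>)\<close> cells of diameter at most \<open>r\<close>, so by Cauchy-Schwarz the square of its mass
  is \<open>O(r\<^bsup>s-(d-1)\<^esup>)\<close>; hence \<open>\<sigma> = 0\<close> as soon as \<open>s > d - 1\<close>.

  Lower bound: push a bump function forward along an interior chart \<open>\<phi>\<close> and multiply by a Gaussian in the
  direction of the axis. Let \<open>\<theta>\<close> be the direction of the frequency. If \<open>\<theta>\<close> is not normal to \<open>S\<close> at the
  centre of the chart, repeated integration by parts gives rapid decay. If it is normal, write the
  square of the modulus of the integral as an integral over \<open>v\<close> of oscillatory integrals with phase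
  \<open>\<theta> \<bullet> \<phi> (u + v) - \<theta> \<bullet> \<phi> u\<close>; nonvanishing curvature makes the gradient of this phase comparable to
  \<open>norm v\<close>, and integrating by parts \<open>d\<close> times in a suitable direction gives the bound
  \<open>O(l\<^bsup>-(d-1)\<^esup>)\<close> for the square. Compactness of the unit sphere makes the bounds uniform in \<open>\<theta>\<close>.
\<close>

section \<open>Bounded directional derivatives\<close>

text \<open>The obstacle is uniformity. The critical points of
  \<open>\<theta> \<bullet> \<phi> u\<close> move with \<theta>, and a stationary phase expansion
  would have to follow them; after squaring, the phase difference for a shift
  \<open>v \<noteq> 0\<close> has no critical point near the centre at all. The price is that the
  useful direction of differentiation depends on \<open>v\<close>, while the constants may depend on
  neither \<theta> nor \<open>v\<close> nor that direction. With m = d - 1 parameters, m + 1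
  integrations by parts bound the integrand in \<open>v\<close> by a multiple of min(1, (l
  |v|)^(-m-1)). The exponent exceeds the dimension m, so this is integrable, and rescaling
  \<open>v\<close> by 1/l produces exactly l^(-m). The axis costs nothing in the lower bound,
  because the Gaussian decays faster than every power. It gains nothing in the upper bound, because
  frequencies orthogonal to the axis see only the projection to \<open>S\<close>. The double
  integral in the upper bound needs |x|^(-s) to be locally integrable in R^d, so the exponent is
  first lowered to a value between d - 1 and d.\<close>

text \<open>Integration by parts uses one direction at a time, so derivatives are recorded along a
  fixed \<open>e\<close> only, and a constant can be chosen before \<open>e\<close>. The same
  \<open>B\<close> bounds every order up to \<open>k\<close>.\<close>

fun bdd_derivs :: "nat \<Rightarrow> 'a::real_normed_vector set \<Rightarrow> 'a \<Rightarrow> real \<Rightarrow> ('a \<Rightarrow> real) \<Rightarrow> bool" where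
  "bdd_derivs 0 U e B f \<longleftrightarrow> continuous_on U f \<and> (\<forall>u\<in>U. \<bar>f u\<bar> \<le> B)"
| "bdd_derivs (Suc k) U e B f \<longleftrightarrow> continuous_on U f \<and> (\<forall>u\<in>U. \<bar>f u\<bar> \<le> B) \<and>
     (\<exists>f'. (\<forall>u\<in>U. ((\<lambda>t. f (u + t *\<^sub>R e)) has_real_derivative f' u) (at 0)) \<and> bdd_derivs k U e B f')"

lemma bdd_derivs_continuous: "bdd_derivs k U e B f \<Longrightarrow> continuous_on U f"
  by (cases k) auto

lemma bdd_derivs_bound: "bdd_derivs k U e B f \<Longrightarrow> u \<in> U \<Longrightarrow> \<bar>f u\<bar> \<le> B"
  by (cases k) auto

lemma bdd_derivs_SucI:
  assumes "continuous_on U f" "\<And>u. u \<in> U \<Longrightarrow> \<bar>f u\<bar> \<le> B"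
    "\<And>u. u \<in> U \<Longrightarrow> ((\<lambda>t. f (u + t *\<^sub>R e)) has_real_derivative f' u) (at 0)"
    "bdd_derivs k U e B f'"
  shows "bdd_derivs (Suc k) U e B f"
  using assms by auto

lemma bdd_derivs_SucE:
  assumes "bdd_derivs (Suc k) U e B f"
  obtains f' where "\<forall>u\<in>U. ((\<lambda>t. f (u + t *\<^sub>R e)) has_real_derivative f' u) (at 0)"
    "bdd_derivs k U e B f'"
  using assms by auto

declare bdd_derivs.simps(2) [simp del]

lemma bdd_derivs_mono: "bdd_derivs k U e B f \<Longrightarrow> B \<le> B' \<Longrightarrow> bdd_derivs k U e B' f"
proof (induction k arbitrary: f)
  case 0
  then show ?case by fastforce
next
  case (Suc k)
  obtain f' where f': "\<forall>u\<in>U. ((\<lambda>t. f (u + t *\<^sub>R e)) has_real_derivative f' u) (at 0)"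
    "bdd_derivs k U e B f'" using Suc.prems(1) by (elim bdd_derivs_SucE) blast
  show ?case
    by (rule bdd_derivs_SucI[OF _ _ bspec[OF f'(1)] Suc.IH[OF f'(2) Suc.prems(2)]])
      (use bdd_derivs_continuous[OF Suc.prems(1)] bdd_derivs_bound[OF Suc.prems(1)] Suc.prems(2) in \<open>force+\<close>)
qed

lemma bdd_derivs_Suc_imp: "bdd_derivs (Suc k) U e B f \<Longrightarrow> bdd_derivs k U e B f"
proof (induction k arbitrary: f)
  case (Suc k)
  obtain f' where f': "\<forall>u\<in>U. ((\<lambda>t. f (u + t *\<^sub>R e)) has_real_derivative f' u) (at 0)"
    "bdd_derivs (Suc k) U e B f'" using bdd_derivs_SucE[OF Suc.prems] by blast
  show ?case
    by (rule bdd_derivs_SucI[OF _ _ bspec[OF f'(1)] Suc.IH[OF f'(2)]])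
      (use bdd_derivs_continuous[OF Suc.prems] bdd_derivs_bound[OF Suc.prems] in auto)
qed (auto simp: bdd_derivs_continuous bdd_derivs_bound)

lemma bdd_derivs_le: "bdd_derivs k U e B f \<Longrightarrow> j \<le> k \<Longrightarrow> bdd_derivs j U e B f"
proof (induction k)
  case (Suc k)
  then show ?case using bdd_derivs_Suc_imp le_Suc_eq by blast
qed simp

lemma bdd_derivs_const: "\<bar>c\<bar> \<le> B \<Longrightarrow> bdd_derivs k U e B (\<lambda>u. c)"
proof (induction k arbitrary: c)
  case (Suc k)
  show ?case
    by (rule bdd_derivs_SucI[where f'="\<lambda>u. 0"]) (use Suc Suc.IH[of 0] in auto)
qed auto

lemma bdd_derivs_add:
  "bdd_derivs k U e A f \<Longrightarrow> bdd_derivs k U e B g \<Longrightarrow> bdd_derivs k U e (A + B) (\<lambda>u. f u + g u)"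
proof (induction k arbitrary: f g)
  case 0
  then show ?case by (auto intro!: continuous_intros order_trans[OF abs_triangle_ineq] add_mono)
next
  case (Suc k)
  from Suc.prems obtain f' g' where
    f': "\<forall>u\<in>U. ((\<lambda>t. f (u + t *\<^sub>R e)) has_real_derivative f' u) (at 0)" "bdd_derivs k U e A f'" and
    g': "\<forall>u\<in>U. ((\<lambda>t. g (u + t *\<^sub>R e)) has_real_derivative g' u) (at 0)" "bdd_derivs k U e B g'"
    by (elim bdd_derivs_SucE) blast
  show ?case
  proof (rule bdd_derivs_SucI[where f'="\<lambda>u. f' u + g' u"])
    show "continuous_on U (\<lambda>u. f u + g u)"
      using Suc.prems by (intro continuous_intros bdd_derivs_continuous)
    show "\<bar>f u + g u\<bar> \<le> A + B" if "u \<in> U" for u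
      using bdd_derivs_bound[OF Suc.prems(1) that] bdd_derivs_bound[OF Suc.prems(2) that] by linarith
  qed (use f' g' Suc.IH in \<open>auto intro!: derivative_intros\<close>)
qed

lemma bdd_derivs_sum:
  assumes "finite I" "\<And>i. i \<in> I \<Longrightarrow> bdd_derivs k U e (B i) (f i)"
  shows "bdd_derivs k U e (\<Sum>i\<in>I. B i) (\<lambda>u. \<Sum>i\<in>I. f i u)"
  using assms by (induction rule: finite_induct) (auto intro: bdd_derivs_add bdd_derivs_const)

text \<open>By the Leibniz rule each derivative of a product is a sum of two products of the same
  kind, so the bound doubles with each order.\<close>

lemma bdd_derivs_mult:
  "bdd_derivs k U e A f \<Longrightarrow> bdd_derivs k U e B g \<Longrightarrow> A \<ge> 0 \<Longrightarrow> B \<ge> 0 \<Longrightarrow>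
     bdd_derivs k U e (2 ^ k * A * B) (\<lambda>u. f u * g u)"
proof (induction k arbitrary: f g)
  case 0
  then show ?case by (auto intro!: continuous_intros mult_mono simp: abs_mult)
next
  case (Suc k)
  from Suc.prems obtain f' g' where
    f': "\<forall>u\<in>U. ((\<lambda>t. f (u + t *\<^sub>R e)) has_real_derivative f' u) (at 0)" "bdd_derivs k U e A f'" and
    g': "\<forall>u\<in>U. ((\<lambda>t. g (u + t *\<^sub>R e)) has_real_derivative g' u) (at 0)" "bdd_derivs k U e B g'"
    by (elim bdd_derivs_SucE) blast
  have fk: "bdd_derivs k U e A f" and gk: "bdd_derivs k U e B g"
    using Suc.prems bdd_derivs_Suc_imp by blast+
  show ?case
  proof (rule bdd_derivs_SucI[where f'="\<lambda>u. f' u * g u + f u * g' u"])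
    show "continuous_on U (\<lambda>u. f u * g u)"
      using Suc.prems by (intro continuous_intros bdd_derivs_continuous)
    have "1 * (A * B) \<le> 2 ^ Suc k * (A * B)"
      using Suc.prems by (intro mult_right_mono) (auto simp: one_le_power simp del: power_Suc)
    moreover have "\<bar>f u * g u\<bar> \<le> A * B" if "u \<in> U" for u
      using bdd_derivs_bound[OF Suc.prems(1) that] bdd_derivs_bound[OF Suc.prems(2) that] Suc.prems
      by (auto simp: abs_mult intro!: mult_mono)
    ultimately show "\<bar>f u * g u\<bar> \<le> 2 ^ Suc k * A * B" if "u \<in> U" for u
      using that by (fastforce simp: mult.assoc)
    show "((\<lambda>t. f (u + t *\<^sub>R e) * g (u + t *\<^sub>R e)) has_real_derivative f' u * g u + f u * g' u) (at 0)"
      if "u \<in> U" for u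
      by (rule DERIV_cong[OF DERIV_mult[OF bspec[OF f'(1) that] bspec[OF g'(1) that]]]) (simp add: algebra_simps)
    have "bdd_derivs k U e (2 ^ k * A * B + 2 ^ k * A * B) (\<lambda>u. f' u * g u + f u * g' u)"
      by (intro bdd_derivs_add Suc.IH f' g' fk gk Suc.prems)
    then show "bdd_derivs k U e (2 ^ Suc k * A * B) (\<lambda>u. f' u * g u + f u * g' u)"
      by (simp add: algebra_simps)
  qed
qed

lemma bdd_derivs_cmult:
  assumes "bdd_derivs k U e A f"
  shows "bdd_derivs k U e (\<bar>c\<bar> * A) (\<lambda>u. c * f u)"
  using assms
proof (induction k arbitrary: f)
  case 0
  then show ?case by (auto intro!: continuous_intros mult_left_mono simp: abs_mult)
next
  case (Suc k)
  then obtain f' where f': "\<forall>u\<in>U. ((\<lambda>t. f (u + t *\<^sub>R e)) has_real_derivative f' u) (at 0)"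
    "bdd_derivs k U e A f'" by (elim bdd_derivs_SucE) blast
  show ?case
    by (rule bdd_derivs_SucI[where f'="\<lambda>u. c * f' u"])
      (use Suc f' bdd_derivs_continuous[OF Suc.prems] bdd_derivs_bound[OF Suc.prems] in \<open>auto intro!: continuous_intros DERIV_cmult mult_left_mono simp: abs_mult\<close>)
qed

text \<open>The derivative of 1/p is -p' times the square of 1/p, so order \<open>k + 1\<close>
  follows from order \<open>k\<close> for 1/p and the product rule. The constant is chosen before
  \<open>U\<close>, \<open>e\<close> and \<open>p\<close>; all later uniformity rests on
  this.\<close>

lemma bdd_derivs_inverse:
  assumes "c > 0" "B \<ge> 0"
  shows "\<exists>C\<ge>0. \<forall>(U :: 'a::real_normed_vector set) e p. bdd_derivs k U e B p \<longrightarrow> (\<forall>u\<in>U. \<bar>p u\<bar> \<ge> c) \<longrightarrow>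
    bdd_derivs k U e C (\<lambda>u. inverse (p u))"
proof (induction k)
  case 0
  show ?case
    using assms by (intro exI[of _ "inverse c"])
      (auto intro!: continuous_intros le_imp_inverse_le)
next
  case (Suc k)
  then obtain C where C: "C \<ge> 0"
    "\<And>(U :: 'a set) e p. bdd_derivs k U e B p \<Longrightarrow> (\<forall>u\<in>U. \<bar>p u\<bar> \<ge> c) \<Longrightarrow> bdd_derivs k U e C (\<lambda>u. inverse (p u))"
    by blast
  define D where "D = max (inverse c) (2 ^ k * B * (2 ^ k * C * C))"
  show ?case
  proof (intro exI[of _ D] conjI allI impI)
    show "D \<ge> 0" using assms by (auto simp: D_def le_max_iff_disj)
    fix U :: "'a set" and e p
    assume p: "bdd_derivs (Suc k) U e B p" and lb: "\<forall>u\<in>U. c \<le> \<bar>p u\<bar>"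
    have nz: "p u \<noteq> 0" if "u \<in> U" for u using lb that assms by force
    from p obtain p' where p': "\<forall>u\<in>U. ((\<lambda>t. p (u + t *\<^sub>R e)) has_real_derivative p' u) (at 0)"
      "bdd_derivs k U e B p'" by (elim bdd_derivs_SucE) blast
    have i: "bdd_derivs k U e C (\<lambda>u. inverse (p u))"
      using C(2) p lb bdd_derivs_Suc_imp by blast
    have n: "bdd_derivs k U e B (\<lambda>u. - p' u)"
      using bdd_derivs_cmult[OF p'(2), of "-1"] by simp
    show "bdd_derivs (Suc k) U e D (\<lambda>u. inverse (p u))"
    proof (rule bdd_derivs_SucI[where f'="\<lambda>u. - p' u * (inverse (p u) * inverse (p u))"])
      show "continuous_on U (\<lambda>u. inverse (p u))"
        using bdd_derivs_continuous[OF p] nz by (intro continuous_intros) auto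
      show "\<bar>inverse (p u)\<bar> \<le> D" if "u \<in> U" for u
        using lb that assms by (auto simp: D_def le_max_iff_disj intro!: disjI1 le_imp_inverse_le)
      show "((\<lambda>t. inverse (p (u + t *\<^sub>R e))) has_real_derivative - p' u * (inverse (p u) * inverse (p u))) (at 0)"
        if "u \<in> U" for u
        by (rule DERIV_cong[OF DERIV_inverse'[OF bspec[OF p'(1) that]]]) (use nz that in auto)
      have "bdd_derivs k U e (2 ^ k * B * (2 ^ k * C * C)) (\<lambda>u. - p' u * (inverse (p u) * inverse (p u)))"
        using C(1) assms by (intro bdd_derivs_mult i n) auto
      then show "bdd_derivs k U e D (\<lambda>u. - p' u * (inverse (p u) * inverse (p u)))"
        by (rule bdd_derivs_mono) (simp add: D_def)
    qed
  qed
qed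

section \<open>Truncated powers and the bump function\<close>

lemma DERIV_max_power: "n \<ge> 1 \<Longrightarrow>
  ((\<lambda>x::real. max 0 x ^ Suc n) has_real_derivative real (Suc n) * max 0 x ^ n) (at x)"
proof -
  assume n: "n \<ge> 1"
  consider "x > 0" | "x < 0" | "x = 0" by linarith
  then show ?thesis
  proof cases
    case 1
    have "\<forall>\<^sub>F y in nhds x. max 0 y ^ Suc n = y ^ Suc n"
      using eventually_nhds_in_open[of "{0<..}" x] 1 by (auto elim!: eventually_mono)
    from DERIV_cong_ev[OF refl this refl] show ?thesis
      using DERIV_pow[of "Suc n" x UNIV] 1 by (simp add: max_def)
  next
    case 2
    have "\<forall>\<^sub>F y in nhds x. max 0 y ^ Suc n = 0"
      using eventually_nhds_in_open[of "{..<0}" x] 2 by (auto elim!: eventually_mono)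
    from DERIV_cong_ev[OF refl this refl] show ?thesis
      using 2 n by (simp add: max_absorb1 zero_power)
  next
    case 3
    \<comment> \<open>At 0 the difference quotient is itself \<open>max 0 h ^ n\<close>, which tends
      to 0 as \<open>n \<ge> 1\<close>.\<close>
    have "((\<lambda>h::real. max 0 h ^ n) \<longlongrightarrow> max 0 0 ^ n) (at 0)"
      by (intro tendsto_intros)
    moreover have "max 0 h ^ n = (max 0 h ^ Suc n) / h" if "h \<noteq> 0" for h :: real
      using that n by (auto simp: max_def)
    ultimately have "((\<lambda>h::real. (max 0 h ^ Suc n) / h) \<longlongrightarrow> max 0 0 ^ n) (at 0)"
      by (subst tendsto_cong[where g="\<lambda>h. max 0 h ^ n"]) (auto simp: eventually_at_filter)
    then show ?thesis using 3 n by (simp add: DERIV_def zero_power)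
  qed
qed

text \<open>A bump function of class \<open>C\<^bsup>n-1\<^esup>\<close>: only finitely many integrations by parts are needed.\<close>

definition bump :: "nat \<Rightarrow> real \<Rightarrow> 'a::real_inner \<Rightarrow> 'a \<Rightarrow> real" where
  "bump n R u0 u = max 0 (R\<^sup>2 - (u - u0) \<bullet> (u - u0)) ^ n"

lemma bump_nonneg: "bump n R u0 u \<ge> 0"
  by (simp add: bump_def)

lemma bump_pos: "R > 0 \<Longrightarrow> dist u0 u < R \<Longrightarrow> bump n R u0 u > 0"
  by (auto simp: bump_def dist_norm norm_minus_commute power2_norm_eq_inner[symmetric]
      intro!: zero_less_power power_strict_mono)

lemma bump_eq_0:
  assumes "n > 0" "R > 0" "dist u0 u \<ge> R"
  shows "bump n R u0 u = 0"
proof -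
  have "R\<^sup>2 \<le> (norm (u - u0))\<^sup>2"
    using assms by (intro power_mono) (auto simp: dist_norm norm_minus_commute)
  then show ?thesis
    using assms by (simp add: bump_def power2_norm_eq_inner zero_power)
qed

lemma bump_continuous: "continuous_on A (bump n R u0)"
  unfolding bump_def by (intro continuous_intros)

text \<open>In \<open>r + 1\<close>, the term \<open>r\<close> bounds the values and 1 bounds the
  constant derivative \<open>e \<bullet> e\<close>. If \<open>r \<le> 0\<close>, the ball is
  empty.\<close>

lemma bdd_derivs_affine:
  assumes "norm (e::'a::real_inner) \<le> 1"
  shows "bdd_derivs k (ball u0 r) e (r + 1) (\<lambda>u. (u - u0) \<bullet> e)"
proof -
  have b: "\<bar>(u - u0) \<bullet> e\<bar> \<le> r + 1" if "u \<in> ball u0 r" for u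
  proof -
    have "\<bar>(u - u0) \<bullet> e\<bar> \<le> norm (u - u0) * norm e" by (rule Cauchy_Schwarz_ineq2)
    also have "\<dots> \<le> r * 1" using that assms le_less_trans[OF norm_ge_zero, of "u0 - u" r]
      by (intro mult_mono) (auto simp: dist_norm norm_minus_commute)
    finally show ?thesis by simp
  qed
  show ?thesis
  proof (cases k)
    case 0
    then show ?thesis using b by (auto intro!: continuous_intros)
  next
    case (Suc j)
    show ?thesis
    proof (cases "r > 0")
      case True
      have "norm e ^ 2 \<le> 1" using assms by (simp add: power_le_one)
      then have "\<bar>e \<bullet> e\<bar> \<le> r + 1" using True by (simp add: power2_norm_eq_inner)
      then have c: "bdd_derivs j (ball u0 r) e (r + 1) (\<lambda>u. e \<bullet> e)" by (rule bdd_derivs_const)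
      show ?thesis unfolding Suc
        by (rule bdd_derivs_SucI[OF _ _ _ c])
          (use b in \<open>auto intro!: continuous_intros derivative_eq_intros simp: inner_left_distrib inner_diff_left\<close>)
    next
      case False
      then have "ball u0 r = {}" by (simp only: ball_eq_empty not_less)
      moreover have "bdd_derivs k {} e (r+1) f" for f :: "'a \<Rightarrow> real"
        by (induction k arbitrary: f) (auto simp: bdd_derivs.simps(2))
      ultimately show ?thesis by metis
    qed
  qed
qed

text \<open>Differentiating lowers the power by one and brings out an affine factor, so the
  induction on \<open>k\<close> also lowers \<open>n\<close>.\<close>

lemma bdd_derivs_bump:
  assumes "r \<ge> 0" "R > 0"
  shows "k < n \<Longrightarrow> \<exists>B\<ge>0. \<forall>e. norm e \<le> 1 \<longrightarrow> bdd_derivs k (ball u0 r) e B (bump n R u0)"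
proof (induction k arbitrary: n)
  have b: "\<bar>bump n R u0 u\<bar> \<le> (R\<^sup>2) ^ n" for n u
    by (auto simp: bump_def intro!: power_mono)
  case 0
  show ?case
    by (rule exI[of _ "(R\<^sup>2) ^ n"]) (use b bump_continuous in auto)
next
  have b: "\<bar>bump n R u0 u\<bar> \<le> (R\<^sup>2) ^ n" for n u
    by (auto simp: bump_def intro!: power_mono)
  case (Suc k)
  then obtain n' where n: "n = Suc n'" and k: "k < n'" by (cases n) auto
  from Suc.IH[OF k] obtain B where B: "B \<ge> 0"
    "\<And>e. norm e \<le> 1 \<Longrightarrow> bdd_derivs k (ball u0 r) e B (bump n' R u0)" by blast
  define D where "D = max ((R\<^sup>2) ^ n) (\<bar>- 2 * real n\<bar> * (2 ^ k * B * (r + 1)))"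
  show ?case
  proof (intro exI[of _ D] conjI allI impI)
    show "D \<ge> 0" using b[of n u0] by (auto simp: D_def le_max_iff_disj)
    fix e :: 'a assume e: "norm e \<le> 1"
    show "bdd_derivs (Suc k) (ball u0 r) e D (bump n R u0)"
    proof (rule bdd_derivs_SucI[where f'="\<lambda>u. - 2 * real n * (bump n' R u0 u * ((u - u0) \<bullet> e))"])
      show "continuous_on (ball u0 r) (bump n R u0)" by (rule bump_continuous)
      show "\<bar>bump n R u0 u\<bar> \<le> D" for u using b[of n u] by (auto simp: D_def le_max_iff_disj)
      have "bdd_derivs k (ball u0 r) e (\<bar>- 2 * real n\<bar> * (2 ^ k * B * (r + 1)))
        (\<lambda>u. - 2 * real n * (bump n' R u0 u * ((u - u0) \<bullet> e)))"
        using assms B(1) by (intro bdd_derivs_cmult bdd_derivs_mult B(2) e bdd_derivs_affine) auto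
      then show "bdd_derivs k (ball u0 r) e D (\<lambda>u. - 2 * real n * (bump n' R u0 u * ((u - u0) \<bullet> e)))"
        by (rule bdd_derivs_mono) (simp add: D_def)
      fix u
      have 1: "((\<lambda>t. R\<^sup>2 - (u + t *\<^sub>R e - u0) \<bullet> (u + t *\<^sub>R e - u0)) has_real_derivative - 2 * ((u - u0) \<bullet> e)) (at 0)"
      proof -
        have "(\<lambda>t. R\<^sup>2 - (u + t *\<^sub>R e - u0) \<bullet> (u + t *\<^sub>R e - u0)) =
          (\<lambda>t. R\<^sup>2 - (u - u0) \<bullet> (u - u0) - 2 * t * ((u - u0) \<bullet> e) - t\<^sup>2 * (e \<bullet> e))"
          by (auto simp: fun_eq_iff inner_left_distrib inner_right_distrib inner_diff_left inner_diff_right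
              power2_eq_square inner_commute algebra_simps)
        then show ?thesis by (auto intro!: derivative_eq_intros)
      qed
      have "n' \<ge> 1" using k by simp
      from DERIV_chain2[OF DERIV_max_power[OF this] 1]
      show "((\<lambda>t. bump n R u0 (u + t *\<^sub>R e)) has_real_derivative - 2 * real n * (bump n' R u0 u * ((u - u0) \<bullet> e))) (at 0)"
        unfolding bump_def n by (rule DERIV_cong) (simp add: algebra_simps)
    qed
  qed
qed

lemma bdd_derivs_translate:
  assumes "\<And>u. u \<in> U \<Longrightarrow> u + v \<in> V"
  shows "bdd_derivs k V e B f \<Longrightarrow> bdd_derivs k U e B (\<lambda>u. f (u + v))"
proof (induction k arbitrary: f)
  case 0
  then show ?case
    using assms by (auto intro!: continuous_on_compose2[of V f] continuous_intros)
next
  case (Suc k)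
  then obtain f' where f': "\<forall>u\<in>V. ((\<lambda>t. f (u + t *\<^sub>R e)) has_real_derivative f' u) (at 0)"
    "bdd_derivs k V e B f'" by (elim bdd_derivs_SucE) blast
  show ?case
  proof (rule bdd_derivs_SucI[where f'="\<lambda>u. f' (u + v)"])
    show "continuous_on U (\<lambda>u. f (u + v))"
      using assms bdd_derivs_continuous[OF Suc.prems]
      by (auto intro!: continuous_on_compose2[of V f] continuous_intros)
    show "((\<lambda>t. f (u + t *\<^sub>R e + v)) has_real_derivative f' (u + v)) (at 0)" if "u \<in> U" for u
      using bspec[OF f'(1) assms[OF that]] by (simp add: algebra_simps)
  qed (use Suc.IH f' assms bdd_derivs_bound[OF Suc.prems] in auto)
qed

section \<open>Integration by parts along a direction\<close>

lemma lborel_integral_translate: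
  fixes f :: "'a::euclidean_space \<Rightarrow> 'b::{banach, second_countable_topology}"
  assumes "f \<in> borel_measurable borel"
  shows "(LINT u|lborel. f (u + c)) = (LINT u|lborel. f u)"
proof -
  have "(LINT u|lborel. f u) = (LINT u|distr lborel borel ((+) c). f u)"
    by (simp add: lborel_distr_plus)
  also have "\<dots> = (LINT u|lborel. f (c + u))"
    using assms by (subst integral_distr) auto
  finally show ?thesis by (simp add: add.commute)
qed

lemma lborel_integrable_translate:
  fixes f :: "'a::euclidean_space \<Rightarrow> 'b::{banach, second_countable_topology}"
  assumes "integrable lborel f"
  shows "integrable lborel (\<lambda>u. f (u + c))"
proof -
  have [measurable]: "f \<in> borel_measurable borel" using assms by auto
  have "integrable (distr lborel borel ((+) c)) f"
    using assms by (simp add: lborel_distr_plus)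
  then have "integrable lborel (\<lambda>u. f (c + u))"
    by (subst (asm) integrable_distr_eq) auto
  then show ?thesis by (simp add: add.commute)
qed

lemma eventually_line_in_open:
  fixes u e :: "'a::real_normed_vector"
  assumes "open U" "u \<in> U"
  shows "\<forall>\<^sub>F t in nhds (0::real). u + t *\<^sub>R e \<in> U"
proof -
  have "((\<lambda>t. u + t *\<^sub>R e) \<longlongrightarrow> u + 0 *\<^sub>R e) (nhds (0::real))"
    by (intro tendsto_intros filterlim_ident)
  then show ?thesis
    by (rule topological_tendstoD) (use assms in auto)
qed

text \<open>Each difference quotient of the zero extension of \<open>F\<close> integrates to 0 by
  translation invariance, and dominated convergence carries this to the derivative. Neither Fubini
  along lines nor a change of coordinates is involved.\<close>

lemma integral_directional_derivative_eq_0: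
  fixes F F' :: "'a::euclidean_space \<Rightarrow> complex"
  assumes U: "open U" and K: "compact K" "K \<subseteq> U"
    and F: "continuous_on U F" and F': "continuous_on U F'"
    and D: "\<And>u. u \<in> U \<Longrightarrow> ((\<lambda>t. F (u + t *\<^sub>R e)) has_vector_derivative F' u) (at 0)"
    and Z: "\<And>u. u \<in> U - K \<Longrightarrow> F u = 0"
  shows "(LINT u|lborel. indicator K u *\<^sub>R F' u) = 0"
proof -
  define F0 where "F0 u = indicator K u *\<^sub>R F u" for u
  define F1 where "F1 u = indicator K u *\<^sub>R F' u" for u
  have int0: "integrable lborel F0" and int1: "integrable lborel F1"
    unfolding F0_def F1_def using K F F'
    by (auto intro!: borel_integrable_compact intro: continuous_on_subset)
  have F0_eq: "F0 u = F u" if "u \<in> U" for u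
    using Z that by (auto simp: F0_def indicator_def)
  \<comment> \<open>The zero extension agrees with \<open>F\<close> on the open set \<open>U\<close>
    and vanishes on the open complement of \<open>K\<close>; these two sets cover the space.\<close>
  have D0: "((\<lambda>t. F0 (u + t *\<^sub>R e)) has_vector_derivative F1 u) (at 0)" for u
  proof (cases "u \<in> K")
    case True
    then have "u \<in> U" using K by auto
    from eventually_line_in_open[OF U this, of e]
    have "\<forall>\<^sub>F t in nhds (0::real). F (u + t *\<^sub>R e) = F0 (u + t *\<^sub>R e)"
      by eventually_elim (simp add: F0_eq)
    then show ?thesis
      using D[OF \<open>u \<in> U\<close>] has_vector_derivative_cong_ev[of UNIV "\<lambda>t. F (u + t *\<^sub>R e)" "\<lambda>t. F0 (u + t *\<^sub>R e)" 0]
        True \<open>u \<in> U\<close> by (simp add: F1_def F0_eq)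
  next
    case False
    have "open (-K)" using K by (simp add: compact_imp_closed open_Compl)
    from eventually_line_in_open[OF this, of u e] False
    have "\<forall>\<^sub>F t in nhds (0::real). 0 = F0 (u + t *\<^sub>R e)"
      by (auto simp: F0_def elim: eventually_mono)
    then show ?thesis
      using has_vector_derivative_cong_ev[of UNIV "\<lambda>t. 0" "\<lambda>t. F0 (u + t *\<^sub>R e)" 0 "F1 u"] False
      by (simp add: F1_def F0_def)
  qed
  have Ds: "((\<lambda>t. F0 (u + t *\<^sub>R e)) has_vector_derivative F1 (u + s *\<^sub>R e)) (at s)" for u s
  proof -
    have a: "((\<lambda>t. t - s) has_vector_derivative 1) (at s)"
      by (auto intro!: derivative_eq_intros)
    have "((\<lambda>t. F0 ((u + s *\<^sub>R e) + t *\<^sub>R e)) has_vector_derivative F1 (u + s *\<^sub>R e)) (at (s - s))"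
      using D0[of "u + s *\<^sub>R e"] by simp
    from vector_diff_chain_at[OF a this] show ?thesis
      by (simp add: o_def algebra_simps)
  qed
  obtain M where M: "M \<ge> 0" "\<And>u. norm (F1 u) \<le> M"
  proof -
    have "compact (F' ` K)"
      using K F' by (intro compact_continuous_image) (auto intro: continuous_on_subset)
    then obtain M where "M > 0" "\<forall>x\<in>F' ` K. norm x \<le> M"
      using compact_imp_bounded bounded_pos by metis
    then show ?thesis
      by (intro that[of M]) (auto simp: F1_def indicator_def)
  qed
  have lip: "norm (F0 (u + t *\<^sub>R e) - F0 u) \<le> M * \<bar>t\<bar>" for u t
  proof -
    have "norm (F0 (u + t *\<^sub>R e) - F0 (u + 0 *\<^sub>R e)) \<le> M * norm (t - 0)"
    proof (rule differentiable_bound[where S=UNIV])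
      show "((\<lambda>t. F0 (u + t *\<^sub>R e)) has_derivative (\<lambda>h. h *\<^sub>R F1 (u + s *\<^sub>R e))) (at s within UNIV)" for s
        using Ds[of u s] by (simp add: has_vector_derivative_def)
      show "onorm (\<lambda>h. h *\<^sub>R F1 (u + s *\<^sub>R e)) \<le> M" for s
        by (rule onorm_bound) (use M in \<open>auto simp: mult.commute[of M] intro!: mult_left_mono\<close>)
    qed auto
    then show ?thesis by simp
  qed
  obtain r where r: "\<And>u. u \<in> K \<Longrightarrow> norm u \<le> r"
    using K compact_imp_bounded bounded_iff by metis
  define q where "q n u = real (Suc n) *\<^sub>R (F0 (u + (1 / real (Suc n)) *\<^sub>R e) - F0 u)" for n u
  have "(\<lambda>n. LINT u|lborel. q n u) \<longlonglongrightarrow> (LINT u|lborel. F1 u)"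
  proof (rule integral_dominated_convergence)
    show "F1 \<in> borel_measurable lborel" using int1 by auto
    show "q n \<in> borel_measurable lborel" for n
      using int0 unfolding q_def[abs_def]
      by (intro borel_measurable_scaleR borel_measurable_diff borel_measurable_const
          borel_measurable_integrable lborel_integrable_translate)
    \<comment> \<open>The shifts have length at most \<open>norm e\<close>, so all quotients live in
      this ball; there the Lipschitz bound along \<open>e\<close> gives \<open>M\<close>.\<close>
    show "integrable lborel (\<lambda>u. indicator (cball 0 (r + norm e)) u *\<^sub>R M)"
      by (intro borel_integrable_compact) auto
    have "(\<lambda>n. q n u) \<longlonglongrightarrow> F1 u" for u
    proof -
      have "((\<lambda>h. (F0 (u + h *\<^sub>R e) - F0 u) /\<^sub>R h) \<longlongrightarrow> F1 u) (at 0)"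
      proof (rule LIM_zero_cancel)
        have "((\<lambda>h. norm (F0 (u + h *\<^sub>R e) - F0 u - h *\<^sub>R F1 u) / norm h) \<longlongrightarrow> 0) (at (0::real))"
          using D0[of u] by (simp add: has_vector_derivative_def has_derivative_at)
        moreover have "\<forall>\<^sub>F h in at (0::real). norm (F0 (u + h *\<^sub>R e) - F0 u - h *\<^sub>R F1 u) / norm h =
            norm ((F0 (u + h *\<^sub>R e) - F0 u) /\<^sub>R h - F1 u)"
          unfolding eventually_at_filter
        proof (rule always_eventually, intro allI impI)
          fix h :: real assume "h \<noteq> 0"
          then have "(F0 (u + h *\<^sub>R e) - F0 u) /\<^sub>R h - F1 u = (F0 (u + h *\<^sub>R e) - F0 u - h *\<^sub>R F1 u) /\<^sub>R h"
            by (simp add: scaleR_diff_right)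
          then show "norm (F0 (u + h *\<^sub>R e) - F0 u - h *\<^sub>R F1 u) / norm h =
            norm ((F0 (u + h *\<^sub>R e) - F0 u) /\<^sub>R h - F1 u)" by (simp add: divide_inverse_commute)
        qed
        ultimately have "((\<lambda>h. norm ((F0 (u + h *\<^sub>R e) - F0 u) /\<^sub>R h - F1 u)) \<longlongrightarrow> 0) (at (0::real))"
          by (rule Lim_transform_eventually)
        then show "((\<lambda>h. (F0 (u + h *\<^sub>R e) - F0 u) /\<^sub>R h - F1 u) \<longlongrightarrow> 0) (at (0::real))"
          by (rule tendsto_norm_zero_cancel)
      qed
      moreover have "filterlim (\<lambda>n. 1 / real (Suc n)) (at 0) sequentially"
        unfolding filterlim_at using LIMSEQ_Suc[OF lim_1_over_n] by auto
      ultimately have "(\<lambda>n. (F0 (u + (1 / real (Suc n)) *\<^sub>R e) - F0 u) /\<^sub>R (1 / real (Suc n))) \<longlonglongrightarrow> F1 u"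
        by (rule filterlim_compose)
      then show ?thesis by (simp add: q_def divide_inverse)
    qed
    then show "AE u in lborel. (\<lambda>n. q n u) \<longlonglongrightarrow> F1 u" by simp
    have "norm (q n u) \<le> indicator (cball 0 (r + norm e)) u *\<^sub>R M" for n u
    proof (cases "u \<in> cball 0 (r + norm e)")
      case True
      have "norm (q n u) \<le> real (Suc n) * (M * \<bar>1 / real (Suc n)\<bar>)"
        unfolding q_def norm_scaleR
        using lip[of u "1 / real (Suc n)"] by (intro mult_mono) (auto simp del: of_nat_Suc)
      also have "\<dots> = M" by simp
      finally show ?thesis using True by simp
    next
      case False
      have "u \<notin> K" using False r[of u] norm_ge_zero[of e] by fastforce
      moreover have "u + (1 / real (Suc n)) *\<^sub>R e \<notin> K"
      proof
        assume "u + (1 / real (Suc n)) *\<^sub>R e \<in> K"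
        then have "norm (u + (1 / real (Suc n)) *\<^sub>R e) \<le> r" by (rule r)
        moreover have "norm ((1 / real (Suc n)) *\<^sub>R e) \<le> norm e"
          by (simp add: divide_le_eq algebra_simps)
        ultimately have "norm u \<le> r + norm e"
          using norm_triangle_ineq4[of "u + (1 / real (Suc n)) *\<^sub>R e" "(1 / real (Suc n)) *\<^sub>R e"] by simp
        then show False using False by simp
      qed
      ultimately show ?thesis using M by (simp add: q_def F0_def)
    qed
    then show "AE u in lborel. norm (q n u) \<le> indicator (cball 0 (r + norm e)) u *\<^sub>R M" for n by simp
  qed
  moreover have "(LINT u|lborel. q n u) = 0" for n
  proof -
    have "(LINT u|lborel. q n u) = real (Suc n) *\<^sub>R
        ((LINT u|lborel. F0 (u + (1 / real (Suc n)) *\<^sub>R e)) - (LINT u|lborel. F0 u))"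
      unfolding q_def using int0 by (simp add: lborel_integrable_translate del: of_nat_Suc)
    then show ?thesis
      using int0 by (simp add: lborel_integral_translate borel_measurable_integrable)
  qed
  ultimately show ?thesis
    by (simp add: F1_def LIMSEQ_const_iff)
qed

text \<open>The derivative along \<open>e\<close> of (b / p) cis(l \<psi>) is (b / p)' cis(l \<psi>)
  + i l b cis(l \<psi>) and has integral 0. Hence the integral with amplitude \<open>b\<close>
  equals, up to a factor of modulus 1/l, the one with amplitude (b / p)', which has one derivative
  less at its disposal.\<close>

lemma oscillatory_integral_iterate:
  fixes U K :: "'a::euclidean_space set"
  assumes U: "open U" and K: "compact K" "K \<subseteq> U"
    and psi: "continuous_on U \<psi>" "\<And>u. u \<in> U \<Longrightarrow> ((\<lambda>t. \<psi> (u + t *\<^sub>R e)) has_real_derivative p u) (at 0)"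
    and p: "\<And>u. u \<in> U \<Longrightarrow> p u \<noteq> 0" and g: "bdd_derivs N U e G (\<lambda>u. inverse (p u))"
    and pos: "l > 0" "G \<ge> 0"
  shows "n \<le> N \<Longrightarrow> bdd_derivs n U e B b \<Longrightarrow> B \<ge> 0 \<Longrightarrow> (\<And>u. u \<in> U - K \<Longrightarrow> b u = 0) \<Longrightarrow>
    cmod (LINT u|lborel. indicator K u *\<^sub>R (of_real (b u) * cis (l * \<psi> u))) \<le> (2 ^ N * G / l) ^ n * B * measure lborel K"
proof (induction n arbitrary: b B)
  case 0
  have "cmod (LINT u|lborel. indicator K u *\<^sub>R (of_real (b u) * cis (l * \<psi> u))) \<le> (LINT u|lborel. indicator K u *\<^sub>R B)"
  proof (rule Bochner_Integration.integral_norm_bound_integral)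
    have "continuous_on K b" "continuous_on K \<psi>"
      using bdd_derivs_continuous[OF "0.prems"(2)] psi(1) K continuous_on_subset by blast+
    then show "integrable lborel (\<lambda>u. indicator K u *\<^sub>R (of_real (b u) * cis (l * \<psi> u)))"
      by (intro borel_integrable_compact K continuous_intros)
    show "integrable lborel (\<lambda>u. indicator K u *\<^sub>R B)"
      by (intro borel_integrable_compact K continuous_intros)
    show "cmod (indicator K u *\<^sub>R (of_real (b u) * cis (l * \<psi> u))) \<le> indicator K u *\<^sub>R B" for u
      using bdd_derivs_bound[OF "0.prems"(2), of u] K by (auto simp: norm_mult indicator_def)
  qed
  also have "\<dots> = B * measure lborel K"
    using K by (simp add: borel_compact)
  finally show ?case by simp
next
  case (Suc n)
  let ?g = "\<lambda>u. inverse (p u)"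
  have g': "bdd_derivs (Suc n) U e G ?g" using g Suc.prems(1) by (rule bdd_derivs_le)
  have "bdd_derivs (Suc n) U e (2 ^ Suc n * B * G) (\<lambda>u. b u * ?g u)"
    by (intro bdd_derivs_mult Suc.prems g' pos)
  \<comment> \<open>Enlarging \<open>2 ^ Suc n\<close> to \<open>2 ^ N\<close> makes the factor the
    same in every round.\<close>
  then have bg: "bdd_derivs (Suc n) U e (2 ^ N * B * G) (\<lambda>u. b u * ?g u)"
    using Suc.prems pos by (elim bdd_derivs_mono) (intro mult_right_mono power_increasing; simp)
  then obtain c where c: "\<forall>u\<in>U. ((\<lambda>t. b (u + t *\<^sub>R e) * ?g (u + t *\<^sub>R e)) has_real_derivative c u) (at 0)"
    "bdd_derivs n U e (2 ^ N * B * G) c" using bdd_derivs_SucE[OF bg] by blast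
  \<comment> \<open>The new amplitude must again vanish off \<open>K\<close> for the induction
    hypothesis to apply.\<close>
  have c0: "c u = 0" if u: "u \<in> U - K" for u
  proof -
    have "open (U - K)" using U K by (simp add: compact_imp_closed open_Diff)
    from eventually_line_in_open[OF this u, of e]
    have "\<forall>\<^sub>F t in nhds 0. b (u + t *\<^sub>R e) * ?g (u + t *\<^sub>R e) = 0"
      by eventually_elim (use Suc.prems(4) in auto)
    from DERIV_cong_ev[OF refl this refl] c(1) u
    have "((\<lambda>t::real. 0) has_real_derivative c u) (at 0)" by auto
    then show ?thesis using DERIV_unique[OF _ DERIV_const] by blast
  qed
  define F where "F u = of_real (b u * ?g u) * cis (l * \<psi> u)" for u
  define F' where "F' u = of_real (c u) * cis (l * \<psi> u) + \<i> * of_real l * (of_real (b u) * cis (l * \<psi> u))" for u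
  have cb: "continuous_on U b" "continuous_on U ?g" "continuous_on U c"
    using bdd_derivs_continuous Suc.prems(2) g c(2) by blast+
  have "(LINT u|lborel. indicator K u *\<^sub>R F' u) = 0"
  proof (rule integral_directional_derivative_eq_0[OF U K, of F F' e])
    show "continuous_on U F" "continuous_on U F'"
      unfolding F_def F'_def by (intro continuous_intros cb psi)+
    show "F u = 0" if "u \<in> U - K" for u using Suc.prems(4)[OF that] by (simp add: F_def)
    fix u assume u: "u \<in> U"
    have 1: "((\<lambda>t. complex_of_real (b (u + t *\<^sub>R e) * ?g (u + t *\<^sub>R e))) has_vector_derivative of_real (c u)) (at 0)"
      using c(1) u by (intro has_vector_derivative_of_real) (auto simp: has_real_derivative_iff_has_vector_derivative)
    have "((\<lambda>t. l * \<psi> (u + t *\<^sub>R e)) has_derivative (\<lambda>x. (l * p u) * x)) (at 0)"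
      using DERIV_cmult[OF psi(2)[OF u], of l] by (simp add: has_field_derivative_def)
    from has_derivative_cis[OF this]
    have 2: "((\<lambda>t. cis (l * \<psi> (u + t *\<^sub>R e))) has_vector_derivative (l * p u) *\<^sub>R (\<i> * cis (l * \<psi> u))) (at 0)"
      by (simp add: has_vector_derivative_def mult.commute)
    show "((\<lambda>t. F (u + t *\<^sub>R e)) has_vector_derivative F' u) (at 0)"
      unfolding F_def F'_def
      by (rule has_vector_derivative_eq_rhs[OF has_vector_derivative_mult[OF 1 2]])
        (use p[OF u] in \<open>simp add: scaleR_conv_of_real field_simps\<close>)
  qed
  moreover have "(LINT u|lborel. indicator K u *\<^sub>R F' u) =
     (LINT u|lborel. indicator K u *\<^sub>R (of_real (c u) * cis (l * \<psi> u))) +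
     \<i> * of_real l * (LINT u|lborel. indicator K u *\<^sub>R (of_real (b u) * cis (l * \<psi> u)))"
  proof -
    have i: "integrable lborel (\<lambda>u. indicator K u *\<^sub>R (of_real (f u) * cis (l * \<psi> u)))" if "continuous_on U f" for f
      using that K psi(1) by (intro borel_integrable_compact continuous_intros) (auto intro: continuous_on_subset)
    have "(\<lambda>u. indicator K u *\<^sub>R F' u) = (\<lambda>u. indicator K u *\<^sub>R (of_real (c u) * cis (l * \<psi> u)) +
        (\<i> * of_real l) * (indicator K u *\<^sub>R (of_real (b u) * cis (l * \<psi> u))))"
      by (auto simp: F'_def fun_eq_iff indicator_def)
    then show ?thesis
      by (simp only: Bochner_Integration.integral_add[OF i[OF cb(3)] integrable_mult_right[OF i[OF cb(1)]]]
          integral_mult_right_zero)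
  qed
  ultimately have "cmod (\<i> * of_real l * (LINT u|lborel. indicator K u *\<^sub>R (of_real (b u) * cis (l * \<psi> u)))) =
     cmod (LINT u|lborel. indicator K u *\<^sub>R (of_real (c u) * cis (l * \<psi> u)))"
    by (simp only: add_eq_0_iff[of "LINT u|lborel. indicator K u *\<^sub>R (of_real (c u) * cis (l * \<psi> u))"] norm_minus_cancel)
  then have "l * cmod (LINT u|lborel. indicator K u *\<^sub>R (of_real (b u) * cis (l * \<psi> u))) \<le>
      (2 ^ N * G / l) ^ n * (2 ^ N * B * G) * measure lborel K"
    using Suc.IH[OF _ c(2) _ c0] Suc.prems pos by (simp add: norm_mult)
  then show ?case using pos(1) by (simp add: field_simps)
qed

text \<open>The order of the quantifiers is the content: \<open>C\<close> is fixed before the phase,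
  the direction, the amplitude and \<open>l\<close>, so one constant serves a whole family of
  integrals obeying the same bounds.\<close>

lemma nonstationary_phase:
  fixes N :: nat
  assumes "c > 0" "P \<ge> 0" "A \<ge> 0"
  shows "\<exists>C\<ge>0. \<forall>(U :: 'a::euclidean_space set) K e \<psi> p b l.
    open U \<longrightarrow> compact K \<longrightarrow> K \<subseteq> U \<longrightarrow> continuous_on U \<psi> \<longrightarrow>
    (\<forall>u\<in>U. ((\<lambda>t. \<psi> (u + t *\<^sub>R e)) has_real_derivative p u) (at 0)) \<longrightarrow>
    (\<forall>u\<in>U. c \<le> \<bar>p u\<bar>) \<longrightarrow> bdd_derivs N U e P p \<longrightarrow> bdd_derivs N U e A b \<longrightarrow>
    (\<forall>u\<in>U - K. b u = 0) \<longrightarrow> l > 0 \<longrightarrow>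
    cmod (LINT u|lborel. indicator K u *\<^sub>R (of_real (b u) * cis (l * \<psi> u))) \<le> C * measure lborel K / l ^ N"
proof -
  obtain G where G: "G \<ge> 0" "\<forall>(U :: 'a set) e p. bdd_derivs N U e P p \<longrightarrow> (\<forall>u\<in>U. c \<le> \<bar>p u\<bar>) \<longrightarrow>
    bdd_derivs N U e G (\<lambda>u. inverse (p u))"
    using bdd_derivs_inverse[OF assms(1,2), of N] by blast
  show ?thesis
  proof (intro exI[of _ "(2 ^ N * G) ^ N * A"] conjI allI impI)
    show "0 \<le> (2 ^ N * G) ^ N * A" using G assms by simp
    fix U K :: "'a set" and e \<psi> p b and l :: real
    assume *: "open U" "compact K" "K \<subseteq> U" "continuous_on U \<psi>"
      "\<forall>u\<in>U. ((\<lambda>t. \<psi> (u + t *\<^sub>R e)) has_real_derivative p u) (at 0)"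
      "\<forall>u\<in>U. c \<le> \<bar>p u\<bar>" "bdd_derivs N U e P p" "bdd_derivs N U e A b"
      "\<forall>u\<in>U - K. b u = 0" "l > 0"
    have "cmod (LINT u|lborel. indicator K u *\<^sub>R (of_real (b u) * cis (l * \<psi> u))) \<le> (2 ^ N * G / l) ^ N * A * measure lborel K"
      by (rule oscillatory_integral_iterate[where U=U and p=p and e=e]) (use * G assms in force)+
    then show "cmod (LINT u|lborel. indicator K u *\<^sub>R (of_real (b u) * cis (l * \<psi> u))) \<le> (2 ^ N * G) ^ N * A * measure lborel K / l ^ N"
      by (simp add: power_divide)
  qed
qed

section \<open>Autocorrelation and radial integrals\<close>

text \<open>The product of the integral and its conjugate is a double integral; translating one
  variable by the other and moving the norm inside the outer integral gives the bound. For an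
  oscillating \<open>f\<close> the inner integrand carries the phase difference.\<close>

lemma norm_integral_squared_le_autocorrelation:
  fixes f :: "'a::euclidean_space \<Rightarrow> complex"
  assumes f: "integrable lborel f"
  shows "ennreal ((cmod (LINT u|lborel. f u))\<^sup>2) \<le>
    (\<integral>\<^sup>+v. ennreal (cmod (LINT u|lborel. f (u + v) * cnj (f u))) \<partial>lborel)"
proof -
  have [measurable]: "f \<in> borel_measurable borel" using f by auto
  have [measurable]: "(\<lambda>u. cnj (f u)) \<in> borel_measurable borel"
    by (intro borel_measurable_continuous_on[where f=cnj] continuous_intros) auto
  have tr: "(LINT v|lborel. f (u + v)) = (LINT v|lborel. f v)" for u
    using lborel_integral_translate[of f u] by (simp add: add.commute)
  have ntr: "(LINT v|lborel. cmod (f (u + v))) = (LINT v|lborel. cmod (f v))" for u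
    using lborel_integral_translate[of "\<lambda>v. cmod (f v)" u] by (simp add: add.commute)
  let ?H = "\<lambda>u v. f (u + v) * cnj (f u)"
  have H: "integrable (lborel \<Otimes>\<^sub>M lborel) (case_prod ?H)"
  proof (rule lborel_pair.Fubini_integrable)
    show "case_prod ?H \<in> borel_measurable (lborel \<Otimes>\<^sub>M lborel)" by measurable
    have "(LINT v|lborel. norm (case_prod ?H (u, v))) = (LINT v|lborel. cmod (f v)) * cmod (f u)" for u
      by (simp add: norm_mult ntr)
    then show "integrable lborel (\<lambda>u. LINT v|lborel. norm (case_prod ?H (u, v)))"
      using f by simp
    show "AE u in lborel. integrable lborel (\<lambda>v. case_prod ?H (u, v))"
      using integrable_mult_left[OF lborel_integrable_translate[OF f]] by (simp add: add.commute)
  qed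
  let ?I = "LINT u|lborel. f u"
  have "(LINT v|lborel. LINT u|lborel. ?H u v) = (LINT u|lborel. LINT v|lborel. ?H u v)"
    by (rule lborel_pair.Fubini_integral[OF H])
  also have "\<dots> = (LINT u|lborel. ?I * cnj (f u))"
    by (simp add: tr)
  also have "\<dots> = ?I * cnj ?I" using f by simp
  finally have eq: "(LINT v|lborel. LINT u|lborel. ?H u v) = ?I * cnj ?I" .
  have "integrable lborel (\<lambda>v. LINT u|lborel. ?H u v)"
    using lborel_pair.integrable_snd[OF H] by simp
  from integral_norm_bound_ennreal[OF this] show ?thesis
    unfolding eq by (simp add: norm_mult power2_eq_square)
qed

section \<open>Dyadic sums for radial integrands\<close>

lemma suminf_geometric_ennreal:
  fixes q K :: real
  assumes "0 \<le> q" "q < 1" "0 \<le> K"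
  shows "(\<Sum>j. ennreal (K * q ^ j)) = ennreal (K / (1 - q))"
proof -
  have "(\<lambda>j. K * q ^ j) sums (K * (1 / (1 - q)))"
    using assms by (intro sums_mult geometric_sums) auto
  then show ?thesis
    using assms by (subst suminf_ennreal_eq[of _ "K / (1 - q)"]) auto
qed

lemma ennreal_le_suminf:
  fixes f :: "nat \<Rightarrow> ennreal"
  shows "f j \<le> (\<Sum>i. f i)"
  using sum_le_suminf[of f "{j}"] by auto

text \<open>With d the dimension, \<open>J\<close> is dominated on dyadic balls of radius 2^j / l by
  heights of order 2^(-j (d + 1)), against volumes of order 2^(j d) / l^d. The surplus power leaves
  a geometric series of ratio 1/2. The factor \<open>2 ^ Suc DIM('a)\<close> is lost because
  \<open>l * norm v\<close> is only known to exceed 2^(j - 1).\<close>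

lemma nn_integral_power_decay:
  assumes "A \<ge> 0"
  shows "\<exists>C\<ge>0. \<forall>l>0. \<forall>J :: 'a::euclidean_space \<Rightarrow> real. (\<forall>v. J v \<le> A) \<longrightarrow>
    (\<forall>v. v \<noteq> 0 \<longrightarrow> J v \<le> A / (l * norm v) ^ Suc DIM('a)) \<longrightarrow>
    (\<integral>\<^sup>+v. ennreal (J v) \<partial>lborel) \<le> ennreal (C / l ^ DIM('a))"
proof -
  have [measurable]: "cball (0::'a) r \<in> sets borel" for r by simp
  let ?d = "DIM('a)"
  let ?V = "unit_ball_vol (real ?d)"
  define K where "K = A * 2 ^ Suc ?d * ?V"
  have K: "K \<ge> 0" using assms by (simp add: K_def)
  show ?thesis
  proof (intro exI[of _ "2 * K"] conjI allI impI)
    show "0 \<le> 2 * K" using K by simp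
    fix l :: real and J :: "'a \<Rightarrow> real"
    assume l: "l > 0" and J1: "\<forall>v. J v \<le> A" and J2: "\<forall>v. v \<noteq> 0 \<longrightarrow> J v \<le> A / (l * norm v) ^ Suc ?d"
    define c where "c j = A * 2 ^ Suc ?d / (2 ^ j) ^ Suc ?d" for j :: nat
    have c: "c j \<ge> 0" for j using assms by (simp add: c_def)
    have pw: "ennreal (J v) \<le> (\<Sum>j. ennreal (c j) * indicator (cball 0 (2 ^ j / l)) v)" for v
    proof -
      obtain j where j: "l * norm v \<le> 2 ^ j" and min: "\<And>i. i < j \<Longrightarrow> \<not> l * norm v \<le> 2 ^ i"
      proof -
        obtain n where "l * norm v < 2 ^ n"
          using real_arch_pow[of 2 "l * norm v"] by auto
        then have "\<exists>n. l * norm v \<le> 2 ^ n" using less_imp_le by blast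
        from LeastI_ex[OF this] not_less_Least show ?thesis by (intro that) auto
      qed
      have "J v \<le> c j"
      proof (cases j)
        case 0
        have "A * 1 \<le> A * 2 ^ Suc ?d" using assms by (intro mult_left_mono) (auto intro: one_le_power simp del: power_Suc)
        then show ?thesis using J1 0 by (auto simp: c_def intro: order_trans)
      next
        case (Suc i)
        then have i: "2 ^ i < l * norm v" using min[of i] by simp
        then have "v \<noteq> 0" by (auto simp: not_less)
        then have "J v \<le> A / (l * norm v) ^ Suc ?d" using J2 by blast
        also have "\<dots> \<le> A / (2 ^ i) ^ Suc ?d"
          using assms i l \<open>v \<noteq> 0\<close> by (intro divide_left_mono power_mono mult_pos_pos zero_less_power) auto
        also have "\<dots> = c j" using Suc by (simp add: c_def power_mult_distrib field_simps)
        finally show ?thesis .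
      qed
      then have "ennreal (J v) \<le> ennreal (c j) * indicator (cball 0 (2 ^ j / l)) v"
        using j l by (auto simp: indicator_def field_simps ennreal_leI)
      also have "\<dots> \<le> (\<Sum>j. ennreal (c j) * indicator (cball 0 (2 ^ j / l)) v)"
        by (rule ennreal_le_suminf)
      finally show ?thesis .
    qed
    have "(\<integral>\<^sup>+v. ennreal (J v) \<partial>lborel) \<le> (\<integral>\<^sup>+v. (\<Sum>j. ennreal (c j) * indicator (cball 0 (2 ^ j / l)) (v::'a)) \<partial>lborel)"
      by (intro nn_integral_mono pw)
    also have "\<dots> = (\<Sum>j. (\<integral>\<^sup>+v. ennreal (c j) * indicator (cball 0 (2 ^ j / l)) (v::'a) \<partial>lborel))"
      by (rule nn_integral_suminf) measurable
    also have "\<dots> = (\<Sum>j. ennreal (K / l ^ ?d * (1 / 2) ^ j))"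
    proof (rule suminf_cong)
      fix j
      have "(\<integral>\<^sup>+v. ennreal (c j) * indicator (cball 0 (2 ^ j / l)) (v::'a) \<partial>lborel) =
          ennreal (c j) * ennreal (?V * (2 ^ j / l) ^ ?d)"
        using l by (subst nn_integral_cmult_indicator) (auto simp: emeasure_cball)
      also have "\<dots> = ennreal (c j * (?V * (2 ^ j / l) ^ ?d))"
        using c l by (simp add: ennreal_mult)
      also have "c j * (?V * (2 ^ j / l) ^ ?d) = K / l ^ ?d * (1 / 2) ^ j"
        by (simp add: c_def K_def power_divide field_simps)
      finally show "(\<integral>\<^sup>+v. ennreal (c j) * indicator (cball 0 (2 ^ j / l)) (v::'a) \<partial>lborel) =
          ennreal (K / l ^ ?d * (1 / 2) ^ j)" .
    qed
    also have "\<dots> = ennreal (2 * K / l ^ ?d)"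
      using K l by (subst suminf_geometric_ennreal) auto
    finally show "(\<integral>\<^sup>+v. ennreal (J v) \<partial>lborel) \<le> ennreal (2 * K / l ^ ?d)" .
  qed
qed

text \<open>The same dyadic argument with balls shrinking to 0; the ratio is 2^(s - d) for dimension
  d, which is below 1 exactly when \<open>s\<close> is below the dimension.\<close>

lemma nn_integral_norm_powr_finite:
  assumes "0 \<le> s" "s < real DIM('a::euclidean_space)"
  shows "(\<integral>\<^sup>+v. ennreal (norm (v::'a) powr - s) * indicator (cball 0 1) v \<partial>lborel) < \<infinity>"
proof -
  have [measurable]: "cball (0::'a) r \<in> sets borel" for r by simp
  let ?d = "DIM('a)"
  let ?V = "unit_ball_vol (real ?d)"
  define c where "c j = 2 powr (s * real (Suc j))" for j :: nat
  have c: "c j \<ge> 0" for j by (simp add: c_def)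
  define q where "q = 2 powr (s - real ?d)"
  have q: "0 \<le> q" "q < 1" using assms powr_less_mono[of "s - real ?d" 0 2] by (auto simp: q_def)
  have pw: "ennreal (norm v powr - s) * indicator (cball 0 1) v \<le>
    (\<Sum>j. ennreal (c j) * indicator (cball 0 (1 / 2 ^ j)) v)" for v :: 'a
  \<comment> \<open>At \<open>v = 0\<close> the integrand is 0, by the convention that 0
    \<open>powr\<close> anything is 0.\<close>
  proof (cases "v \<noteq> 0 \<and> norm v \<le> 1")
    case False
    then show ?thesis by (auto simp: indicator_def)
  next
    case True
    obtain j where j: "norm v > (1 / 2) ^ j" and min: "\<And>i. i < j \<Longrightarrow> \<not> norm v > (1 / 2) ^ i"
    proof -
      obtain n where "(1 / 2) ^ n < norm v"
        using real_arch_pow_inv[of "norm v" "1/2"] True by auto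
      then have "\<exists>n. norm v > (1 / 2) ^ n" by blast
      from LeastI_ex[OF this] not_less_Least show ?thesis by (intro that) auto
    qed
    obtain i where i: "j = Suc i" using j True by (cases j) auto
    have v: "norm v \<le> (1 / 2) ^ i" using min[of i] i by simp
    have "norm v powr - s \<le> ((1 / 2) ^ j) powr - s"
      using j True assms by (intro powr_mono2') auto
    also have "(1 / 2) ^ j = (2::real) powr - real j"
      by (simp add: powr_minus powr_realpow power_one_over inverse_eq_divide)
    also have "(2 powr - real j) powr - s = c i"
      by (simp add: powr_powr c_def i mult.commute del: of_nat_Suc)
    finally have "ennreal (norm v powr - s) * indicator (cball 0 1) v \<le>
        ennreal (c i) * indicator (cball 0 (1 / 2 ^ i)) v"
      using True v by (auto simp: indicator_def power_one_over ennreal_leI)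
    also have "\<dots> \<le> (\<Sum>j. ennreal (c j) * indicator (cball 0 (1 / 2 ^ j)) v)"
      by (rule ennreal_le_suminf)
    finally show ?thesis .
  qed
  have "(\<integral>\<^sup>+v. ennreal (norm (v::'a) powr - s) * indicator (cball 0 1) v \<partial>lborel) \<le>
     (\<integral>\<^sup>+v. (\<Sum>j. ennreal (c j) * indicator (cball 0 (1 / 2 ^ j)) (v::'a)) \<partial>lborel)"
    by (intro nn_integral_mono pw)
  also have "\<dots> = (\<Sum>j. (\<integral>\<^sup>+v. ennreal (c j) * indicator (cball 0 (1 / 2 ^ j)) (v::'a) \<partial>lborel))"
    by (rule nn_integral_suminf) measurable
  also have "\<dots> = (\<Sum>j. ennreal (2 powr s * ?V * q ^ j))"
  proof (rule suminf_cong)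
    fix j
    have "(\<integral>\<^sup>+v. ennreal (c j) * indicator (cball 0 (1 / 2 ^ j)) (v::'a) \<partial>lborel) =
        ennreal (c j) * ennreal (?V * (1 / 2 ^ j) ^ ?d)"
      by (subst nn_integral_cmult_indicator) (auto simp: emeasure_cball)
    also have "\<dots> = ennreal (c j * (?V * (1 / 2 ^ j) ^ ?d))"
      using c by (simp add: ennreal_mult)
    also have "c j * (?V * (1 / 2 ^ j) ^ ?d) = 2 powr s * ?V * q ^ j"
    proof -
      have "q ^ j = 2 powr ((s - real ?d) * real j)"
        by (simp add: q_def powr_powr[symmetric] powr_realpow)
      also have "\<dots> = 2 powr (s * real j) / 2 powr (real ?d * real j)"
        by (simp add: left_diff_distrib powr_diff)
      also have "2 powr (real ?d * real j) = (2 ^ j) ^ ?d"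
        by (simp add: powr_realpow powr_powr[symmetric] mult.commute[of "real DIM('a)"])
      finally show ?thesis
        by (simp add: c_def distrib_left powr_add power_one_over)
    qed
    finally show "(\<integral>\<^sup>+v. ennreal (c j) * indicator (cball 0 (1 / 2 ^ j)) (v::'a) \<partial>lborel) =
        ennreal (2 powr s * ?V * q ^ j)" .
  qed
  also have "\<dots> < \<infinity>"
    using q by (subst suminf_geometric_ennreal) auto
  finally show ?thesis .
qed

section \<open>Smooth functions\<close>

lemma smooth_on_frechet_derivative:
  "smooth_on f W \<Longrightarrow> smooth_on (\<lambda>x. frechet_derivative f (at x) v) W"
  unfolding smooth_on_def using Ck_on.simps(2) by blast

lemma smooth_on_continuous_on: "smooth_on f W \<Longrightarrow> continuous_on W f"
  unfolding smooth_on_def using Ck_on.simps(1) by blast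

lemma smooth_on_has_derivative:
  assumes "smooth_on f W" "open W" "u \<in> W"
  shows "(f has_derivative frechet_derivative f (at u)) (at u)"
proof -
  have "Ck_on (Suc 0) f W" using assms(1) unfolding smooth_on_def by blast
  then have "f differentiable (at u)"
    using assms by (metis Ck_on.simps(2) at_within_open differentiable_on_def)
  then show ?thesis by (simp add: frechet_derivative_works)
qed

text \<open>\<open>Ck_on\<close> speaks about the derivative in each fixed direction separately.
  Expanding \<open>e\<close> over the basis reduces bounds uniform in \<open>e\<close> to finitely
  many functions.\<close>

lemma frechet_derivative_Basis_sum:
  fixes f :: "'a::euclidean_space \<Rightarrow> 'b::real_inner"
  assumes "smooth_on f W" "open W" "u \<in> W"
  shows "\<theta> \<bullet> frechet_derivative f (at u) e = (\<Sum>b\<in>Basis. (e \<bullet> b) * (\<theta> \<bullet> frechet_derivative f (at u) b))"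
proof -
  have lin: "linear (frechet_derivative f (at u))"
    using smooth_on_has_derivative[OF assms] by (rule has_derivative_linear)
  have "frechet_derivative f (at u) e = frechet_derivative f (at u) (\<Sum>b\<in>Basis. (e \<bullet> b) *\<^sub>R b)"
    by (simp only: euclidean_representation)
  also have "\<dots> = (\<Sum>b\<in>Basis. (e \<bullet> b) *\<^sub>R frechet_derivative f (at u) b)"
    using lin by (simp add: linear_sum linear_cmul)
  finally show ?thesis by (simp add: inner_sum_right)
qed

lemma smooth_on_line_derivative:
  fixes f :: "'a::euclidean_space \<Rightarrow> 'b::real_inner"
  assumes "smooth_on f W" "open W" "u + s *\<^sub>R e \<in> W"
  shows "((\<lambda>t. \<theta> \<bullet> f (u + t *\<^sub>R e)) has_real_derivative
    (\<Sum>b\<in>Basis. (e \<bullet> b) * (\<theta> \<bullet> frechet_derivative f (at (u + s *\<^sub>R e)) b))) (at s)"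
proof -
  let ?D = "frechet_derivative f (at (u + s *\<^sub>R e))"
  have D: "(f has_derivative ?D) (at (u + s *\<^sub>R e))"
    using smooth_on_has_derivative[OF assms] .
  have "((\<lambda>t. u + t *\<^sub>R e) has_derivative (\<lambda>t. t *\<^sub>R e)) (at s)"
    by (auto intro!: derivative_eq_intros)
  from has_derivative_compose[OF this D] have "((\<lambda>t. f (u + t *\<^sub>R e)) has_derivative (\<lambda>t. ?D (t *\<^sub>R e))) (at s)" .
  then have "((\<lambda>t. \<theta> \<bullet> f (u + t *\<^sub>R e)) has_derivative (\<lambda>t. \<theta> \<bullet> ?D (t *\<^sub>R e))) (at s)"
    by (rule has_derivative_inner_right)
  moreover have "(\<lambda>t. \<theta> \<bullet> ?D (t *\<^sub>R e)) = (*) (\<theta> \<bullet> ?D e)"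
    using linear_cmul[OF has_derivative_linear[OF D]] by auto
  ultimately show ?thesis
    unfolding has_field_derivative_def frechet_derivative_Basis_sum[OF assms, symmetric] by simp
qed

lemma bdd_derivs_Basis_sum:
  fixes e :: "'a::euclidean_space"
  assumes "norm e \<le> 1" "\<And>b. b \<in> Basis \<Longrightarrow> bdd_derivs k U e (B b) (g b)" "\<And>b. b \<in> Basis \<Longrightarrow> B b \<ge> 0"
  shows "bdd_derivs k U e (\<Sum>b\<in>Basis. B b) (\<lambda>u. \<Sum>b\<in>Basis. (e \<bullet> b) * g b u)"
proof (rule bdd_derivs_sum)
  fix b :: 'a assume b: "b \<in> Basis"
  have "\<bar>e \<bullet> b\<bar> \<le> 1" using Basis_le_norm[OF b, of e] assms(1) by linarith
  then have "\<bar>e \<bullet> b\<bar> * B b \<le> 1 * B b" using assms(3)[OF b] by (intro mult_right_mono) auto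
  with bdd_derivs_cmult[OF assms(2)[OF b], of "e \<bullet> b"]
  show "bdd_derivs k U e (B b) (\<lambda>u. (e \<bullet> b) * g b u)" by (auto elim: bdd_derivs_mono)
qed simp

lemma bounded_on_compact:
  fixes f :: "'a::topological_space \<Rightarrow> 'b::real_normed_vector"
  assumes "compact K" "continuous_on K f"
  obtains B where "B \<ge> 0" "\<And>x. x \<in> K \<Longrightarrow> norm (f x) \<le> B"
proof -
  have "bounded (f ` K)" using assms compact_continuous_image compact_imp_bounded by blast
  then show ?thesis using that unfolding bounded_pos by (meson imageI less_imp_le)
qed

text \<open>The induction replaces \<open>f\<close> by its partial derivatives, which are again
  smooth; since \<open>e\<close> and \<theta> enter linearly, one \<open>B\<close> serves their
  whole unit balls.\<close>

lemma bdd_derivs_smooth: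
  fixes f :: "'a::euclidean_space \<Rightarrow> 'b::real_inner"
  assumes W: "open W" and K: "compact K" "K \<subseteq> W" and U: "open U" "U \<subseteq> K"
  shows "smooth_on f W \<Longrightarrow> \<exists>B\<ge>0. \<forall>e \<theta>. norm e \<le> 1 \<longrightarrow> norm \<theta> \<le> 1 \<longrightarrow> bdd_derivs k U e B (\<lambda>u. \<theta> \<bullet> f u)"
proof (induction k arbitrary: f)
  case 0
  have c: "continuous_on K f" using smooth_on_continuous_on[OF 0] K continuous_on_subset by blast
  from bounded_on_compact[OF K(1) c] obtain B where B: "B \<ge> 0" "\<And>x. x \<in> K \<Longrightarrow> norm (f x) \<le> B" by blast
  show ?case
  proof (intro exI[of _ B] conjI allI impI)
    fix e :: 'a and \<theta> :: 'b assume "norm e \<le> 1" and th: "norm \<theta> \<le> 1"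
    have "\<bar>\<theta> \<bullet> f u\<bar> \<le> B" if "u \<in> U" for u
    proof -
      have "\<bar>\<theta> \<bullet> f u\<bar> \<le> norm \<theta> * norm (f u)" by (rule Cauchy_Schwarz_ineq2)
      also have "\<dots> \<le> 1 * B" using th B(2)[of u] that U by (intro mult_mono) auto
      finally show ?thesis by simp
    qed
    then show "bdd_derivs 0 U e B (\<lambda>u. \<theta> \<bullet> f u)"
      using c U by (auto intro!: continuous_intros intro: continuous_on_subset)
  qed (rule B)
next
  case (Suc k)
  let ?D = "\<lambda>b u. frechet_derivative f (at u) b"
  have "\<exists>B\<ge>0. \<forall>e \<theta>. norm e \<le> 1 \<longrightarrow> norm \<theta> \<le> 1 \<longrightarrow> bdd_derivs k U e B (\<lambda>u. \<theta> \<bullet> ?D b u)" for b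
    by (rule Suc.IH) (rule smooth_on_frechet_derivative[OF Suc.prems])
  then obtain B where B: "\<And>b. B b \<ge> 0"
    "\<And>b e \<theta>. norm e \<le> 1 \<Longrightarrow> norm \<theta> \<le> 1 \<Longrightarrow> bdd_derivs k U e (B b) (\<lambda>u. \<theta> \<bullet> ?D b u)" by metis
  have c: "continuous_on K f" using smooth_on_continuous_on[OF Suc.prems] K continuous_on_subset by blast
  from bounded_on_compact[OF K(1) c] obtain B0 where B0: "B0 \<ge> 0" "\<And>x. x \<in> K \<Longrightarrow> norm (f x) \<le> B0" by blast
  define C where "C = max B0 (\<Sum>b\<in>Basis. B b)"
  show ?case
  proof (intro exI[of _ C] conjI allI impI)
    show "C \<ge> 0" using B0 by (simp add: C_def le_max_iff_disj)
    fix e :: 'a and \<theta> :: 'b assume e: "norm e \<le> 1" and th: "norm \<theta> \<le> 1"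
    show "bdd_derivs (Suc k) U e C (\<lambda>u. \<theta> \<bullet> f u)"
    proof (rule bdd_derivs_SucI[where f'="\<lambda>u. \<Sum>b\<in>Basis. (e \<bullet> b) * (\<theta> \<bullet> ?D b u)"])
      show "continuous_on U (\<lambda>u. \<theta> \<bullet> f u)"
        using c U by (auto intro!: continuous_intros intro: continuous_on_subset)
      show "\<bar>\<theta> \<bullet> f u\<bar> \<le> C" if "u \<in> U" for u
      proof -
        have "\<bar>\<theta> \<bullet> f u\<bar> \<le> norm \<theta> * norm (f u)" by (rule Cauchy_Schwarz_ineq2)
        also have "\<dots> \<le> 1 * B0" using th B0(2)[of u] that U by (intro mult_mono) auto
        finally show ?thesis by (simp add: C_def le_max_iff_disj)
      qed
      show "((\<lambda>t. \<theta> \<bullet> f (u + t *\<^sub>R e)) has_real_derivative (\<Sum>b\<in>Basis. (e \<bullet> b) * (\<theta> \<bullet> ?D b u))) (at 0)"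
        if "u \<in> U" for u
        using smooth_on_line_derivative[OF Suc.prems W, of u 0 e \<theta>] that U K by auto
      have "bdd_derivs k U e (\<Sum>b\<in>Basis. B b) (\<lambda>u. \<Sum>b\<in>Basis. (e \<bullet> b) * (\<theta> \<bullet> ?D b u))"
        by (rule bdd_derivs_Basis_sum[OF e B(2)[OF e th] B(1)])
      then show "bdd_derivs k U e C (\<lambda>u. \<Sum>b\<in>Basis. (e \<bullet> b) * (\<theta> \<bullet> ?D b u))"
        by (rule bdd_derivs_mono) (simp add: C_def)
    qed
  qed
qed

lemma smooth_on_lipschitz:
  fixes f :: "'a::euclidean_space \<Rightarrow> 'b::real_inner"
  assumes "open W" "compact K" "K \<subseteq> W" "convex K" "smooth_on f W"
  shows "\<exists>B\<ge>0. \<forall>x\<in>K. \<forall>y\<in>K. norm (f x - f y) \<le> B * norm (x - y)"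
proof -
  let ?D = "\<lambda>b u. frechet_derivative f (at u) b"
  have "\<exists>B\<ge>0. \<forall>x\<in>K. norm (?D b x) \<le> B" for b
    using bounded_on_compact[OF assms(2), of "?D b"] continuous_on_subset
      smooth_on_continuous_on[OF smooth_on_frechet_derivative[OF assms(5)]] assms(3) by metis
  then obtain B where B: "\<And>b. B b \<ge> 0" "\<And>b x. x \<in> K \<Longrightarrow> norm (?D b x) \<le> B b" by metis
  show ?thesis
  proof (intro exI[of _ "\<Sum>b\<in>Basis. B b"] conjI ballI)
    show "0 \<le> (\<Sum>b\<in>Basis. B b)" using B by (simp add: sum_nonneg)
    show "norm (f x - f y) \<le> (\<Sum>b\<in>Basis. B b) * norm (x - y)" if "x \<in> K" "y \<in> K" for x y
    proof (rule differentiable_bound[OF assms(4)])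
      show "(f has_derivative frechet_derivative f (at z)) (at z within K)" if "z \<in> K" for z
        using smooth_on_has_derivative[OF assms(5,1)] that assms(3) has_derivative_at_withinI by blast
      fix z assume z: "z \<in> K"
      have lin: "linear (frechet_derivative f (at z))"
        using smooth_on_has_derivative[OF assms(5,1)] z assms(3) has_derivative_linear by blast
      show "onorm (frechet_derivative f (at z)) \<le> (\<Sum>b\<in>Basis. B b)"
      proof (rule onorm_bound)
        fix e :: 'a
        have "frechet_derivative f (at z) e = frechet_derivative f (at z) (\<Sum>b\<in>Basis. (e \<bullet> b) *\<^sub>R b)"
          by (simp only: euclidean_representation)
        also have "\<dots> = (\<Sum>b\<in>Basis. (e \<bullet> b) *\<^sub>R ?D b z)"
          using lin by (simp add: linear_sum linear_cmul)
        also have "norm \<dots> \<le> (\<Sum>b\<in>Basis. norm e * B b)"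
          by (rule sum_norm_le) (use B z in \<open>auto intro!: mult_mono simp: Basis_le_norm\<close>)
        finally show "norm (frechet_derivative f (at z) e) \<le> (\<Sum>b\<in>Basis. B b) * norm e"
          by (simp add: sum_distrib_left mult.commute)
      qed (use B in \<open>simp add: sum_nonneg\<close>)
    qed (use that in auto)
  qed
qed

text \<open>Derivatives of a difference are differences of derivatives, and each of those is
  Lipschitz on the compact convex set. The factor \<open>norm v\<close> is what allows the phase
  difference to be divided by \<open>norm v\<close> with bounds that do not depend on
  \<open>v\<close>.\<close>

lemma bdd_derivs_smooth_diff:
  fixes f :: "'a::euclidean_space \<Rightarrow> 'b::real_inner"
  assumes W: "open W" and K: "compact K" "convex K" "K \<subseteq> W" and U: "open U" "U \<subseteq> K"
  shows "smooth_on f W \<Longrightarrow> \<exists>B\<ge>0. \<forall>e \<theta> v. norm e \<le> 1 \<longrightarrow> norm \<theta> \<le> 1 \<longrightarrow> (\<forall>u\<in>U. u + v \<in> K) \<longrightarrow>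
    bdd_derivs k U e (B * norm v) (\<lambda>u. \<theta> \<bullet> f (u + v) - \<theta> \<bullet> f u)"
proof (induction k arbitrary: f)
  have cont: "continuous_on U (\<lambda>u. \<theta> \<bullet> f (u + v) - \<theta> \<bullet> f u)"
    if "smooth_on f W" "\<forall>u\<in>U. u + v \<in> K" for f :: "'a \<Rightarrow> 'b" and \<theta> v
  proof -
    have "continuous_on K f" using smooth_on_continuous_on[OF that(1)] K continuous_on_subset by blast
    then have "continuous_on U f" "continuous_on U (\<lambda>u. f (u + v))"
      using U that(2) by (auto intro: continuous_on_subset intro!: continuous_on_compose2[of K f] continuous_intros)
    then show ?thesis by (intro continuous_intros)
  qed
  have bound: "\<exists>B\<ge>0. \<forall>\<theta> v u. norm \<theta> \<le> 1 \<longrightarrow> (\<forall>u\<in>U. u + v \<in> K) \<longrightarrow> u \<in> U \<longrightarrow>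
    \<bar>\<theta> \<bullet> f (u + v) - \<theta> \<bullet> f u\<bar> \<le> B * norm v" if sm: "smooth_on f W" for f :: "'a \<Rightarrow> 'b"
  proof -
    obtain B where B: "B \<ge> 0" "\<And>x y. x \<in> K \<Longrightarrow> y \<in> K \<Longrightarrow> norm (f x - f y) \<le> B * norm (x - y)"
      using smooth_on_lipschitz[OF W K(1,3,2) sm] by blast
    show ?thesis
    proof (intro exI[of _ B] conjI allI impI)
      fix \<theta> :: 'b and u v assume th: "norm \<theta> \<le> 1" and v: "\<forall>u\<in>U. u + v \<in> K" and u: "u \<in> U"
      have "\<bar>\<theta> \<bullet> f (u + v) - \<theta> \<bullet> f u\<bar> = \<bar>\<theta> \<bullet> (f (u + v) - f u)\<bar>" by (simp add: inner_diff_right)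
      also have "\<dots> \<le> norm \<theta> * norm (f (u + v) - f u)" by (rule Cauchy_Schwarz_ineq2)
      also have "\<dots> \<le> 1 * (B * norm (u + v - u))" using th v u U by (intro mult_mono B) auto
      finally show "\<bar>\<theta> \<bullet> f (u + v) - \<theta> \<bullet> f u\<bar> \<le> B * norm v" by simp
    qed (rule B)
  qed
  {
    case 0
    from bound[OF 0] show ?case using cont[OF 0] by auto
  next
    case (Suc k)
    let ?D = "\<lambda>b u. frechet_derivative f (at u) b"
    have "\<exists>B\<ge>0. \<forall>e \<theta> v. norm e \<le> 1 \<longrightarrow> norm \<theta> \<le> 1 \<longrightarrow> (\<forall>u\<in>U. u + v \<in> K) \<longrightarrow>
      bdd_derivs k U e (B * norm v) (\<lambda>u. \<theta> \<bullet> ?D b (u + v) - \<theta> \<bullet> ?D b u)" for b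
      by (rule Suc.IH) (rule smooth_on_frechet_derivative[OF Suc.prems])
    then have "\<forall>b. \<exists>B. B \<ge> 0 \<and> (\<forall>e \<theta> v. norm e \<le> 1 \<longrightarrow> norm \<theta> \<le> 1 \<longrightarrow> (\<forall>u\<in>U. u + v \<in> K) \<longrightarrow>
      bdd_derivs k U e (B * norm v) (\<lambda>u. \<theta> \<bullet> ?D b (u + v) - \<theta> \<bullet> ?D b u))" by blast
    from choice[OF this] obtain B where B: "\<And>b. B b \<ge> 0"
      "\<And>b e \<theta> v. norm e \<le> 1 \<Longrightarrow> norm \<theta> \<le> 1 \<Longrightarrow> (\<forall>u\<in>U. u + v \<in> K) \<Longrightarrow>
         bdd_derivs k U e (B b * norm v) (\<lambda>u. \<theta> \<bullet> ?D b (u + v) - \<theta> \<bullet> ?D b u)" by blast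
    from bound[OF Suc.prems] obtain B0 where B0: "B0 \<ge> 0"
      "\<And>\<theta> v u. norm \<theta> \<le> 1 \<Longrightarrow> (\<forall>u\<in>U. u + v \<in> K) \<Longrightarrow> u \<in> U \<Longrightarrow>
        \<bar>\<theta> \<bullet> f (u + v) - \<theta> \<bullet> f u\<bar> \<le> B0 * norm v" by blast
    define C where "C = max B0 (\<Sum>b\<in>Basis. B b)"
    show ?case
    proof (intro exI[of _ C] conjI allI impI)
      show "C \<ge> 0" using B0 by (simp add: C_def le_max_iff_disj)
      fix e v :: 'a and \<theta> :: 'b
      assume e: "norm e \<le> 1" and th: "norm \<theta> \<le> 1" and v: "\<forall>u\<in>U. u + v \<in> K"
      show "bdd_derivs (Suc k) U e (C * norm v) (\<lambda>u. \<theta> \<bullet> f (u + v) - \<theta> \<bullet> f u)"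
      proof (rule bdd_derivs_SucI[where f'="\<lambda>u. \<Sum>b\<in>Basis. (e \<bullet> b) * (\<theta> \<bullet> ?D b (u + v) - \<theta> \<bullet> ?D b u)"])
        show "continuous_on U (\<lambda>u. \<theta> \<bullet> f (u + v) - \<theta> \<bullet> f u)" by (rule cont[OF Suc.prems v])
        show "\<bar>\<theta> \<bullet> f (u + v) - \<theta> \<bullet> f u\<bar> \<le> C * norm v" if "u \<in> U" for u
          using B0(2)[OF th v that] by (rule order_trans) (simp add: C_def mult_right_mono)
        show "((\<lambda>t. \<theta> \<bullet> f (u + t *\<^sub>R e + v) - \<theta> \<bullet> f (u + t *\<^sub>R e)) has_real_derivative
            (\<Sum>b\<in>Basis. (e \<bullet> b) * (\<theta> \<bullet> ?D b (u + v) - \<theta> \<bullet> ?D b u))) (at 0)" if "u \<in> U" for u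
        proof -
          have "u \<in> W" "u + v \<in> W" using that v U K by auto
          then show ?thesis
            using DERIV_diff[OF smooth_on_line_derivative[OF Suc.prems W, of "u + v" 0 e \<theta>]
                smooth_on_line_derivative[OF Suc.prems W, of u 0 e \<theta>]]
            by (simp add: right_diff_distrib sum_subtractf algebra_simps)
        qed
        have "bdd_derivs k U e (\<Sum>b\<in>Basis. B b * norm v) (\<lambda>u. \<Sum>b\<in>Basis. (e \<bullet> b) * (\<theta> \<bullet> ?D b (u + v) - \<theta> \<bullet> ?D b u))"
          by (rule bdd_derivs_Basis_sum[OF e B(2)[OF e th v]]) (use B(1) in simp)
        then show "bdd_derivs k U e (C * norm v) (\<lambda>u. \<Sum>b\<in>Basis. (e \<bullet> b) * (\<theta> \<bullet> ?D b (u + v) - \<theta> \<bullet> ?D b u))"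
          by (rule bdd_derivs_mono) (simp add: C_def sum_distrib_right[symmetric] mult_right_mono)
      qed
    qed
  }
qed

section \<open>Oscillatory integrals over small balls\<close>

text \<open>This is the Fourier transform of the bump density carried by \<phi>, in polar form: at a
  frequency \<xi> one takes \<theta> = -\<xi> / |\<xi>| and l = 2 \<pi> |\<xi>|. The indicator
  confines the integrand to a ball inside the chart, where \<phi> is continuous.\<close>

definition osc_integral :: "nat \<Rightarrow> real \<Rightarrow> 'a::euclidean_space \<Rightarrow> ('a \<Rightarrow> 'b::real_inner) \<Rightarrow> 'b \<Rightarrow> real \<Rightarrow> complex" where
  "osc_integral n R u0 \<phi> \<theta> l =
     (LINT u|lborel. indicator (cball u0 R) u *\<^sub>R (of_real (bump n R u0 u) * cis (l * (\<theta> \<bullet> \<phi> u))))"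

lemma bump_le: "bump n R u0 u \<le> (R\<^sup>2) ^ n"
  by (auto simp: bump_def intro!: power_mono)

lemma osc_integrable:
  assumes "continuous_on (cball u0 R) \<phi>"
  shows "integrable lborel (\<lambda>u. indicator (cball u0 R) u *\<^sub>R (of_real (bump n R u0 u) * cis (l * (\<theta> \<bullet> \<phi> u))))"
  using assms by (intro borel_integrable_compact continuous_intros bump_continuous) auto

lemma norm_osc_integral_le:
  assumes "continuous_on (cball u0 R) \<phi>"
  shows "cmod (osc_integral n R u0 \<phi> \<theta> l) \<le> (R\<^sup>2) ^ n * measure lborel (cball u0 R)"
proof -
  have "cmod (osc_integral n R u0 \<phi> \<theta> l) \<le> (LINT u|lborel. indicator (cball u0 R) u *\<^sub>R (R\<^sup>2) ^ n)"
    unfolding osc_integral_def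
  proof (rule Bochner_Integration.integral_norm_bound_integral[OF osc_integrable[OF assms]])
    show "integrable lborel (\<lambda>u. indicator (cball u0 R) u *\<^sub>R (R\<^sup>2) ^ n)"
      by (intro borel_integrable_compact continuous_intros) auto
  qed (auto simp: norm_mult indicator_def bump_le abs_of_nonneg[OF bump_nonneg])
  then show ?thesis by (simp add: mult.commute)
qed

text \<open>A nonzero partial derivative of \<open>\<theta>0 \<bullet> \<phi>\<close> at
  \<open>u0\<close> stays at least half as large for all nearby \<theta> and \<open>u\<close>, so
  integration by parts along that basis vector applies. Every small radius is allowed because the
  final radius is fixed only after finitely many directions \<theta>0 have been selected.\<close>

lemma osc_integral_nonstationary:
  fixes \<phi> :: "'a::euclidean_space \<Rightarrow> 'b::real_inner"
  assumes W: "smooth_on \<phi> W" "open W" "u0 \<in> W" and n: "DIM('a) < n"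
    and b: "b \<in> Basis" "\<theta>0 \<bullet> frechet_derivative \<phi> (at u0) b \<noteq> 0"
  shows "\<exists>R0>0. \<exists>\<epsilon>>0. \<forall>R. 0 < R \<and> R \<le> R0 \<longrightarrow> (\<exists>C\<ge>0. \<forall>\<theta> l. norm \<theta> = 1 \<longrightarrow> dist \<theta>0 \<theta> < \<epsilon> \<longrightarrow> l > 0 \<longrightarrow>
    (cmod (osc_integral n R u0 \<phi> \<theta> l))\<^sup>2 \<le> C / l ^ DIM('a))"
proof -
  let ?D = "\<lambda>u. frechet_derivative \<phi> (at u) b"
  let ?m = "DIM('a)"
  define c where "c = \<bar>\<theta>0 \<bullet> ?D u0\<bar> / 2"
  have c: "c > 0" using b by (simp add: c_def)
  have sD: "smooth_on ?D W" by (rule smooth_on_frechet_derivative[OF W(1)])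
  have "continuous_on (UNIV \<times> W) (\<lambda>z. \<bar>fst z \<bullet> ?D (snd z)\<bar>)"
    by (intro continuous_intros continuous_on_compose2[OF smooth_on_continuous_on[OF sD]]) auto
  then have "open ((UNIV \<times> W) \<inter> (\<lambda>z. \<bar>fst z \<bullet> ?D (snd z)\<bar>) -` {c<..})"
    using W by (intro continuous_open_preimage) (auto intro: open_Times)
  moreover have "(\<theta>0, u0) \<in> (UNIV \<times> W) \<inter> (\<lambda>z. \<bar>fst z \<bullet> ?D (snd z)\<bar>) -` {c<..}"
    using W c by (simp add: c_def)
  ultimately obtain A B where AB: "open A" "open B" "(\<theta>0, u0) \<in> A \<times> B"
      "A \<times> B \<subseteq> (UNIV \<times> W) \<inter> (\<lambda>z. \<bar>fst z \<bullet> ?D (snd z)\<bar>) -` {c<..}"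
    by (rule open_prod_elim)
  obtain \<epsilon> where eps: "\<epsilon> > 0" "ball \<theta>0 \<epsilon> \<subseteq> A" using AB openE by blast
  obtain r where r: "r > 0" "ball u0 r \<subseteq> B" using AB openE by blast
  have lower: "c \<le> \<bar>\<theta> \<bullet> ?D u\<bar>" and inW: "u \<in> W" if "dist \<theta>0 \<theta> < \<epsilon>" "dist u0 u < r" for \<theta> u
  proof -
    have "(\<theta>, u) \<in> A \<times> B" using that eps r by (auto simp: subset_iff)
    then have "(\<theta>, u) \<in> (UNIV \<times> W) \<inter> (\<lambda>z. \<bar>fst z \<bullet> ?D (snd z)\<bar>) -` {c<..}" using AB(4) by blast
    then show "c \<le> \<bar>\<theta> \<bullet> ?D u\<bar>" "u \<in> W" by auto
  qed
  show ?thesis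
  \<comment> \<open>With \<open>R \<le> r / 3\<close> the enlarged ball of radius
    \<open>2 * R\<close> still lies inside the ball of radius \<open>r\<close>.\<close>
  proof (rule exI[of _ "r / 3"], rule conjI[OF _ exI[of _ \<epsilon>, OF conjI[OF _ allI[OF impI]]]])
    show "r / 3 > 0" "\<epsilon> > 0" using r eps by auto
    fix R assume R: "0 < R \<and> R \<le> r / 3"
    define U where "U = ball u0 (2 * R)"
    define K where "K = cball u0 R"
    have U: "open U" "U \<subseteq> cball u0 (2 * R)" and K: "compact K" "K \<subseteq> U" using R by (auto simp: U_def K_def)
    have sub: "cball u0 (2 * R) \<subseteq> W"
      using inW[of \<theta>0] eps R by (auto intro!: inW[of \<theta>0])
    have Ur: "dist u0 u < r" if "u \<in> U" for u using that R by (auto simp: U_def)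
    obtain P where P: "P \<ge> 0" "\<And>e \<theta>. norm e \<le> 1 \<Longrightarrow> norm \<theta> \<le> 1 \<Longrightarrow> bdd_derivs ?m U e P (\<lambda>u. \<theta> \<bullet> ?D u)"
      using bdd_derivs_smooth[OF W(2) compact_cball sub U sD, of ?m] by blast
    obtain A' where A': "A' \<ge> 0" "\<And>e. norm e \<le> 1 \<Longrightarrow> bdd_derivs ?m U e A' (bump n R u0)"
      using bdd_derivs_bump[of "2 * R" R ?m n u0] R n unfolding U_def by auto
    obtain C where C: "C \<ge> 0" "\<forall>(U :: 'a set) K e \<psi> p b l.
      open U \<longrightarrow> compact K \<longrightarrow> K \<subseteq> U \<longrightarrow> continuous_on U \<psi> \<longrightarrow>
      (\<forall>u\<in>U. ((\<lambda>t. \<psi> (u + t *\<^sub>R e)) has_real_derivative p u) (at 0)) \<longrightarrow>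
      (\<forall>u\<in>U. c \<le> \<bar>p u\<bar>) \<longrightarrow> bdd_derivs ?m U e P p \<longrightarrow> bdd_derivs ?m U e A' b \<longrightarrow>
      (\<forall>u\<in>U - K. b u = 0) \<longrightarrow> l > 0 \<longrightarrow>
      cmod (LINT u|lborel. indicator K u *\<^sub>R (of_real (b u) * cis (l * \<psi> u))) \<le> C * measure lborel K / l ^ ?m"
      using nonstationary_phase[OF c P(1) A'(1), where 'a='a and N="?m"] by blast
    have cont: "continuous_on (cball u0 (2 * R)) \<phi>"
      using smooth_on_continuous_on[OF W(1)] sub continuous_on_subset by blast
    define C2 where "C2 = (R\<^sup>2) ^ n * measure lborel (cball u0 R)"
    show "\<exists>C\<ge>0. \<forall>\<theta> l. norm \<theta> = 1 \<longrightarrow> dist \<theta>0 \<theta> < \<epsilon> \<longrightarrow> l > 0 \<longrightarrow>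
      (cmod (osc_integral n R u0 \<phi> \<theta> l))\<^sup>2 \<le> C / l ^ ?m"
    proof (intro exI[of _ "C2 * (C * measure lborel K)"] conjI allI impI)
      show "0 \<le> C2 * (C * measure lborel K)" using C by (simp add: C2_def)
      fix \<theta> :: 'b and l :: real assume th: "norm \<theta> = 1" "dist \<theta>0 \<theta> < \<epsilon>" and l: "l > 0"
      have "cmod (LINT u|lborel. indicator K u *\<^sub>R (of_real (bump n R u0 u) * cis (l * (\<theta> \<bullet> \<phi> u)))) \<le> C * measure lborel K / l ^ ?m"
      proof (rule C(2)[rule_format, of U K _ b "\<lambda>u. \<theta> \<bullet> ?D u"])
        show "continuous_on U (\<lambda>u. \<theta> \<bullet> \<phi> u)"
          using cont U by (auto intro!: continuous_intros intro: continuous_on_subset)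
        show "((\<lambda>t. \<theta> \<bullet> \<phi> (u + t *\<^sub>R b)) has_real_derivative \<theta> \<bullet> ?D u) (at 0)" if "u \<in> U" for u
        proof -
          have "u \<in> W" using that U sub by auto
          then show ?thesis
            using smooth_on_line_derivative[OF W(1,2), of u 0 b \<theta>] frechet_derivative_Basis_sum[OF W(1,2), of u \<theta> b] by simp
        qed
        show "bump n R u0 u = 0" if "u \<in> U - K" for u
          using that R n by (intro bump_eq_0) (auto simp: K_def)
      qed (use U K lower[OF th(2) Ur] P(2) A'(2) th b(1) l in auto)
      then have 1: "cmod (osc_integral n R u0 \<phi> \<theta> l) \<le> C * measure lborel K / l ^ ?m"
        unfolding osc_integral_def K_def .
      have 2: "cmod (osc_integral n R u0 \<phi> \<theta> l) \<le> C2"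
        unfolding C2_def using R by (intro norm_osc_integral_le continuous_on_subset[OF cont]) auto
      \<comment> \<open>One factor already decays like the full power of \<open>l\<close>; the other
        is bounded trivially.\<close>
      have "(cmod (osc_integral n R u0 \<phi> \<theta> l))\<^sup>2 \<le> C2 * (C * measure lborel K / l ^ ?m)"
        unfolding power2_eq_square by (rule mult_mono[OF 2 1]) (auto simp: C2_def)
      then show "(cmod (osc_integral n R u0 \<phi> \<theta> l))\<^sup>2 \<le> C2 * (C * measure lborel K) / l ^ ?m" by simp
    qed
  qed
qed

text \<open>Let H be the Hessian of \<open>\<theta>0 \<bullet> \<phi>\<close> at \<open>u0\<close>.
  For a shift \<open>v\<close> the direction is e = H v / |H v|: along it the phase difference has
  derivative close to e \<bullet> H v = |H v|, which is at least a multiple of |v| because H is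
  injective. The last derivative order is \<open>Suc DIM('a)\<close>, hence the larger
  \<open>n\<close>.\<close>

lemma osc_integral_nondegenerate:
  fixes \<phi> :: "'a::euclidean_space \<Rightarrow> 'b::real_inner" and u0 :: 'a
  defines "D \<equiv> \<lambda>b u. frechet_derivative \<phi> (at u) b"
  defines "D2 \<equiv> \<lambda>b b' u. frechet_derivative (D b) (at u) b'"
  assumes W: "smooth_on \<phi> W" "open W" "u0 \<in> W" and n: "Suc DIM('a) < n"
    and nondeg: "\<And>v. (\<forall>b\<in>Basis. (\<Sum>b'\<in>Basis. (v \<bullet> b') * (\<theta>0 \<bullet> D2 b b' u0)) = 0) \<Longrightarrow> v = 0"
  shows "\<exists>R0>0. \<exists>\<epsilon>>0. \<forall>R. 0 < R \<and> R \<le> R0 \<longrightarrow> (\<exists>C\<ge>0. \<forall>\<theta> l. norm \<theta> = 1 \<longrightarrow> dist \<theta>0 \<theta> < \<epsilon> \<longrightarrow> l > 0 \<longrightarrow>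
    (cmod (osc_integral n R u0 \<phi> \<theta> l))\<^sup>2 \<le> C / l ^ DIM('a))"
proof -
  let ?m = "DIM('a)"
  have sD: "smooth_on (D b) W" for b
    unfolding D_def by (rule smooth_on_frechet_derivative[OF W(1)])
  have sD2: "smooth_on (D2 b b') W" for b b'
    unfolding D2_def by (rule smooth_on_frechet_derivative[OF sD])
  \<comment> \<open>\<open>Q\<close> is the Hessian of \<open>\<theta> \<bullet> \<phi>\<close> at
    \<open>u\<close> as a bilinear form in \<open>v\<close> and \<open>e\<close>; \<open>H\<close>
    is the linear map representing it at \<open>\<theta>0\<close> and \<open>u0\<close>.\<close>
  define Q where "Q \<theta> u v e = (\<Sum>b\<in>Basis. (e \<bullet> b) * (\<Sum>b'\<in>Basis. (v \<bullet> b') * (\<theta> \<bullet> D2 b b' u)))" for \<theta> u v and e :: 'a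
  define H where "H v = (\<Sum>b\<in>Basis. (\<Sum>b'\<in>Basis. (v \<bullet> b') * (\<theta>0 \<bullet> D2 b b' u0)) *\<^sub>R b)" for v :: 'a
  have H_inner: "e \<bullet> H v = Q \<theta>0 u0 v e" for e v
    by (simp add: H_def Q_def inner_sum_right mult.commute)
  have "linear H"
    unfolding H_def
    by (rule linearI)
      (simp_all add: inner_left_distrib distrib_right sum.distrib scaleR_add_left scaleR_sum_right sum_distrib_left mult.assoc)
  moreover have "inj H"
  proof (rule linear_injective_0[OF \<open>linear H\<close>, THEN iffD2], intro allI impI)
    fix v assume "H v = 0"
    have "(\<Sum>b'\<in>Basis. (v \<bullet> b') * (\<theta>0 \<bullet> D2 b b' u0)) = 0" if "b \<in> Basis" for b
    proof -
      have "(\<Sum>b'\<in>Basis. (v \<bullet> b') * (\<theta>0 \<bullet> D2 b b' u0)) = H v \<bullet> b"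
        using that by (simp add: H_def)
      then show ?thesis using \<open>H v = 0\<close> by simp
    qed
    then show "v = 0" using nondeg by blast
  qed
  ultimately obtain c where c: "c > 0" "\<And>v. c * norm v \<le> norm (H v)"
    using linear_inj_bounded_below_pos by metis
  \<comment> \<open>\<open>G\<close> adds up the deviations of all Hessian entries from their values
    at the centre. Where it is at most \<open>c / 2\<close>, at least half of the lower bound
    \<open>c * norm v\<close> survives.\<close>
  define G where "G z = (\<Sum>b\<in>Basis. \<Sum>b'\<in>Basis. \<bar>fst z \<bullet> D2 b b' (snd z) - \<theta>0 \<bullet> D2 b b' u0\<bar>)" for z
  have "continuous_on (UNIV \<times> W) G"
    unfolding G_def
    by (intro continuous_intros continuous_on_compose2[OF smooth_on_continuous_on[OF sD2]]) auto
  then have "open ((UNIV \<times> W) \<inter> G -` {..<c / 2})"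
    using W by (intro continuous_open_preimage) (auto intro: open_Times)
  moreover have "(\<theta>0, u0) \<in> (UNIV \<times> W) \<inter> G -` {..<c / 2}"
    using W c by (simp add: G_def)
  ultimately obtain A B where AB: "open A" "open B" "(\<theta>0, u0) \<in> A \<times> B"
      "A \<times> B \<subseteq> (UNIV \<times> W) \<inter> G -` {..<c / 2}"
    by (rule open_prod_elim)
  obtain \<epsilon> where eps: "\<epsilon> > 0" "ball \<theta>0 \<epsilon> \<subseteq> A" using AB openE by blast
  obtain r where r: "r > 0" "ball u0 r \<subseteq> B" using AB openE by blast
  have Gle: "G (\<theta>, u) \<le> c / 2" and inW: "u \<in> W" if "dist \<theta>0 \<theta> < \<epsilon>" "dist u0 u < r" for \<theta> u
  proof -
    have "(\<theta>, u) \<in> A \<times> B" using that eps r by (auto simp: subset_iff)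
    then have "(\<theta>, u) \<in> (UNIV \<times> W) \<inter> G -` {..<c / 2}" using AB(4) by blast
    then show "G (\<theta>, u) \<le> c / 2" "u \<in> W" by auto
  qed
  have Qlow: "Q \<theta> u v (H v /\<^sub>R norm (H v)) \<ge> c / 2 * norm v"
    if "dist \<theta>0 \<theta> < \<epsilon>" "dist u0 u < r" "v \<noteq> 0" for \<theta> u v
  proof -
    define e where "e = H v /\<^sub>R norm (H v)"
    have "norm (H v) > 0" using c(2)[of v] c(1) that(3) by (smt (verit) mult_pos_pos zero_less_norm_iff)
    then have e: "norm e = 1" and eH: "e \<bullet> H v = norm (H v)"
      by (auto simp: e_def power2_norm_eq_inner[symmetric] power2_eq_square)
    have "\<bar>Q \<theta> u v e - Q \<theta>0 u0 v e\<bar> =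
        \<bar>\<Sum>b\<in>Basis. \<Sum>b'\<in>Basis. (e \<bullet> b) * (v \<bullet> b') * (\<theta> \<bullet> D2 b b' u - \<theta>0 \<bullet> D2 b b' u0)\<bar>"
      by (simp add: Q_def sum_subtractf[symmetric] sum_distrib_left right_diff_distrib mult.assoc)
    also have "\<dots> \<le> (\<Sum>b\<in>Basis. \<Sum>b'\<in>Basis. \<bar>(e \<bullet> b) * (v \<bullet> b') * (\<theta> \<bullet> D2 b b' u - \<theta>0 \<bullet> D2 b b' u0)\<bar>)"
      by (intro order_trans[OF sum_abs] sum_mono sum_abs)
    also have "\<dots> \<le> (\<Sum>b\<in>Basis. \<Sum>b'\<in>Basis. norm v * \<bar>\<theta> \<bullet> D2 b b' u - \<theta>0 \<bullet> D2 b b' u0\<bar>)"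
    proof (intro sum_mono)
      fix b b' :: 'a assume b: "b \<in> Basis" "b' \<in> Basis"
      have "\<bar>e \<bullet> b\<bar> * \<bar>v \<bullet> b'\<bar> \<le> 1 * norm v"
        using Basis_le_norm[OF b(1), of e] Basis_le_norm[OF b(2), of v] e by (intro mult_mono) auto
      then show "\<bar>(e \<bullet> b) * (v \<bullet> b') * (\<theta> \<bullet> D2 b b' u - \<theta>0 \<bullet> D2 b b' u0)\<bar> \<le>
          norm v * \<bar>\<theta> \<bullet> D2 b b' u - \<theta>0 \<bullet> D2 b b' u0\<bar>"
        by (simp add: abs_mult mult_right_mono)
    qed
    also have "\<dots> = norm v * G (\<theta>, u)" by (simp add: G_def sum_distrib_left)
    also have "\<dots> \<le> norm v * (c / 2)" using Gle[OF that(1,2)] by (intro mult_left_mono) auto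
    finally have "\<bar>Q \<theta> u v e - Q \<theta>0 u0 v e\<bar> \<le> norm v * (c / 2)" .
    moreover have "Q \<theta>0 u0 v e \<ge> c * norm v" using H_inner[of e v] eH c(2)[of v] by simp
    ultimately have "Q \<theta> u v e \<ge> c * norm v - norm v * (c / 2)" by linarith
    then show ?thesis unfolding e_def[symmetric] by (simp add: mult.commute)
  qed
  show ?thesis
  \<comment> \<open>Base points range over radius \<open>2 * R\<close> and shifts have length at
    most \<open>2 * R\<close>, so all points met lie within \<open>5 * R < r\<close> of the
    centre.\<close>
  proof (rule exI[of _ "r / 6"], rule conjI[OF _ exI[of _ \<epsilon>, OF conjI[OF _ allI[OF impI]]]])
    show "r / 6 > 0" "\<epsilon> > 0" using r eps by auto
    fix R assume R: "0 < R \<and> R \<le> r / 6"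
    define U where "U = ball u0 (2 * R)"
    define V where "V = cball u0 (5 * R)"
    define K where "K = cball u0 R"
    have U: "open U" "U \<subseteq> V" and K: "compact K" "K \<subseteq> U" using R by (auto simp: U_def K_def V_def)
    have V: "compact V" "convex V" by (auto simp: V_def)
    have Vr: "dist u0 u < r" if "u \<in> V" for u using that R by (auto simp: V_def)
    have sub: "V \<subseteq> W" using inW[of \<theta>0] eps Vr by auto
    have shift: "u + v \<in> ball u0 (5 * R)" if "u \<in> U" "norm v \<le> 2 * R" for u v
      using that R norm_triangle_ineq[of "u - u0" v]
      by (simp add: U_def dist_norm norm_minus_commute algebra_simps)
    have shiftV: "u + v \<in> V" if "u \<in> U" "norm v \<le> 2 * R" for u v
      using shift[OF that] ball_subset_cball unfolding V_def by blast
    have "\<exists>B\<ge>0. \<forall>e \<theta> v. norm e \<le> 1 \<longrightarrow> norm \<theta> \<le> 1 \<longrightarrow> (\<forall>u\<in>U. u + v \<in> V) \<longrightarrow>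
      bdd_derivs (Suc ?m) U e (B * norm v) (\<lambda>u. \<theta> \<bullet> D b (u + v) - \<theta> \<bullet> D b u)" for b
      by (rule bdd_derivs_smooth_diff[OF W(2) V sub U sD])
    then have "\<forall>b. \<exists>B. B \<ge> 0 \<and> (\<forall>e \<theta> v. norm e \<le> 1 \<longrightarrow> norm \<theta> \<le> 1 \<longrightarrow> (\<forall>u\<in>U. u + v \<in> V) \<longrightarrow>
      bdd_derivs (Suc ?m) U e (B * norm v) (\<lambda>u. \<theta> \<bullet> D b (u + v) - \<theta> \<bullet> D b u))" by blast
    from choice[OF this] obtain Bd where Bd: "\<And>b. Bd b \<ge> 0"
      "\<And>b e \<theta> v. norm e \<le> 1 \<Longrightarrow> norm \<theta> \<le> 1 \<Longrightarrow> (\<forall>u\<in>U. u + v \<in> V) \<Longrightarrow>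
         bdd_derivs (Suc ?m) U e (Bd b * norm v) (\<lambda>u. \<theta> \<bullet> D b (u + v) - \<theta> \<bullet> D b u)" by blast
    define P where "P = (\<Sum>b\<in>Basis. Bd b)"
    have P0: "P \<ge> 0" using Bd(1) by (simp add: P_def sum_nonneg)
    obtain A' where A': "A' \<ge> 0" "\<And>e. norm e \<le> 1 \<Longrightarrow> bdd_derivs (Suc ?m) (ball u0 (5 * R)) e A' (bump n R u0)"
      using bdd_derivs_bump[of "5 * R" R "Suc ?m" n u0] R n by auto
    obtain A2 where A2: "A2 \<ge> 0" "\<And>e. norm e \<le> 1 \<Longrightarrow> bdd_derivs (Suc ?m) U e A2 (bump n R u0)"
      using bdd_derivs_bump[of "2 * R" R "Suc ?m" n u0] R n unfolding U_def by auto
    define Ab where "Ab = 2 ^ Suc ?m * A' * A2"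
    have Ab: "Ab \<ge> 0" using A' A2 by (simp add: Ab_def)
    have c2: "c / 2 > 0" using c by simp
    obtain C where C: "C \<ge> 0" "\<forall>(U :: 'a set) K e \<psi> p b l.
      open U \<longrightarrow> compact K \<longrightarrow> K \<subseteq> U \<longrightarrow> continuous_on U \<psi> \<longrightarrow>
      (\<forall>u\<in>U. ((\<lambda>t. \<psi> (u + t *\<^sub>R e)) has_real_derivative p u) (at 0)) \<longrightarrow>
      (\<forall>u\<in>U. c / 2 \<le> \<bar>p u\<bar>) \<longrightarrow> bdd_derivs (Suc ?m) U e P p \<longrightarrow> bdd_derivs (Suc ?m) U e Ab b \<longrightarrow>
      (\<forall>u\<in>U - K. b u = 0) \<longrightarrow> l > 0 \<longrightarrow>
      cmod (LINT u|lborel. indicator K u *\<^sub>R (of_real (b u) * cis (l * \<psi> u))) \<le> C * measure lborel K / l ^ Suc ?m"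
      using nonstationary_phase[OF c2 P0 Ab, where 'a='a and N="Suc ?m"] by blast
    \<comment> \<open>The maximum of the trivial bound for \<open>J\<close> and the constant of the
      bound by parts, so that one number serves both hypotheses of
      \<open>nn_integral_power_decay\<close>.\<close>
    define Af where "Af = max (((R\<^sup>2) ^ n * (R\<^sup>2) ^ n) * measure lborel K) (C * measure lborel K)"
    have Af: "Af \<ge> 0" using C by (simp add: Af_def le_max_iff_disj)
    obtain CC where CC: "CC \<ge> 0" "\<forall>l>0. \<forall>J :: 'a \<Rightarrow> real. (\<forall>v. J v \<le> Af) \<longrightarrow>
      (\<forall>v. v \<noteq> 0 \<longrightarrow> J v \<le> Af / (l * norm v) ^ Suc ?m) \<longrightarrow>
      (\<integral>\<^sup>+v. ennreal (J v) \<partial>lborel) \<le> ennreal (CC / l ^ ?m)"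
      using nn_integral_power_decay[OF Af, where 'a='a] by blast
    have contV: "continuous_on V \<phi>"
      using smooth_on_continuous_on[OF W(1)] sub continuous_on_subset by blast
    have contK: "continuous_on (cball u0 R) \<phi>"
      using contV U K K_def by (auto intro: continuous_on_subset)
    show "\<exists>C\<ge>0. \<forall>\<theta> l. norm \<theta> = 1 \<longrightarrow> dist \<theta>0 \<theta> < \<epsilon> \<longrightarrow> l > 0 \<longrightarrow>
      (cmod (osc_integral n R u0 \<phi> \<theta> l))\<^sup>2 \<le> C / l ^ ?m"
    proof (intro exI[of _ CC] conjI allI impI CC(1))
      fix \<theta> :: 'b and l :: real assume th: "norm \<theta> = 1" "dist \<theta>0 \<theta> < \<epsilon>" and l: "l > 0"
      define f where "f u = indicator (cball u0 R) u *\<^sub>R (of_real (bump n R u0 u) * cis (l * (\<theta> \<bullet> \<phi> u)))" for u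
      define J where "J v = cmod (LINT u|lborel. f (u + v) * cnj (f u))" for v
      have f0: "f u = of_real (bump n R u0 u) * cis (l * (\<theta> \<bullet> \<phi> u))" for u
        using bump_eq_0[of n R u0 u] R n by (auto simp: f_def indicator_def)
      have ff: "f (u + v) * cnj (f u) = indicator K u *\<^sub>R (of_real (bump n R u0 (u + v) * bump n R u0 u) *
          cis (l * (\<theta> \<bullet> \<phi> (u + v) - \<theta> \<bullet> \<phi> u)))" for u v
      proof -
        have "cis (l * (\<theta> \<bullet> \<phi> (u + v) - \<theta> \<bullet> \<phi> u)) = cis (l * (\<theta> \<bullet> \<phi> (u + v))) * cnj (cis (l * (\<theta> \<bullet> \<phi> u)))"
          by (simp add: cis_cnj cis_mult right_diff_distrib)
        then show ?thesis
          by (cases "u \<in> K") (simp add: f0 mult.assoc mult.left_commute, simp add: f_def K_def)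
      qed
      have J1: "J v \<le> Af" for v
      proof -
        have "J v \<le> (LINT u|lborel. indicator K u *\<^sub>R ((R\<^sup>2) ^ n * (R\<^sup>2) ^ n))"
          unfolding J_def
        proof (rule order_trans[OF integral_norm_bound integral_mono'])
          show "0 \<le> indicator K u *\<^sub>R ((R\<^sup>2) ^ n * (R\<^sup>2) ^ n)" for u by simp
          show "integrable lborel (\<lambda>u. indicator K u *\<^sub>R ((R\<^sup>2) ^ n * (R\<^sup>2) ^ n))"
            by (intro borel_integrable_compact continuous_intros K)
          show "norm (f (u + v) * cnj (f u)) \<le> indicator K u *\<^sub>R ((R\<^sup>2) ^ n * (R\<^sup>2) ^ n)" for u
            unfolding ff by (auto simp: norm_mult indicator_def bump_nonneg intro!: mult_mono bump_le)
        qed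
        also have "\<dots> \<le> Af" by (simp add: Af_def mult.commute)
        finally show ?thesis .
      qed
      have J2: "J v \<le> Af / (l * norm v) ^ Suc ?m" if v: "v \<noteq> 0" for v
      proof (cases "norm v \<le> 2 * R")
        case False
        \<comment> \<open>Two points of the ball of radius \<open>R\<close> cannot differ by more
          than \<open>2 * R\<close>.\<close>
        have "f (u + v) * cnj (f u) = 0" for u
        proof (rule ccontr)
          assume "f (u + v) * cnj (f u) \<noteq> 0"
          then have "bump n R u0 (u + v) \<noteq> 0" "bump n R u0 u \<noteq> 0" by (auto simp: f0)
          then have "dist u0 (u + v) < R" "dist u0 u < R"
            using bump_eq_0[of n R u0] R n by (meson not_less less_trans zero_less_Suc)+
          then show False
            using False norm_triangle_ineq4[of "u + v - u0" "u - u0"]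
            by (simp add: dist_norm norm_minus_commute)
        qed
        then have "J v = 0" unfolding J_def by (simp only: Bochner_Integration.integral_zero norm_zero)
        then show ?thesis using Af l by simp
      next
        case True
        define e where "e = H v /\<^sub>R norm (H v)"
        have e: "norm e \<le> 1" by (cases "H v = 0") (auto simp: e_def)
        \<comment> \<open>Dividing the phase by \<open>norm v\<close> and multiplying the frequency
          by it leaves the integral unchanged, but makes the bounds on the phase independent of
          \<open>v\<close>.\<close>
        define \<psi> where "\<psi> u = (\<theta> \<bullet> \<phi> (u + v) - \<theta> \<bullet> \<phi> u) / norm v" for u
        define p where "p u = (1 / norm v) * (\<Sum>b\<in>Basis. (e \<bullet> b) * (\<theta> \<bullet> D b (u + v) - \<theta> \<bullet> D b u))" for u
        have sh: "\<forall>u\<in>U. u + v \<in> V" using shiftV True by blast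
        have "cmod (LINT u|lborel. indicator K u *\<^sub>R (of_real (bump n R u0 (u + v) * bump n R u0 u) *
           cis ((l * norm v) * \<psi> u))) \<le> C * measure lborel K / (l * norm v) ^ Suc ?m"
        proof (rule C(2)[rule_format, of U K _ e p])
          show "continuous_on U \<psi>"
          proof -
            have "continuous_on U \<phi>" "continuous_on U (\<lambda>u. \<phi> (u + v))"
              using contV U sh by (auto intro: continuous_on_subset intro!: continuous_on_compose2[of V \<phi>] continuous_intros)
            then show ?thesis unfolding \<psi>_def using v by (intro continuous_intros) auto
          qed
          show "((\<lambda>t. \<psi> (u + t *\<^sub>R e)) has_real_derivative p u) (at 0)" if "u \<in> U" for u
          proof -
            have uW: "u + 0 *\<^sub>R e \<in> W" "u + v + 0 *\<^sub>R e \<in> W" using that sh U sub by auto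
            have "((\<lambda>t. (\<theta> \<bullet> \<phi> (u + v + t *\<^sub>R e) - \<theta> \<bullet> \<phi> (u + t *\<^sub>R e)) / norm v) has_real_derivative
              ((\<Sum>b\<in>Basis. (e \<bullet> b) * (\<theta> \<bullet> D b (u + v + 0 *\<^sub>R e))) - (\<Sum>b\<in>Basis. (e \<bullet> b) * (\<theta> \<bullet> D b (u + 0 *\<^sub>R e)))) / norm v) (at 0)"
              unfolding D_def
              by (intro DERIV_cdivide DERIV_diff smooth_on_line_derivative[OF W(1,2)] uW)
            then show ?thesis
              by (simp add: \<psi>_def p_def right_diff_distrib sum_subtractf add_ac diff_divide_distrib)
          qed
          show "c / 2 \<le> \<bar>p u\<bar>" if "u \<in> U" for u
          proof -
            \<comment> \<open>By the mean value theorem on the segment from \<open>u\<close> to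
              \<open>u + v\<close>, the difference of first derivatives in \<open>p\<close> becomes
              a Hessian value at an intermediate point, where \<open>Qlow\<close> applies.\<close>
            define h where "h t = (\<Sum>b\<in>Basis. (e \<bullet> b) * (\<theta> \<bullet> D b (u + t *\<^sub>R v)))" for t
            have seg: "u + t *\<^sub>R v \<in> V" if "0 \<le> t" "t \<le> 1" for t
            proof -
              have "norm (t *\<^sub>R v) \<le> 1 * norm v"
                unfolding norm_scaleR using that by (intro mult_right_mono) auto
              then have "norm (t *\<^sub>R v) \<le> 2 * R" using True by simp
              then show ?thesis using shiftV[OF \<open>u \<in> U\<close>] by blast
            qed
            have "(h has_real_derivative Q \<theta> (u + t *\<^sub>R v) v e) (at t)" if "0 \<le> t" "t \<le> 1" for t
              unfolding h_def[abs_def] Q_def D2_def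
              by (intro DERIV_sum DERIV_cmult smooth_on_line_derivative[OF sD W(2)]) (use seg[OF that] sub in auto)
            then obtain z where z: "0 < z" "z < 1" "h 1 - h 0 = (1 - 0) * Q \<theta> (u + z *\<^sub>R v) v e"
              using MVT2[of 0 1 h "\<lambda>t. Q \<theta> (u + t *\<^sub>R v) v e"] by auto
            have "p u = Q \<theta> (u + z *\<^sub>R v) v e / norm v"
              using z(3) by (simp add: p_def h_def right_diff_distrib sum_subtractf)
            moreover have "Q \<theta> (u + z *\<^sub>R v) v e \<ge> c / 2 * norm v"
              unfolding e_def using z seg by (intro Qlow th v Vr) auto
            ultimately have "p u \<ge> c / 2" using v by (simp add: pos_le_divide_eq)
            then show ?thesis by linarith
          qed
          show "bdd_derivs (Suc ?m) U e P p"
          proof -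
            have "bdd_derivs (Suc ?m) U e (\<Sum>b\<in>Basis. Bd b * norm v)
                (\<lambda>u. \<Sum>b\<in>Basis. (e \<bullet> b) * (\<theta> \<bullet> D b (u + v) - \<theta> \<bullet> D b u))"
              by (rule bdd_derivs_Basis_sum[OF e Bd(2)[OF e _ sh]]) (use Bd(1) th in auto)
            from bdd_derivs_cmult[OF this, of "1 / norm v"] show ?thesis
              using v by (simp add: p_def[abs_def] P_def sum_distrib_right[symmetric] del: bdd_derivs.simps)
          qed
          show "bdd_derivs (Suc ?m) U e Ab (\<lambda>u. bump n R u0 (u + v) * bump n R u0 u)"
            unfolding Ab_def using shift True
            by (intro bdd_derivs_mult bdd_derivs_translate[OF _ A'(2)] A2 A' e) auto
          show "bump n R u0 (u + v) * bump n R u0 u = 0" if "u \<in> U - K" for u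
            using that R n bump_eq_0[of n R u0 u] by (auto simp: K_def)
        qed (use U K v l in auto)
        moreover have "(l * norm v) * \<psi> u = l * (\<theta> \<bullet> \<phi> (u + v) - \<theta> \<bullet> \<phi> u)" for u
          using v by (simp add: \<psi>_def)
        ultimately have "J v \<le> C * measure lborel K / (l * norm v) ^ Suc ?m"
          unfolding J_def ff by (simp only:)
        also have "\<dots> \<le> Af / (l * norm v) ^ Suc ?m"
          using l by (intro divide_right_mono) (auto simp: Af_def)
        finally show ?thesis .
      qed
      have "integrable lborel f" unfolding f_def by (rule osc_integrable[OF contK])
      from norm_integral_squared_le_autocorrelation[OF this]
      have "ennreal ((cmod (LINT u|lborel. f u))\<^sup>2) \<le> (\<integral>\<^sup>+v. ennreal (J v) \<partial>lborel)"
        unfolding J_def .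
      also have "\<dots> \<le> ennreal (CC / l ^ ?m)" using CC(2) l J1 J2 by blast
      finally have "(cmod (LINT u|lborel. f u))\<^sup>2 \<le> CC / l ^ ?m"
        using CC(1) l by (subst (asm) ennreal_le_iff) auto
      then show "(cmod (osc_integral n R u0 \<phi> \<theta> l))\<^sup>2 \<le> CC / l ^ ?m"
        unfolding osc_integral_def f_def .
    qed
  qed
qed

section \<open>A measure on the cylinder with optimal decay\<close>

text \<open>Each unit \<theta>0 falls under one of the two preceding lemmas, which cover a
  neighbourhood of it; finitely many such neighbourhoods cover the unit sphere. The assumption
  \<open>alt\<close> is nondegeneracy of the Hessian in normal directions.\<close>

lemma osc_integral_decay:
  fixes \<phi> :: "'a::euclidean_space \<Rightarrow> 'b::euclidean_space" and u0 :: 'a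
  assumes W: "smooth_on \<phi> W" "open W" "u0 \<in> W" and n: "Suc DIM('a) < n"
    and alt: "\<And>\<theta>. norm \<theta> = 1 \<Longrightarrow> \<forall>b\<in>Basis. \<theta> \<bullet> frechet_derivative \<phi> (at u0) b = 0 \<Longrightarrow>
      (\<forall>v. (\<forall>b\<in>Basis. (\<Sum>b'\<in>Basis. (v \<bullet> b') *
        (\<theta> \<bullet> frechet_derivative (\<lambda>u. frechet_derivative \<phi> (at u) b) (at u0) b')) = 0) \<longrightarrow> v = 0)"
  shows "\<exists>R>0. cball u0 R \<subseteq> W \<and> (\<exists>C\<ge>0. \<forall>\<theta> l. norm \<theta> = 1 \<longrightarrow> l > 0 \<longrightarrow>
    (cmod (osc_integral n R u0 \<phi> \<theta> l))\<^sup>2 \<le> C / l ^ DIM('a))"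
proof -
  let ?m = "DIM('a)"
  let ?P = "\<lambda>\<theta>0 R0 \<epsilon>. R0 > 0 \<and> \<epsilon> > 0 \<and> (\<forall>R. 0 < R \<and> R \<le> R0 \<longrightarrow> (\<exists>C\<ge>0. \<forall>\<theta> l. norm \<theta> = 1 \<longrightarrow> dist \<theta>0 \<theta> < \<epsilon> \<longrightarrow> l > 0 \<longrightarrow>
    (cmod (osc_integral n R u0 \<phi> \<theta> l))\<^sup>2 \<le> C / l ^ ?m))"
  have "\<forall>\<theta>0\<in>sphere 0 1. \<exists>z. ?P \<theta>0 (fst z) (snd z)"
  proof
    fix \<theta>0 :: 'b assume "\<theta>0 \<in> sphere 0 1"
    then have th: "norm \<theta>0 = 1" by simp
    have n': "DIM('a) < n" using n by simp
    have "\<exists>R0>0. \<exists>\<epsilon>>0. (\<forall>R. 0 < R \<and> R \<le> R0 \<longrightarrow> (\<exists>C\<ge>0. \<forall>\<theta> l. norm \<theta> = 1 \<longrightarrow> dist \<theta>0 \<theta> < \<epsilon> \<longrightarrow> l > 0 \<longrightarrow>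
      (cmod (osc_integral n R u0 \<phi> \<theta> l))\<^sup>2 \<le> C / l ^ ?m))"
    proof (cases "\<forall>b\<in>Basis. \<theta>0 \<bullet> frechet_derivative \<phi> (at u0) b = 0")
      case True
      from alt[OF th True] show ?thesis by (intro osc_integral_nondegenerate[OF W n]) blast
    next
      case False
      then obtain b where "b \<in> Basis" "\<theta>0 \<bullet> frechet_derivative \<phi> (at u0) b \<noteq> 0" by blast
      then show ?thesis by (rule osc_integral_nonstationary[OF W n'])
    qed
    then obtain R0 \<epsilon> where "?P \<theta>0 R0 \<epsilon>" by blast
    then show "\<exists>z. ?P \<theta>0 (fst z) (snd z)" by (intro exI[of _ "(R0, \<epsilon>)"]) simp
  qed
  from bchoice[OF this] obtain z where z: "\<forall>\<theta>0\<in>sphere 0 1. ?P \<theta>0 (fst (z \<theta>0)) (snd (z \<theta>0))" by blast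
  have "sphere 0 1 \<subseteq> (\<Union>\<theta>0\<in>sphere 0 1. ball \<theta>0 (snd (z \<theta>0)))"
    using z by auto
  then obtain T where T: "T \<subseteq> sphere 0 1" "finite T" "sphere 0 1 \<subseteq> (\<Union>\<theta>0\<in>T. ball \<theta>0 (snd (z \<theta>0)))"
    using compactE_image[OF compact_sphere, of "sphere 0 1" "\<lambda>\<theta>0. ball \<theta>0 (snd (z \<theta>0))" 0 1] by auto
  obtain r where r: "r > 0" "cball u0 r \<subseteq> W" using W open_contains_cball by blast
  \<comment> \<open>A common radius for the finite subcover, also small enough to stay in
    \<open>W\<close>. The constants belong to this \<open>R\<close> and are summed.\<close>
  define R where "R = Min (insert r ((fst \<circ> z) ` T))"
  have fin: "finite (insert r ((fst \<circ> z) ` T))" using T by simp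
  have R: "R > 0" "R \<le> r" "\<And>t. t \<in> T \<Longrightarrow> R \<le> fst (z t)"
    unfolding R_def using fin r z T by (auto simp: Min_gr_iff)
  have "\<forall>t\<in>T. \<exists>C\<ge>0. \<forall>\<theta> l. norm \<theta> = 1 \<longrightarrow> dist t \<theta> < snd (z t) \<longrightarrow> l > 0 \<longrightarrow>
    (cmod (osc_integral n R u0 \<phi> \<theta> l))\<^sup>2 \<le> C / l ^ ?m"
    using z T(1) R by blast
  then have "\<forall>t\<in>T. \<exists>C. C \<ge> 0 \<and> (\<forall>\<theta> l. norm \<theta> = 1 \<longrightarrow> dist t \<theta> < snd (z t) \<longrightarrow> l > 0 \<longrightarrow>
    (cmod (osc_integral n R u0 \<phi> \<theta> l))\<^sup>2 \<le> C / l ^ ?m)" by blast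
  from bchoice[OF this] obtain C where C: "\<And>t. t \<in> T \<Longrightarrow> C t \<ge> 0"
    "\<And>t \<theta> l. t \<in> T \<Longrightarrow> norm \<theta> = 1 \<Longrightarrow> dist t \<theta> < snd (z t) \<Longrightarrow> l > 0 \<Longrightarrow>
    (cmod (osc_integral n R u0 \<phi> \<theta> l))\<^sup>2 \<le> C t / l ^ ?m" by blast
  have "(cmod (osc_integral n R u0 \<phi> \<theta> l))\<^sup>2 \<le> (\<Sum>t\<in>T. C t) / l ^ ?m" if th: "norm \<theta> = 1" and l: "l > 0" for \<theta> l
  proof -
    have "\<theta> \<in> sphere 0 1" using th by simp
    then obtain t where t: "t \<in> T" "dist t \<theta> < snd (z t)" using T(3) by auto
    have "(cmod (osc_integral n R u0 \<phi> \<theta> l))\<^sup>2 \<le> C t / l ^ ?m" by (rule C(2)[OF t(1) th t(2) l])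
    also have "\<dots> \<le> (\<Sum>t\<in>T. C t) / l ^ ?m"
      using l C(1) t T(2) by (intro divide_right_mono member_le_sum) auto
    finally show ?thesis .
  qed
  moreover have "(\<Sum>t\<in>T. C t) \<ge> 0" using C(1) by (simp add: sum_nonneg)
  moreover have "cball u0 R \<subseteq> W" using r R by (meson subset_cball order_trans)
  ultimately show ?thesis using R(1) by blast
qed

section \<open>Interior charts and the second fundamental form\<close>

text \<open>A chart at a boundary point becomes an interior chart after restriction to the open
  half-space: the homeomorphism keeps the image relatively open in \<open>S\<close>.\<close>

lemma interior_chart_exists:
  fixes S :: "(real^'n) set"
  assumes "smooth_hypersurface TYPE('m::finite) S" "S \<noteq> {}"
  obtains \<phi> :: "real^'m \<Rightarrow> real^'n" and W u0 where "hs_chart S \<phi> W UNIV" "u0 \<in> W"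
proof -
  obtain p where "p \<in> S" using assms by blast
  then obtain \<phi> :: "real^'m \<Rightarrow> real^'n" and W P where P: "model_space P" and ch: "hs_chart S \<phi> W P" and p: "p \<in> \<phi> ` (W \<inter> P)"
    using assms(1) unfolding smooth_hypersurface_def by blast
  obtain u1 where u1: "u1 \<in> W" "u1 \<in> P" using p by blast
  from P show ?thesis unfolding model_space_def
  proof
    assume "P = UNIV"
    then show ?thesis using that ch u1 by blast
  next
    assume "\<exists>k. P = {u. 0 \<le> u $ k}"
    then obtain k where k: "P = {u. 0 \<le> u $ k}" by blast
    define W' where "W' = W \<inter> {u. 0 < u $ k}"
    have W: "open W" "smooth_on \<phi> W" "\<forall>u\<in>W. inj (frechet_derivative \<phi> (at u))"
      using ch by (auto simp: hs_chart_def)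
    obtain \<psi> where hom: "homeomorphism (W \<inter> P) (\<phi> ` (W \<inter> P)) \<phi> \<psi>" using ch by (auto simp: hs_chart_def)
    obtain V where V: "open V" "\<phi> ` (W \<inter> P) = S \<inter> V" using ch unfolding hs_chart_def by blast
    have W': "open W'" unfolding W'_def
      by (intro open_Int W open_Collect_less continuous_intros)
    have sub: "W' \<subseteq> W \<inter> P" by (auto simp: W'_def k)
    have "openin (top_of_set (W \<inter> P)) W'" using W' sub by (simp add: openin_open_eq open_subset)
    then have "openin (top_of_set (\<phi> ` (W \<inter> P))) (\<phi> ` W')"
      by (rule homeomorphism_imp_open_map[OF hom])
    then obtain V1 where V1: "open V1" "\<phi> ` W' = \<phi> ` (W \<inter> P) \<inter> V1" unfolding openin_open by blast
    have "\<phi> ` W' = S \<inter> (V \<inter> V1)" using V1 V by blast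
    moreover have "homeomorphism W' (\<phi> ` W') \<phi> \<psi>"
      by (rule homeomorphism_of_subsets[OF hom sub]) (use sub in auto)
    moreover have "smooth_on \<phi> W'"
    proof -
      have "Ck_on j f W'" if "Ck_on j f W" for j and f :: "real^'m \<Rightarrow> real^'n"
        using that
      proof (induction j arbitrary: f)
        case 0
        then show ?case by (auto intro: continuous_on_subset simp: W'_def)
      next
        case (Suc j)
        then show ?case by (auto simp: W'_def intro: differentiable_on_subset)
      qed
      then show ?thesis using W unfolding smooth_on_def by blast
    qed
    ultimately have "hs_chart S \<phi> W' UNIV"
      using W' W V V1 unfolding hs_chart_def by (auto simp: W'_def intro!: exI[of _ "V \<inter> V1"])
    moreover obtain u0 where "u0 \<in> W'"
    proof -
      obtain e where e: "e > 0" "ball u1 e \<subseteq> W" using W u1 openE by blast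
      \<comment> \<open>Moving the base point inwards makes the k-th coordinate strictly positive,
        even if it was 0.\<close>
      define u where "u = u1 + (e / 2) *\<^sub>R axis k 1"
      have "dist u1 u < e" using e by (simp add: u_def dist_norm)
      moreover have "u $ k > 0" using u1 k e by (simp add: u_def axis_def)
      ultimately show ?thesis using e that[of u] by (auto simp: W'_def)
    qed
    ultimately show ?thesis by (rule that)
  qed
qed

lemma Basis_vec_real: "(Basis :: (real^'m) set) = range (\<lambda>i. axis i 1)"
  by (auto simp: Basis_vec_def)

text \<open>For a unit normal \<theta> the inner sums are the entries of the second fundamental form
  applied to \<open>v\<close>. Its determinant is the numerator of the curvature, hence
  nonzero.\<close>

lemma unit_normal_nondegenerate:
  fixes \<phi> :: "real^'m \<Rightarrow> real^'n" and S :: "(real^'n) set"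
  assumes "nonvanishing_gauss_interior TYPE('m::finite) S" "hs_chart S \<phi> W UNIV" "u0 \<in> W" "norm \<theta> = 1"
    and "\<forall>b\<in>Basis. \<theta> \<bullet> frechet_derivative \<phi> (at u0) b = 0"
    and v: "\<forall>b\<in>Basis. (\<Sum>b'\<in>Basis. (v \<bullet> b') *
        (\<theta> \<bullet> frechet_derivative (\<lambda>u. frechet_derivative \<phi> (at u) b) (at u0) b')) = 0"
  shows "v = 0"
proof -
  have "unit_normal \<phi> u0 \<theta>"
    using assms(4,5) by (auto simp: unit_normal_def pd_def)
  then have "gauss_curvature \<phi> \<theta> u0 \<noteq> 0"
    using assms(1-3) unfolding nonvanishing_gauss_interior_def by blast
  then have "det (second_fundamental_form \<phi> \<theta> u0) \<noteq> 0"
    by (auto simp: gauss_curvature_def)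
  then have "invertible (second_fundamental_form \<phi> \<theta> u0)" by (simp add: invertible_det_nz)
  then have ker: "\<And>x. second_fundamental_form \<phi> \<theta> u0 *v x = 0 \<Longrightarrow> x = 0"
    using matrix_left_invertible_ker unfolding invertible_def by metis
  have inj: "inj (\<lambda>i::'m. axis i (1::real))" by (auto simp: inj_def axis_eq_axis)
  have "(second_fundamental_form \<phi> \<theta> u0 *v v) $ i = 0" for i
  proof -
    have "(second_fundamental_form \<phi> \<theta> u0 *v v) $ i = (\<Sum>j\<in>UNIV. (v \<bullet> axis j 1) *
        (\<theta> \<bullet> frechet_derivative (\<lambda>u. frechet_derivative \<phi> (at u) (axis i 1)) (at u0) (axis j 1)))"
      by (simp add: second_fundamental_form_def matrix_vector_mult_def pd2_def pd_def
          inner_axis inner_commute mult.commute)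
    also have "\<dots> = (\<Sum>b'\<in>Basis. (v \<bullet> b') *
        (\<theta> \<bullet> frechet_derivative (\<lambda>u. frechet_derivative \<phi> (at u) (axis i 1)) (at u0) b'))"
      unfolding Basis_vec_real by (subst sum.reindex[OF inj]) simp
    also have "\<dots> = 0" using v by simp
    finally show ?thesis .
  qed
  then have "second_fundamental_form \<phi> \<theta> u0 *v v = 0" by (simp add: vec_eq_iff)
  then show ?thesis by (rule ker)
qed

section \<open>The product with a Gaussian\<close>

lemma power_mult_exp_minus_square_le:
  fixes x :: real
  assumes "x \<ge> 0"
  shows "x ^ m * exp (- x\<^sup>2) \<le> fact m"
proof (cases "x \<le> 1")
  case True
  have "x ^ m * exp (- x\<^sup>2) \<le> 1 * 1" using assms True by (intro mult_mono) (auto intro: power_le_one)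
  also have "\<dots> \<le> fact m" by (simp add: fact_ge_1)
  finally show ?thesis .
next
  case False
  then have "x \<le> x\<^sup>2" by (simp add: power2_eq_square)
  then have "x ^ m * exp (- x\<^sup>2) \<le> x ^ m * exp (- x)" using assms by (intro mult_left_mono) auto
  also have "\<dots> \<le> fact m"
  proof -
    have "x ^ m /\<^sub>R fact m \<le> (\<Sum>k. x ^ k /\<^sub>R fact k)"
      using sum_le_suminf[OF summable_exp_generic[of x], of "{m}"] assms by auto
    then have "x ^ m / fact m \<le> exp x" by (simp add: exp_def divide_inverse mult.commute)
    then show ?thesis by (simp add: exp_minus field_simps)
  qed
  finally show ?thesis .
qed

lemma cis_measurable [measurable]: "cis \<in> borel_measurable borel"
  by (intro borel_measurable_continuous_onI continuous_intros)

text \<open>The measure is the image of a product, so its transform factors as A(\<xi>) B(\<eta>).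
  The power of |(\<xi>, \<eta>)| splits into powers of |\<xi>| and |\<eta>|, each absorbed by its
  own factor while the other factor stays bounded.\<close>

lemma cylinder_measure_decay:
  fixes \<phi> :: "'a::euclidean_space \<Rightarrow> 'b::euclidean_space"
  assumes n: "n > 0" and R: "R > 0" and cont: "continuous_on (cball u0 R) \<phi>" and S: "\<phi> ` cball u0 R \<subseteq> S"
    and C: "C \<ge> 0" "\<And>\<theta> l. norm \<theta> = 1 \<Longrightarrow> l > 0 \<Longrightarrow> (cmod (osc_integral n R u0 \<phi> \<theta> l))\<^sup>2 \<le> C / l ^ m"
    and m: "m > 0"
  shows "\<exists>M \<in> finite_measures_on (S \<times> (UNIV :: real set)).
    \<exists>C. \<forall>\<xi>. norm \<xi> powr (real m / 2) * norm (fourier_transform M \<xi>) \<le> C"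
proof -
  \<comment> \<open>The default value \<phi>(u0) makes the map Borel on the whole space with values
    in the compact image of the ball; the density vanishes where the default is used.\<close>
  define \<phi>' where "\<phi>' u = (if u \<in> cball u0 R then \<phi> u else \<phi> u0)" for u
  have [measurable]: "\<phi>' \<in> borel_measurable borel"
    unfolding \<phi>'_def[abs_def]
    by (rule borel_measurable_continuous_on_if) (use cont in auto)
  define a where "a u = indicator (cball u0 R) u * bump n R u0 u" for u
  have a_nn: "a u \<ge> 0" for u by (simp add: a_def bump_nonneg)
  have ai: "integrable lborel a"
    using borel_integrable_compact[OF compact_cball bump_continuous, of u0 R n R u0] by (simp add: a_def[abs_def])
  then have [measurable]: "a \<in> borel_measurable borel" by auto
  define N where "N = density lborel (\<lambda>u. ennreal (a u))"
  define G where "G = std_normal_distribution"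
  interpret G: prob_space G unfolding G_def by (rule prob_space_normal_density) simp
  have [simp]: "sets N = sets borel" "space N = UNIV" "sets G = sets borel" "space G = UNIV"
    by (auto simp: N_def G_def)
  have [measurable_cong]: "sets N = sets borel" "sets G = sets borel" by auto
  have emN: "emeasure N UNIV = ennreal (LINT u|lborel. a u)"
    using ai a_nn by (simp add: N_def emeasure_density nn_integral_eq_integral)
  interpret N: finite_measure N
    by (rule finite_measureI) (simp add: emN)
  interpret NG: pair_sigma_finite N G ..
  have [measurable]: "(\<lambda>z. (\<phi>' (fst z), snd z)) \<in> measurable (N \<Otimes>\<^sub>M G) borel"
    unfolding borel_prod[symmetric] by measurable
  define M where "M = distr (N \<Otimes>\<^sub>M G) borel (\<lambda>z. (\<phi>' (fst z), snd z))"
  have emM: "emeasure M UNIV = ennreal (LINT u|lborel. a u)"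
  proof -
    have "emeasure M UNIV = emeasure (N \<Otimes>\<^sub>M G) (UNIV \<times> UNIV)"
      by (simp add: M_def emeasure_distr space_pair_measure)
    also have "\<dots> = emeasure N UNIV * emeasure G UNIV"
      by (subst G.emeasure_pair_measure_Times) auto
    also have "emeasure G UNIV = 1" using G.emeasure_space_1 by simp
    finally show ?thesis by (simp add: emN)
  qed
  have pos: "(LINT u|lborel. a u) > 0"
  proof (rule ccontr)
    assume "\<not> (LINT u|lborel. a u) > 0"
    then have "(LINT u|lborel. a u) = 0" using a_nn by (simp add: not_less integral_nonneg_eq_0_iff_AE order_antisym integral_nonneg)
    then have "AE u in lborel. a u = 0" using ai a_nn by (subst (asm) integral_nonneg_eq_0_iff_AE) auto
    then have "AE u in lborel. u \<notin> ball u0 R"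
    proof (rule AE_mp, intro AE_I2 impI notI)
      fix u assume "a u = 0" "u \<in> ball u0 R"
      then show False using bump_pos[of R u0 u n] R by (auto simp: a_def)
    qed
    then have "emeasure lborel (ball u0 R) = 0"
      by (subst (asm) AE_iff_measurable[of "ball u0 R"]) auto
    then show False using R unit_ball_vol_pos[of "real DIM('a)"] by (simp add: emeasure_ball)
  qed
  have "M \<in> finite_measures_on (S \<times> UNIV)"
  proof -
    have "AE z in M. z \<in> \<phi> ` cball u0 R \<times> UNIV"
    proof -
      have "\<phi>' u \<in> \<phi> ` cball u0 R" for u using R by (auto simp: \<phi>'_def)
      moreover have "closed (\<phi> ` cball u0 R \<times> (UNIV :: real set))"
        by (rule closed_Times[OF compact_imp_closed[OF compact_continuous_image[OF cont compact_cball]] closed_UNIV])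
      ultimately show ?thesis unfolding M_def by (subst AE_distr_iff) auto
    qed
    then have "AE z in M. z \<in> S \<times> UNIV" using S by (auto elim!: eventually_mono)
    then show ?thesis using pos by (simp add: finite_measures_on_def emM) (simp add: M_def)
  qed
  moreover have "\<exists>C. \<forall>\<xi>. norm \<xi> powr (real m / 2) * norm (fourier_transform M \<xi>) \<le> C"
  proof -
    define A where "A \<xi> = (LINT u|N. cis (- (2 * pi * (\<phi>' u \<bullet> \<xi>))))" for \<xi>
    define B where "B \<eta> = (LINT h|G. cis (- (2 * pi * (h * \<eta>))))" for \<eta>
    define A0 where "A0 = (LINT u|lborel. a u)"
    have ft: "fourier_transform M (\<xi>, \<eta>) = A \<xi> * B \<eta>" for \<xi> \<eta>
    proof -
      let ?f = "\<lambda>u h. cis (- (2 * pi * (\<phi>' u \<bullet> \<xi>))) * cis (- (2 * pi * (h * \<eta>)))"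
      have fm: "finite_measure (N \<Otimes>\<^sub>M G)"
        by (rule finite_measureI) (use emM in \<open>simp add: M_def emeasure_distr\<close>)
      have int: "integrable (N \<Otimes>\<^sub>M G) (\<lambda>(u, h). ?f u h)"
        by (rule finite_measure.integrable_const_bound[OF fm, where B=1]) (auto simp: norm_mult)
      have "fourier_transform M (\<xi>, \<eta>) = (LINT z|(N \<Otimes>\<^sub>M G). cis (- (2 * pi * ((\<phi>' (fst z), snd z) \<bullet> (\<xi>, \<eta>)))))"
        unfolding fourier_transform_def M_def by (subst integral_distr) auto
      also have "\<dots> = (LINT z|(N \<Otimes>\<^sub>M G). (case z of (u, h) \<Rightarrow> ?f u h))"
        by (intro Bochner_Integration.integral_cong) (auto simp: cis_mult algebra_simps)
      also have "\<dots> = (LINT u|N. LINT h|G. ?f u h)"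
        using NG.integral_fst[OF int] by simp
      also have "\<dots> = A \<xi> * B \<eta>" by (simp add: A_def B_def)
      finally show ?thesis .
    qed
    have Beq: "cmod (B \<eta>) = exp (- (2 * pi * \<eta>)\<^sup>2 / 2)" for \<eta>
    proof -
      have "B \<eta> = char G (- (2 * pi * \<eta>))"
        by (simp add: B_def char_def cis_conv_exp mult_ac)
      then show ?thesis by (simp add: G_def char_std_normal_distribution)
    qed
    have Aeq: "A \<xi> = (LINT u|lborel. indicator (cball u0 R) u *\<^sub>R (of_real (bump n R u0 u) * cis (- (2 * pi * (\<phi> u \<bullet> \<xi>)))))" for \<xi>
    proof -
      have "A \<xi> = (LINT u|lborel. a u *\<^sub>R cis (- (2 * pi * (\<phi>' u \<bullet> \<xi>))))"
        unfolding A_def N_def by (subst integral_density) (use a_nn in auto)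
      also have "\<dots> = (LINT u|lborel. indicator (cball u0 R) u *\<^sub>R (of_real (bump n R u0 u) * cis (- (2 * pi * (\<phi> u \<bullet> \<xi>)))))"
        by (intro Bochner_Integration.integral_cong) (auto simp: a_def \<phi>'_def indicator_def scaleR_conv_of_real)
      finally show ?thesis .
    qed
    have A1: "norm \<xi> ^ m * (cmod (A \<xi>))\<^sup>2 \<le> C / (2 * pi) ^ m" for \<xi>
    proof (cases "\<xi> = 0")
      case True
      then show ?thesis using m C(1) by (simp add: zero_power)
    next
      case False
      have "A \<xi> = osc_integral n R u0 \<phi> (- \<xi> /\<^sub>R norm \<xi>) (2 * pi * norm \<xi>)"
        unfolding Aeq osc_integral_def using False
        by (intro Bochner_Integration.integral_cong) (auto simp: inner_commute field_simps)
      then have "(cmod (A \<xi>))\<^sup>2 \<le> C / (2 * pi * norm \<xi>) ^ m"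
        using C(2)[of "- \<xi> /\<^sub>R norm \<xi>" "2 * pi * norm \<xi>"] False by simp
      then show ?thesis using False by (simp add: field_simps power_mult_distrib)
    qed
    have A2: "cmod (A \<xi>) \<le> A0" for \<xi>
      unfolding A_def
    proof (rule order_trans[OF integral_norm_bound])
      have "(LINT u|N. norm (cis (- (2 * pi * (\<phi>' u \<bullet> \<xi>))))) = measure N UNIV" by simp
      also have "\<dots> = A0" using pos by (simp add: measure_def emN A0_def)
      finally show "(LINT u|N. norm (cis (- (2 * pi * (\<phi>' u \<bullet> \<xi>))))) \<le> A0" by simp
    qed
    have A0: "A0 > 0" using pos by (simp add: A0_def)
    \<comment> \<open>Everything is squared, as the oscillatory bound is. \<open>2 ^ m\<close> comes
      from replacing the norm by twice the larger component norm, \<open>(2 * pi) ^ m\<close> from l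
      = 2 \<pi> |\<xi>|, and \<open>fact m\<close> from the Gaussian.\<close>
    define K where "K = 2 ^ m * (C / (2 * pi) ^ m + A0\<^sup>2 * fact m)"
    have "norm \<zeta> powr (real m / 2) * norm (fourier_transform M \<zeta>) \<le> sqrt K" for \<zeta> :: "'b \<times> real"
    proof (cases "\<zeta> = 0")
      case True
      then show ?thesis using C(1) by (simp add: K_def)
    next
      case False
      obtain \<xi> \<eta> where z: "\<zeta> = (\<xi>, \<eta>)" by (cases \<zeta>)
      have "(norm \<zeta> powr (real m / 2))\<^sup>2 = norm \<zeta> ^ m"
        using False by (simp add: power2_eq_square powr_add[symmetric] powr_realpow)
      also have "\<dots> \<le> (norm \<xi> + \<bar>\<eta>\<bar>) ^ m"
        unfolding z norm_Pair by (intro power_mono) (auto intro: sqrt_sum_squares_le_sum[of "norm \<xi>" "\<bar>\<eta>\<bar>", simplified])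
      also have "\<dots> \<le> (2 * max (norm \<xi>) \<bar>\<eta>\<bar>) ^ m" by (intro power_mono) auto
      also have "\<dots> \<le> 2 ^ m * (norm \<xi> ^ m + \<bar>\<eta>\<bar> ^ m)"
        by (auto simp: power_mult_distrib max_def intro!: mult_left_mono)
      finally have 1: "(norm \<zeta> powr (real m / 2))\<^sup>2 \<le> 2 ^ m * (norm \<xi> ^ m + \<bar>\<eta>\<bar> ^ m)" .
      have B1: "(cmod (B \<eta>))\<^sup>2 \<le> 1" by (simp add: Beq power_le_one)
      have B2: "\<bar>\<eta>\<bar> ^ m * (cmod (B \<eta>))\<^sup>2 \<le> fact m"
      proof -
        \<comment> \<open>Squaring exp(-x^2 / 2) at x = 2 \<pi> |\<eta>| gives the factor exp(-x^2)
          of \<open>power_mult_exp_minus_square_le\<close>.\<close>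
        have "\<bar>\<eta>\<bar> \<le> 2 * pi * \<bar>\<eta>\<bar>" using pi_gt3 by (simp add: mult_le_cancel_right1)
        then have "\<bar>\<eta>\<bar> ^ m * (cmod (B \<eta>))\<^sup>2 \<le> (2 * pi * \<bar>\<eta>\<bar>) ^ m * exp (- (2 * pi * \<bar>\<eta>\<bar>)\<^sup>2)"
          by (intro mult_mono power_mono)
            (auto simp: Beq power2_eq_square exp_add[symmetric] mult_exp_exp)
        also have "\<dots> \<le> fact m" by (rule power_mult_exp_minus_square_le) simp
        finally show ?thesis .
      qed
      have "(norm \<zeta> powr (real m / 2) * norm (fourier_transform M \<zeta>))\<^sup>2 =
          (norm \<zeta> powr (real m / 2))\<^sup>2 * ((cmod (A \<xi>))\<^sup>2 * (cmod (B \<eta>))\<^sup>2)"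
        by (simp add: z ft norm_mult power_mult_distrib)
      also have "\<dots> \<le> 2 ^ m * (norm \<xi> ^ m + \<bar>\<eta>\<bar> ^ m) * ((cmod (A \<xi>))\<^sup>2 * (cmod (B \<eta>))\<^sup>2)"
        by (intro mult_right_mono 1) auto
      also have "\<dots> = 2 ^ m * ((norm \<xi> ^ m * (cmod (A \<xi>))\<^sup>2) * (cmod (B \<eta>))\<^sup>2 + (cmod (A \<xi>))\<^sup>2 * (\<bar>\<eta>\<bar> ^ m * (cmod (B \<eta>))\<^sup>2))"
        by (simp add: algebra_simps)
      also have "\<dots> \<le> 2 ^ m * (C / (2 * pi) ^ m * 1 + A0\<^sup>2 * fact m)"
        using C(1) by (intro mult_left_mono add_mono mult_mono A1 B1 B2 power_mono A2) auto
      finally have "(norm \<zeta> powr (real m / 2) * norm (fourier_transform M \<zeta>))\<^sup>2 \<le> K" by (simp add: K_def)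
      then show ?thesis by (rule real_le_rsqrt)
    qed
    then show ?thesis by blast
  qed
  ultimately show ?thesis by blast
qed

lemma cylinder_measure_exists:
  fixes S :: "(real^'n) set"
  assumes "S \<noteq> {}" "smooth_hypersurface TYPE('m::finite) S" "nonvanishing_gauss_interior TYPE('m::finite) S"
  shows "\<exists>M \<in> finite_measures_on (S \<times> (UNIV :: real set)).
    \<exists>C. \<forall>\<xi>. norm \<xi> powr (real CARD('m) / 2) * norm (fourier_transform M \<xi>) \<le> C"
proof -
  obtain \<phi> :: "real^'m \<Rightarrow> real^'n" and W u0 where ch: "hs_chart S \<phi> W UNIV" and u0: "u0 \<in> W"
    by (rule interior_chart_exists[OF assms(2,1)])
  have W: "open W" "smooth_on \<phi> W" and S: "\<phi> ` W \<subseteq> S"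
    using ch by (auto simp: hs_chart_def)
  \<comment> \<open>The smallest admissible power: derivatives of order up to m + 1 of the bump must
    exist and be continuous, with m the dimension of the parameter space.\<close>
  define n where "n = Suc (Suc DIM(real^'m))"
  have n: "Suc DIM(real^'m) < n" by (simp add: n_def)
  obtain R C where R: "R > 0" "cball u0 R \<subseteq> W" and C: "C \<ge> 0"
    "\<And>\<theta> l. norm \<theta> = 1 \<Longrightarrow> l > 0 \<Longrightarrow> (cmod (osc_integral n R u0 \<phi> \<theta> l))\<^sup>2 \<le> C / l ^ DIM(real^'m)"
    using osc_integral_decay[OF W(2,1) u0 n] unit_normal_nondegenerate[OF assms(3) ch u0] by blast
  show ?thesis
  proof (rule cylinder_measure_decay[of n R u0 \<phi> S C])
    show "continuous_on (cball u0 R) \<phi>"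
      using smooth_on_continuous_on[OF W(2)] R continuous_on_subset by blast
    show "\<phi> ` cball u0 R \<subseteq> S" using R S by blast
  qed (use R C n in auto)
qed

section \<open>Decay and concentration near the diagonal\<close>

text \<open>Serves both sides of the Fubini identity below: with the measure \<open>M\<close> it
  yields the squared transform, with Lebesgue measure on a small ball the squared kernel.\<close>

lemma integral_pair_cnj:
  fixes f :: "'a \<Rightarrow> complex"
  assumes A: "finite_measure A" and [measurable]: "f \<in> borel_measurable A" and "\<And>x. cmod (f x) \<le> 1"
  shows "(LINT z|(A \<Otimes>\<^sub>M A). f (fst z) * cnj (f (snd z))) = of_real ((cmod (LINT x|A. f x))\<^sup>2)"
proof -
  interpret finite_measure A by fact
  interpret AA: pair_sigma_finite A A ..
  interpret P: finite_measure "A \<Otimes>\<^sub>M A" by (rule finite_measure_pair_measure) unfold_locales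
  have [measurable]: "(\<lambda>x. cnj (f x)) \<in> borel_measurable A"
    by (intro borel_measurable_continuous_on[where f=cnj] continuous_intros) auto
  have "integrable (A \<Otimes>\<^sub>M A) (\<lambda>z. f (fst z) * cnj (f (snd z)))"
    using assms(3) by (intro P.integrable_const_bound[where B=1]) (auto simp: norm_mult intro!: mult_le_one)
  then have int: "integrable (A \<Otimes>\<^sub>M A) (case_prod (\<lambda>x y. f x * cnj (f y)))"
    by (simp add: case_prod_beta')
  have fi: "integrable A f" using assms(3) by (intro integrable_const_bound[where B=1]) auto
  have "(LINT z|(A \<Otimes>\<^sub>M A). f (fst z) * cnj (f (snd z))) = (LINT x|A. LINT y|A. f x * cnj (f y))"
    using AA.integral_fst[OF int] by (simp add: case_prod_beta')
  also have "\<dots> = (LINT x|A. f x) * cnj (LINT x|A. f x)" using fi by simp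
  finally show ?thesis by (simp only: complex_norm_square)
qed

text \<open>The kernel \<open>\<bar>\<integral>\<^sub>B cis (- 2 \<pi> w \<bullet> \<zeta> / r) d\<zeta>\<bar>\<^sup>2\<close> is nonnegative everywhere and bounded below for
  \<open>norm w \<le> r\<close>, while its frequencies are the points \<open>(\<zeta> - \<zeta>') / r\<close>.\<close>

lemma fourier_decay_near_diagonal:
  fixes M :: "'b::euclidean_space measure"
  assumes M: "finite_measure M" "sets M = sets borel"
    and s: "0 \<le> s" "s < real DIM('b)"
    and decay: "\<And>\<xi>. norm \<xi> powr (s / 2) * norm (fourier_transform M \<xi>) \<le> C"
  shows "\<exists>K\<ge>0. \<forall>r>0. measure (M \<Otimes>\<^sub>M M) {z. dist (fst z) (snd z) \<le> r} \<le> K * r powr s"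
proof -
  interpret M: finite_measure M by fact
  have [simp]: "space M = UNIV" using sets_eq_imp_space_eq[OF M(2)] by simp
  note [measurable_cong] = M(2)
  \<comment> \<open>For |w| \<le> r and |\<zeta>| < 1/8 the phase is at most \<pi>/4, below \<pi>/3,
    so its cosine is at least 1/2. Differences of two points of this ball also stay inside the unit
    ball on which \<open>I\<close> is taken.\<close>
  let ?B = "ball (0::'b) (1 / 8)"
  define v where "v = measure lborel ?B"
  have v: "v > 0" by (simp add: v_def content_ball_gt_0_iff[unfolded measure_completion, simplified] emeasure_ball measure_def)
  have [measurable]: "?B \<in> sets borel" "cball (0::'b) 1 \<in> sets borel" by simp_all
  have indB [simp, measurable]: "(indicator ?B :: 'b \<Rightarrow> ennreal) \<in> borel_measurable borel"
    by (rule borel_measurable_indicator) simp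
  define L where "L = density lborel (indicator ?B :: 'b \<Rightarrow> ennreal)"
  have [simp]: "sets L = sets borel" "space L = UNIV" by (auto simp: L_def)
  have [measurable_cong]: "sets L = sets borel" by simp
  have AE_L: "AE \<zeta> in L. \<zeta> \<in> ?B"
    unfolding L_def by (subst AE_density) (auto simp: indicator_def simp del: mem_ball)
  have fB: "emeasure lborel ?B < \<infinity>" by (rule emeasure_bounded_finite) simp
  have emL: "emeasure L UNIV = emeasure lborel ?B"
    unfolding L_def by (subst emeasure_density) (simp_all add: borel_measurable_indicator)
  have emL': "emeasure L UNIV = ennreal v" unfolding emL v_def using fB by (simp add: emeasure_eq_ennreal_measure)
  interpret L: finite_measure L by (rule finite_measureI) (simp add: emL')
  have measL: "measure L UNIV = v" using emL' v by (simp add: measure_def)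
  interpret MM: finite_measure "M \<Otimes>\<^sub>M M" by (rule finite_measure_pair_measure) unfold_locales
  interpret LL: finite_measure "L \<Otimes>\<^sub>M L" by (rule finite_measure_pair_measure) unfold_locales
  interpret pML: pair_sigma_finite "M \<Otimes>\<^sub>M M" "L \<Otimes>\<^sub>M L" ..
  interpret pM: pair_sigma_finite M M ..
  interpret pL: pair_sigma_finite L L ..
  have [simp]: "space (M \<Otimes>\<^sub>M M) = UNIV" "space (L \<Otimes>\<^sub>M L) = UNIV" by (auto simp: space_pair_measure)
  have "C \<ge> 0" using decay[of 0] by simp
  define I where "I = (\<integral>\<^sup>+w. ennreal (norm (w::'b) powr - s) * indicator (cball 0 1) w \<partial>lborel)"
  have I: "I < \<infinity>" unfolding I_def by (rule nn_integral_norm_powr_finite[OF s])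
  \<comment> \<open>Numerator: the upper bound for the double integral of the squared transform,
    with \<open>v\<close> from the outer variable. Denominator: the lower bound for the squared
    kernel near the diagonal.\<close>
  define K where "K = enn2real I * C\<^sup>2 * v / (v / 2)\<^sup>2"
  show ?thesis
  proof (intro exI[of _ K] conjI allI impI)
    show "K \<ge> 0" using v by (simp add: K_def)
    fix r :: real assume r: "r > 0"
    define g where "g w = (LINT \<zeta>|L. cis (- (2 * pi * (w \<bullet> \<zeta>)) / r))" for w :: 'b
    \<comment> \<open>One bounded integrand in four variables: integrating out the frequencies
      \<open>y\<close> leaves the squared kernel, integrating out the points \<open>z\<close> leaves
      the squared transform of \<open>M\<close>.\<close>
    define F where "F z y = cis (- (2 * pi * ((fst z - snd z) \<bullet> (fst y - snd y))) / r)" for z y :: "'b \<times> 'b"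
    have [measurable]: "(\<lambda>p. F (fst p) (snd p)) \<in> borel_measurable ((M \<Otimes>\<^sub>M M) \<Otimes>\<^sub>M (L \<Otimes>\<^sub>M L))"
      unfolding F_def by measurable
    have fin4: "finite_measure ((M \<Otimes>\<^sub>M M) \<Otimes>\<^sub>M (L \<Otimes>\<^sub>M L))"
      by (rule finite_measure_pair_measure) unfold_locales
    have "integrable ((M \<Otimes>\<^sub>M M) \<Otimes>\<^sub>M (L \<Otimes>\<^sub>M L)) (\<lambda>p. F (fst p) (snd p))"
      by (rule finite_measure.integrable_const_bound[OF fin4, where B=1]) (auto simp: F_def)
    then have int: "integrable ((M \<Otimes>\<^sub>M M) \<Otimes>\<^sub>M (L \<Otimes>\<^sub>M L)) (case_prod F)"
      by (simp add: case_prod_beta')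
    have inL: "(LINT y|(L \<Otimes>\<^sub>M L). F z y) = of_real ((cmod (g (fst z - snd z)))\<^sup>2)" for z
    proof -
      have "F z y = cis (- (2 * pi * ((fst z - snd z) \<bullet> fst y)) / r) * cnj (cis (- (2 * pi * ((fst z - snd z) \<bullet> snd y)) / r))" for y
        by (simp add: F_def cis_cnj cis_mult inner_diff_right diff_divide_distrib[symmetric] algebra_simps)
      then show ?thesis
        unfolding g_def using integral_pair_cnj[OF L.finite_measure_axioms, of "\<lambda>\<zeta>. cis (- (2 * pi * ((fst z - snd z) \<bullet> \<zeta>)) / r)"]
        by simp
    qed
    have split: "cis (- (2 * pi * ((a - b) \<bullet> w)) / r) =
        cis (- (2 * pi * (a \<bullet> (w /\<^sub>R r)))) * cnj (cis (- (2 * pi * (b \<bullet> (w /\<^sub>R r)))))" for a b w :: 'b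
      by (simp add: cis_cnj cis_mult inner_diff_left divide_inverse algebra_simps)
    have inM: "(LINT z|(M \<Otimes>\<^sub>M M). F z y) = of_real ((cmod (fourier_transform M ((fst y - snd y) /\<^sub>R r)))\<^sup>2)" for y
    proof -
      have "F z y = cis (- (2 * pi * (fst z \<bullet> ((fst y - snd y) /\<^sub>R r)))) * cnj (cis (- (2 * pi * (snd z \<bullet> ((fst y - snd y) /\<^sub>R r)))))" for z
        unfolding F_def by (rule split)
      then show ?thesis
        unfolding fourier_transform_def
        using integral_pair_cnj[OF M(1), of "\<lambda>x. cis (- (2 * pi * (x \<bullet> ((fst y - snd y) /\<^sub>R r))))"]
        by simp
    qed
    let ?G = "\<lambda>z. (cmod (g (fst z - snd z)))\<^sup>2"
    let ?H = "\<lambda>y. (cmod (fourier_transform M ((fst y - snd y) /\<^sub>R r)))\<^sup>2"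
    have "(LINT y|(L \<Otimes>\<^sub>M L). LINT z|(M \<Otimes>\<^sub>M M). F z y) = (LINT z|(M \<Otimes>\<^sub>M M). LINT y|(L \<Otimes>\<^sub>M L). F z y)"
      by (rule pML.Fubini_integral[OF int])
    then have "complex_of_real (LINT y|(L \<Otimes>\<^sub>M L). ?H y) = complex_of_real (LINT z|(M \<Otimes>\<^sub>M M). ?G z)"
      by (simp only: inL inM integral_complex_of_real)
    then have eq: "(LINT y|(L \<Otimes>\<^sub>M L). ?H y) = (LINT z|(M \<Otimes>\<^sub>M M). ?G z)" by (simp only: of_real_eq_iff)
    have "integrable (M \<Otimes>\<^sub>M M) (\<lambda>z. LINT y|(L \<Otimes>\<^sub>M L). F z y)"
      using pML.integrable_fst[OF int] by simp
    then have Gi: "integrable (M \<Otimes>\<^sub>M M) ?G"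
      unfolding inL by (simp only: complex_of_real_integrable_eq)
    have "integrable (L \<Otimes>\<^sub>M L) (\<lambda>y. LINT z|(M \<Otimes>\<^sub>M M). F z y)"
      using pML.integrable_snd[OF int] by simp
    then have Hi: "integrable (L \<Otimes>\<^sub>M L) ?H"
      unfolding inM by (simp only: complex_of_real_integrable_eq)
    have glow: "v / 2 \<le> cmod (g w)" if w: "norm w \<le> r" for w
    proof -
      have "v / 2 = (LINT \<zeta>|L. 1 / 2)" using measL by simp
      also have "\<dots> \<le> (LINT \<zeta>|L. Re (cis (- (2 * pi * (w \<bullet> \<zeta>)) / r)))"
      proof (rule integral_mono_AE)
        show "integrable L (\<lambda>\<zeta>. 1 / 2 :: real)" by simp
        show "integrable L (\<lambda>\<zeta>. Re (cis (- (2 * pi * (w \<bullet> \<zeta>)) / r)))"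
          by (rule L.integrable_const_bound[where B=1]) auto
        have half: "1 / 2 \<le> Re (cis (- (2 * pi * (w \<bullet> \<zeta>)) / r))" if z: "\<zeta> \<in> ?B" for \<zeta>
        proof -
          have "\<bar>w \<bullet> \<zeta>\<bar> \<le> norm w * norm \<zeta>" by (rule Cauchy_Schwarz_ineq2)
          also have "\<dots> \<le> r * (1 / 8)" using w z r by (intro mult_mono) auto
          finally have "\<bar>2 * pi * (w \<bullet> \<zeta>) / r\<bar> \<le> 2 * pi * (1 / 8)"
            using r by (simp add: abs_mult field_simps)
          also have "\<dots> \<le> pi / 3" by simp
          finally have "cos (pi / 3) \<le> cos \<bar>2 * pi * (w \<bullet> \<zeta>) / r\<bar>"
            by (intro cos_monotone_0_pi_le) auto
          then have "1 / 2 \<le> cos (2 * pi * (w \<bullet> \<zeta>) / r)" by (simp only: cos_abs_real cos_60)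
          then show ?thesis by simp
        qed
        show "AE \<zeta> in L. 1 / 2 \<le> Re (cis (- (2 * pi * (w \<bullet> \<zeta>)) / r))"
          using AE_L by eventually_elim (rule half)
      qed
      also have "\<dots> = Re (g w)"
        unfolding g_def by (rule integral_Re) (rule L.integrable_const_bound[where B=1], auto)
      also have "\<dots> \<le> cmod (g w)" by (rule complex_Re_le_cmod)
      finally show ?thesis .
    qed
    let ?D = "{z :: 'b \<times> 'b. dist (fst z) (snd z) \<le> r}"
    have D: "?D \<in> sets (M \<Otimes>\<^sub>M M)"
    proof -
      have "{z \<in> space (M \<Otimes>\<^sub>M M). dist (fst z) (snd z) \<le> r} \<in> sets (M \<Otimes>\<^sub>M M)" by measurable
      then show ?thesis by simp
    qed
    have "measure (M \<Otimes>\<^sub>M M) ?D * (v / 2)\<^sup>2 = (LINT z|(M \<Otimes>\<^sub>M M). indicator ?D z * (v / 2)\<^sup>2)"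
      using D by simp
    also have "\<dots> \<le> (LINT z|(M \<Otimes>\<^sub>M M). ?G z)"
    proof (rule integral_mono[OF _ Gi])
      show "integrable (M \<Otimes>\<^sub>M M) (\<lambda>z. indicator ?D z * (v / 2)\<^sup>2)"
        by (intro integrable_mult_left integrable_real_indicator D) (simp add: MM.emeasure_finite less_top[symmetric])
      show "indicator ?D z * (v / 2)\<^sup>2 \<le> ?G z" for z
        using glow[of "fst z - snd z"] v by (auto simp: indicator_def dist_norm intro!: power_mono)
    qed
    also have "\<dots> = (LINT y|(L \<Otimes>\<^sub>M L). ?H y)" by (rule eq[symmetric])
    also have "\<dots> \<le> enn2real I * C\<^sup>2 * v * r powr s"
    proof -
      have [measurable]: "(\<lambda>y. ?H y) \<in> borel_measurable (L \<Otimes>\<^sub>M L)" using Hi by auto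
      have "ennreal (LINT y|(L \<Otimes>\<^sub>M L). ?H y) = (\<integral>\<^sup>+y. ennreal (?H y) \<partial>(L \<Otimes>\<^sub>M L))"
        by (rule nn_integral_eq_integral[OF Hi, symmetric]) simp
      also have "\<dots> = (\<integral>\<^sup>+\<zeta>. \<integral>\<^sup>+\<zeta>'. ennreal (?H (\<zeta>, \<zeta>')) \<partial>L \<partial>L)"
        by (rule L.nn_integral_fst[symmetric]) measurable
      also have "\<dots> \<le> (\<integral>\<^sup>+\<zeta>. ennreal (C\<^sup>2 * r powr s) * I \<partial>L)"
      proof (rule nn_integral_mono_AE)
        have inner: "(\<integral>\<^sup>+\<zeta>'. ennreal (?H (\<zeta>, \<zeta>')) \<partial>L) \<le> ennreal (C\<^sup>2 * r powr s) * I" if z: "\<zeta> \<in> ?B" for \<zeta>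
        proof -
          have meas: "(\<lambda>\<zeta>'. ennreal (?H (\<zeta>, \<zeta>'))) \<in> borel_measurable L"
            by (rule measurable_compose[of "\<lambda>\<zeta>'. (\<zeta>, \<zeta>')" L "L \<Otimes>\<^sub>M L"]) measurable
          have "(\<integral>\<^sup>+\<zeta>'. ennreal (?H (\<zeta>, \<zeta>')) \<partial>L) = (\<integral>\<^sup>+\<zeta>'. indicator ?B \<zeta>' * ennreal (?H (\<zeta>, \<zeta>')) \<partial>lborel)"
            unfolding L_def using meas by (subst nn_integral_density) (auto simp: L_def)
          also have "\<dots> \<le> (\<integral>\<^sup>+\<zeta>'. ennreal (C\<^sup>2 * r powr s) * (ennreal (norm (\<zeta>' - \<zeta>) powr - s) * indicator (cball 0 1) (\<zeta>' - \<zeta>)) \<partial>lborel)"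
          \<comment> \<open>The point \<open>\<zeta>' = \<zeta>\<close> is excluded as a null set,
            since \<open>powr\<close> makes the majorant 0 there.\<close>
          proof (rule nn_integral_mono_AE, rule AE_mp[OF AE_lborel_singleton[of \<zeta>]], intro AE_I2 impI)
            fix \<zeta>' assume ne: "\<zeta>' \<noteq> \<zeta>"
            show "indicator ?B \<zeta>' * ennreal (?H (\<zeta>, \<zeta>')) \<le>
              ennreal (C\<^sup>2 * r powr s) * (ennreal (norm (\<zeta>' - \<zeta>) powr - s) * indicator (cball 0 1) (\<zeta>' - \<zeta>))"
            proof (cases "\<zeta>' \<in> ?B")
              case True
              have n1: "norm (\<zeta>' - \<zeta>) \<le> 1" using True z norm_triangle_ineq4[of \<zeta>' \<zeta>] by simp
              define n where "n = norm (\<zeta>' - \<zeta>)"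
              have n: "n > 0" using ne by (simp add: n_def)
              \<comment> \<open>The decay hypothesis is squared at the frequency (\<zeta> -
                \<zeta>') / r; the scaling by 1/r is the source of the factor
                \<open>r powr s\<close>.\<close>
              have "(norm ((\<zeta> - \<zeta>') /\<^sub>R r) powr (s / 2) * cmod (fourier_transform M ((\<zeta> - \<zeta>') /\<^sub>R r)))\<^sup>2 \<le> C\<^sup>2"
                using decay by (intro power_mono mult_nonneg_nonneg norm_ge_zero powr_ge_zero)
              moreover have "norm ((\<zeta> - \<zeta>') /\<^sub>R r) = n / r"
                using r by (simp add: n_def norm_minus_commute divide_inverse mult.commute)
              moreover have "((n / r) powr (s / 2))\<^sup>2 = n powr s / r powr s"
                using n r by (simp add: power2_eq_square powr_add[symmetric] powr_divide)
              ultimately have "n powr s / r powr s * ?H (\<zeta>, \<zeta>') \<le> C\<^sup>2" by (simp add: power_mult_distrib)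
              then have "?H (\<zeta>, \<zeta>') \<le> C\<^sup>2 * r powr s * n powr - s"
                using n r by (simp add: powr_minus field_simps)
              then have "ennreal (?H (\<zeta>, \<zeta>')) \<le> ennreal (C\<^sup>2 * r powr s) * ennreal (n powr - s)"
                by (subst ennreal_mult[symmetric]) (auto intro: ennreal_leI)
              then show ?thesis using True n1 by (simp add: n_def)
            qed simp
          qed
          also have "\<dots> = ennreal (C\<^sup>2 * r powr s) * (\<integral>\<^sup>+\<zeta>'. ennreal (norm (\<zeta>' - \<zeta>) powr - s) * indicator (cball 0 1) (\<zeta>' - \<zeta>) \<partial>lborel)"
            by (rule nn_integral_cmult) measurable
          also have "(\<integral>\<^sup>+\<zeta>'. ennreal (norm (\<zeta>' - \<zeta>) powr - s) * indicator (cball 0 1) (\<zeta>' - \<zeta>) \<partial>lborel) = I"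
          proof -
            have "I = (\<integral>\<^sup>+w. ennreal (norm (w::'b) powr - s) * indicator (cball 0 1) w \<partial>(distr lborel borel ((+) (- \<zeta>))))"
              unfolding I_def lborel_distr_plus ..
            also have "\<dots> = (\<integral>\<^sup>+\<zeta>'. ennreal (norm (- \<zeta> + \<zeta>') powr - s) * indicator (cball 0 1) (- \<zeta> + \<zeta>') \<partial>lborel)"
              by (rule nn_integral_distr) measurable
            finally show ?thesis by simp
          qed
          finally show ?thesis .
        qed
        show "AE \<zeta> in L. (\<integral>\<^sup>+\<zeta>'. ennreal (?H (\<zeta>, \<zeta>')) \<partial>L) \<le> ennreal (C\<^sup>2 * r powr s) * I"
          using AE_L by eventually_elim (rule inner)
      qed
      also have "\<dots> = ennreal (C\<^sup>2 * r powr s) * I * ennreal v"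
        by (simp add: emL')
      also have "\<dots> = ennreal (C\<^sup>2 * r powr s) * ennreal (enn2real I) * ennreal v"
        using I by (simp add: less_top)
      also have "\<dots> = ennreal (enn2real I * C\<^sup>2 * v * r powr s)"
        using v by (simp add: ennreal_mult[symmetric] mult_ac)
      finally show ?thesis using v by (subst (asm) ennreal_le_iff) auto
    qed
    finally show "measure (M \<Otimes>\<^sub>M M) ?D \<le> K * r powr s"
      using v by (simp add: K_def field_simps)
  qed
qed

section \<open>Counting cells in a chart piece\<close>

text \<open>The cells are preimages under \<psi> of grid cubes of side 1/k. They are counted in the
  parameter space, where the exponent is \<open>CARD('m)\<close>, while \<open>lip\<close> transfers
  their diameters back to \<open>X\<close>. The squares of the cells are disjoint and lie near the
  diagonal.\<close>

lemma square_measure_le_near_diagonal: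
  fixes M :: "(real^'n) measure" and \<psi> :: "real^'n \<Rightarrow> real^'m::finite" and k :: nat
  assumes M: "finite_measure M" "sets M = sets borel"
    and X: "compact X" and \<psi>: "continuous_on X \<psi>"
    and bnd: "\<And>x i. x \<in> X \<Longrightarrow> \<bar>\<psi> x $ i\<bar> \<le> R"
    and lip: "\<And>x y. x \<in> X \<Longrightarrow> y \<in> X \<Longrightarrow> dist x y \<le> L * dist (\<psi> x) (\<psi> y)" and L: "L \<ge> 0" and R: "R \<ge> 0" and k: "k > 0"
  shows "(measure M X)\<^sup>2 \<le> ((2 * R + 3) * real k) ^ CARD('m) *
    measure (M \<Otimes>\<^sub>M M) {z. dist (fst z) (snd z) \<le> L * real CARD('m) / real k}"
proof -
  interpret M: finite_measure M by fact
  have [simp]: "space M = UNIV" using sets_eq_imp_space_eq[OF M(2)] by simp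
  note [measurable_cong] = M(2)
  interpret MM: finite_measure "M \<Otimes>\<^sub>M M" by (rule finite_measure_pair_measure) unfold_locales
  have Xs[measurable]: "X \<in> sets borel" using X by (rule borel_compact)
  define \<psi>' where "\<psi>' x = (if x \<in> X then \<psi> x else 0)" for x
  have [measurable]: "\<psi>' \<in> borel_measurable borel"
    unfolding \<psi>'_def[abs_def] by (rule borel_measurable_continuous_on_if) (use \<psi> in auto)
  have [measurable]: "(\<lambda>x. \<psi>' x $ i) \<in> borel_measurable borel" for i
    by (rule borel_measurable_continuous_on[where f="\<lambda>v. v $ i"]) (auto intro!: continuous_intros)
  \<comment> \<open>All floors lie between \<open>-N\<close> and \<open>N\<close>. The 2 N + 1
    values per coordinate number at most 2 k R + 3, hence at most (2 R + 3) k because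
    \<open>k \<ge> 1\<close>.\<close>
  define N where "N = \<lceil>real k * R\<rceil>"
  have "0 \<le> real k * R" using R by simp
  then have N: "real k * R \<le> of_int N" "N \<ge> 0" unfolding N_def by linarith+
  have N1: "of_int N \<le> real k * R + 1" unfolding N_def by (rule of_int_ceiling_le_add_one)
  define J :: "('m \<Rightarrow> int) set" where "J = PiE UNIV (\<lambda>i. {-N..N})"
  have finJ: "finite J" by (simp add: J_def finite_PiE)
  have cardJ: "card J = nat (2 * N + 1) ^ CARD('m)"
    by (simp add: J_def card_PiE)
  define Q where "Q j = {x \<in> X. \<forall>i. \<lfloor>real k * \<psi>' x $ i\<rfloor> = j i}" for j
  have Qm: "Q j \<in> sets M" for j
  proof -
    have "{x \<in> space borel. x \<in> X \<and> (\<forall>i. \<lfloor>real k * \<psi>' x $ i\<rfloor> = j i)} \<in> sets borel" by measurable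
    then show ?thesis by (simp add: Q_def M(2))
  qed
  have disj: "disjoint_family_on Q J" by (auto simp: disjoint_family_on_def Q_def fun_eq_iff)
  have cover: "X = (\<Union>j\<in>J. Q j)"
  proof
    show "X \<subseteq> (\<Union>j\<in>J. Q j)"
    proof
      fix x assume x: "x \<in> X"
      define j where "j i = \<lfloor>real k * \<psi>' x $ i\<rfloor>" for i
      have "j i \<in> {-N..N}" for i
      proof -
        have "\<bar>real k * \<psi>' x $ i\<bar> \<le> real k * R"
          using bnd[OF x, of i] x by (simp add: \<psi>'_def abs_mult mult_left_mono)
        then have "\<bar>real k * \<psi>' x $ i\<bar> \<le> of_int N" using N by linarith
        then show ?thesis unfolding j_def by (simp add: le_floor_iff floor_le_iff abs_le_iff)
      qed
      then have "j \<in> J" by (simp add: J_def PiE_def extensional_def)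
      moreover have "x \<in> Q j" using x by (simp add: Q_def j_def)
      ultimately show "x \<in> (\<Union>j\<in>J. Q j)" by blast
    qed
  qed (auto simp: Q_def)
  have close: "dist x y \<le> L * real CARD('m) / real k" if "x \<in> Q j" "y \<in> Q j" for x y j
  proof -
    have xy: "x \<in> X" "y \<in> X" using that by (auto simp: Q_def)
    have "\<bar>(\<psi> x - \<psi> y) $ i\<bar> \<le> 1 / real k" for i
    proof -
      have "\<lfloor>real k * \<psi> x $ i\<rfloor> = \<lfloor>real k * \<psi> y $ i\<rfloor>"
        using that by (auto simp: Q_def \<psi>'_def)
      then have "\<bar>real k * \<psi> x $ i - real k * \<psi> y $ i\<bar> \<le> 1" by linarith
      then have "real k * \<bar>(\<psi> x - \<psi> y) $ i\<bar> \<le> 1"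
        by (simp add: right_diff_distrib[symmetric] abs_mult)
      then show ?thesis using k by (simp add: field_simps)
    qed
    \<comment> \<open>The norm is bounded by the sum of the coordinates, which is where
      \<open>CARD('m)\<close> enters the radius.\<close>
    then have "norm (\<psi> x - \<psi> y) \<le> (\<Sum>i\<in>(UNIV::'m set). 1 / real k)"
      by (intro order_trans[OF norm_le_l1_cart] sum_mono) auto
    then have "dist (\<psi> x) (\<psi> y) \<le> real CARD('m) / real k" by (simp add: dist_norm)
    then have "L * dist (\<psi> x) (\<psi> y) \<le> L * (real CARD('m) / real k)" using L by (intro mult_left_mono) auto
    then show ?thesis using lip[OF xy] by simp
  qed
  let ?D = "{z :: (real^'n) \<times> (real^'n). dist (fst z) (snd z) \<le> L * real CARD('m) / real k}"
  have D: "?D \<in> sets (M \<Otimes>\<^sub>M M)"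
  proof -
    have "{z \<in> space (M \<Otimes>\<^sub>M M). dist (fst z) (snd z) \<le> L * real CARD('m) / real k} \<in> sets (M \<Otimes>\<^sub>M M)" by measurable
    then show ?thesis by (simp add: space_pair_measure)
  qed
  have "measure M X = (\<Sum>j\<in>J. measure M (Q j))"
    unfolding cover using finJ disj Qm by (intro M.finite_measure_finite_Union) auto
  then have "(measure M X)\<^sup>2 \<le> (\<Sum>j\<in>J. (measure M (Q j))\<^sup>2) * real (card J)"
    using sum_squared_le_sum_of_squares[of "\<lambda>j. measure M (Q j)" J] by simp
  also have "(\<Sum>j\<in>J. (measure M (Q j))\<^sup>2) = (\<Sum>j\<in>J. measure (M \<Otimes>\<^sub>M M) (Q j \<times> Q j))"
  proof (intro sum.cong refl)
    fix j
    have "emeasure (M \<Otimes>\<^sub>M M) (Q j \<times> Q j) = emeasure M (Q j) * emeasure M (Q j)"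
      by (rule M.emeasure_pair_measure_Times) (rule Qm)+
    then show "(measure M (Q j))\<^sup>2 = measure (M \<Otimes>\<^sub>M M) (Q j \<times> Q j)"
      by (simp add: measure_def enn2real_mult power2_eq_square)
  qed
  also have "\<dots> = measure (M \<Otimes>\<^sub>M M) (\<Union>j\<in>J. Q j \<times> Q j)"
    using finJ disj Qm by (intro MM.finite_measure_finite_Union[symmetric])
      (auto simp: disjoint_family_on_def)
  also have "\<dots> \<le> measure (M \<Otimes>\<^sub>M M) ?D"
    using D close by (intro MM.finite_measure_mono) auto
  finally have 1: "(measure M X)\<^sup>2 \<le> measure (M \<Otimes>\<^sub>M M) ?D * real (card J)"
    by (simp add: mult_right_mono)
  have "real (card J) \<le> ((2 * R + 3) * real k) ^ CARD('m)"
  proof -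
    have "real (nat (2 * N + 1)) = 2 * of_int N + 1" using N(2) by simp
    also have "\<dots> \<le> 2 * (real k * R + 1) + 1" by (intro add_right_mono mult_left_mono N1) simp
    also have "\<dots> \<le> 2 * (real k * R) + 3 * real k" using k by simp
    also have "\<dots> = (2 * R + 3) * real k" by (simp add: algebra_simps)
    finally show ?thesis unfolding cardJ of_nat_power by (intro power_mono) auto
  qed
  then have "measure (M \<Otimes>\<^sub>M M) ?D * real (card J) \<le> measure (M \<Otimes>\<^sub>M M) ?D * ((2 * R + 3) * real k) ^ CARD('m)"
    by (intro mult_left_mono) auto
  with 1 show ?thesis by (simp add: mult.commute)
qed

text \<open>\<phi> is smooth on an open set reaching beyond the half-space, hence Lipschitz on a
  full closed ball. The model space is closed, so the part of the ball inside it is compact even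
  around a boundary point. The estimate on \<psi> is the Lipschitz bound for \<phi> read
  backwards.\<close>

lemma smooth_chart_piece:
  fixes S :: "(real^'n) set"
  assumes "smooth_hypersurface TYPE('m::finite) S" "p \<in> S"
  obtains V X and \<psi> :: "real^'n \<Rightarrow> real^'m" and R L where "open V" "p \<in> V" "S \<inter> V \<subseteq> X" "compact X" "continuous_on X \<psi>"
    "R \<ge> 0" "\<forall>x\<in>X. \<forall>i. \<bar>\<psi> x $ i\<bar> \<le> R" "L > 0"
    "\<forall>x\<in>X. \<forall>y\<in>X. dist x y \<le> L * dist (\<psi> x) (\<psi> y)"
proof -
  obtain \<phi> :: "real^'m \<Rightarrow> real^'n" and W P where P: "model_space P" and ch: "hs_chart S \<phi> W P" and p: "p \<in> \<phi> ` (W \<inter> P)"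
    using assms unfolding smooth_hypersurface_def by blast
  obtain u1 where u1: "u1 \<in> W" "u1 \<in> P" "p = \<phi> u1" using p by blast
  have W: "open W" "smooth_on \<phi> W" using ch unfolding hs_chart_def by blast+
  obtain \<psi> where hom: "homeomorphism (W \<inter> P) (\<phi> ` (W \<inter> P)) \<phi> \<psi>" using ch unfolding hs_chart_def by blast
  obtain V where V: "open V" "\<phi> ` (W \<inter> P) = S \<inter> V" using ch unfolding hs_chart_def by blast
  have closedP: "closed P"
    using P unfolding model_space_def
    by (auto intro!: closed_Collect_le continuous_intros)
  obtain \<rho> where \<rho>: "\<rho> > 0" "cball u1 \<rho> \<subseteq> W" using W u1 open_contains_cball by blast
  obtain B where B: "B \<ge> 0" "\<forall>x\<in>cball u1 \<rho>. \<forall>y\<in>cball u1 \<rho>. norm (\<phi> x - \<phi> y) \<le> B * norm (x - y)"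
    using smooth_on_lipschitz[OF W(1) compact_cball \<rho>(2) convex_cball W(2)] by blast
  define X where "X = \<phi> ` (cball u1 \<rho> \<inter> P)"
  have "openin (top_of_set (W \<inter> P)) ((W \<inter> P) \<inter> ball u1 \<rho>)" by (simp add: openin_open_Int)
  then have "openin (top_of_set (\<phi> ` (W \<inter> P))) (\<phi> ` ((W \<inter> P) \<inter> ball u1 \<rho>))"
    by (rule homeomorphism_imp_open_map[OF hom])
  then obtain V1 where V1: "open V1" "\<phi> ` ((W \<inter> P) \<inter> ball u1 \<rho>) = \<phi> ` (W \<inter> P) \<inter> V1" unfolding openin_open by blast
  have sub: "cball u1 \<rho> \<inter> P \<subseteq> W \<inter> P" using \<rho> by blast
  have inv: "\<psi> (\<phi> u) = u" if "u \<in> cball u1 \<rho> \<inter> P" for u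
    by (rule homeomorphism_apply1[OF hom]) (use sub that in blast)
  show ?thesis
  \<comment> \<open>\<open>B + 1\<close> instead of \<open>B\<close> makes \<open>L\<close>
    positive, as the radii L m / k, with m = \<open>CARD('m)\<close>, must be.\<close>
  proof (rule that[of "V \<inter> V1" X \<psi> "norm u1 + \<rho>" "B + 1"])
    show "open (V \<inter> V1)" using V V1 by blast
    have "p \<in> \<phi> ` ((W \<inter> P) \<inter> ball u1 \<rho>)" using u1 \<rho> by auto
    then show "p \<in> V \<inter> V1" using V V1 by blast
    have "S \<inter> (V \<inter> V1) = \<phi> ` ((W \<inter> P) \<inter> ball u1 \<rho>)" using V V1 by blast
    then show "S \<inter> (V \<inter> V1) \<subseteq> X" unfolding X_def by auto
    show "compact X" unfolding X_def
    proof (rule compact_continuous_image)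
      show "continuous_on (cball u1 \<rho> \<inter> P) \<phi>"
        using smooth_on_continuous_on[OF W(2)] \<rho> by (meson continuous_on_subset le_infI1)
      show "compact (cball u1 \<rho> \<inter> P)" using closedP by (rule compact_Int_closed[OF compact_cball])
    qed
    have "continuous_on (\<phi> ` (W \<inter> P)) \<psi>" by (rule homeomorphism_cont2[OF hom])
    then show "continuous_on X \<psi>" unfolding X_def using sub by (meson continuous_on_subset image_mono)
    show "B + 1 > 0" "norm u1 + \<rho> \<ge> 0" using B \<rho> by auto
    show "\<forall>x\<in>X. \<forall>i. \<bar>\<psi> x $ i\<bar> \<le> norm u1 + \<rho>"
    proof (intro ballI allI)
      fix x i assume x: "x \<in> X"
      obtain u where u: "u \<in> cball u1 \<rho> \<inter> P" "x = \<phi> u" using x unfolding X_def by blast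
      have "\<bar>u $ i\<bar> \<le> norm u" by (rule component_le_norm_cart)
      also have "\<dots> \<le> norm u1 + norm (u - u1)" using norm_triangle_ineq[of u1 "u - u1"] by simp
      also have "\<dots> \<le> norm u1 + \<rho>" using u by (simp add: dist_norm norm_minus_commute)
      finally show "\<bar>\<psi> x $ i\<bar> \<le> norm u1 + \<rho>" using inv u by simp
    qed
    show "\<forall>x\<in>X. \<forall>y\<in>X. dist x y \<le> (B + 1) * dist (\<psi> x) (\<psi> y)"
    proof (intro ballI)
      fix x y assume xy: "x \<in> X" "y \<in> X"
      obtain u where u: "u \<in> cball u1 \<rho> \<inter> P" "x = \<phi> u" using xy unfolding X_def by blast
      obtain w where w: "w \<in> cball u1 \<rho> \<inter> P" "y = \<phi> w" using xy unfolding X_def by blast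
      have "norm (\<phi> u - \<phi> w) \<le> B * norm (u - w)" using B(2) u w by blast
      also have "\<dots> \<le> (B + 1) * norm (u - w)" by (intro mult_right_mono) auto
      finally show "dist x y \<le> (B + 1) * dist (\<psi> x) (\<psi> y)" using inv u w by (simp add: dist_norm)
    qed
  qed
qed

section \<open>The Fourier dimension\<close>

text \<open>With radius of order 1/k the number of cells grows like k^m, with m =
  \<open>CARD('m)\<close>, while the mass near the diagonal shrinks like k^(-s). As \<open>s\<close>
  exceeds m, the product tends to 0.\<close>

lemma fourier_decay_null_piece:
  fixes M :: "(real^'n) measure" and \<psi> :: "real^'n \<Rightarrow> real^'m::finite"
  assumes M: "finite_measure M" "sets M = sets borel"
    and s: "real CARD('m) < s" "s < real CARD('n)"
    and decay: "\<And>\<xi>. norm \<xi> powr (s / 2) * norm (fourier_transform M \<xi>) \<le> C"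
    and X: "compact X" "continuous_on X \<psi>" "R \<ge> 0" "\<forall>x\<in>X. \<forall>i. \<bar>\<psi> x $ i\<bar> \<le> R" "L > 0"
      "\<forall>x\<in>X. \<forall>y\<in>X. dist x y \<le> L * dist (\<psi> x) (\<psi> y)"
  shows "measure M X = 0"
proof -
  let ?m = "CARD('m)"
  have s0: "0 \<le> s" using s by linarith
  obtain K where K: "K \<ge> 0"
    "\<And>r. r > 0 \<Longrightarrow> measure (M \<Otimes>\<^sub>M M) {z. dist (fst z) (snd z) \<le> r} \<le> K * r powr s"
    using fourier_decay_near_diagonal[OF M s0 _ decay] s by auto
  define c where "c = (2 * R + 3) ^ ?m * K * (L * real ?m) powr s"
  have le: "(measure M X)\<^sup>2 \<le> c * real k powr (real ?m - s)" if k: "k > 0" for k :: nat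
  proof -
    have pos: "L * real ?m / real k > 0" using X k by simp
    have "(measure M X)\<^sup>2 \<le> ((2 * R + 3) * real k) ^ ?m *
      measure (M \<Otimes>\<^sub>M M) {z. dist (fst z) (snd z) \<le> L * real ?m / real k}"
      using X k by (intro square_measure_le_near_diagonal[OF M]) auto
    also have "\<dots> \<le> ((2 * R + 3) * real k) ^ ?m * (K * (L * real ?m / real k) powr s)"
      using X by (intro mult_left_mono K(2)[OF pos]) auto
    also have "\<dots> = c * real k powr (real ?m - s)"
    proof -
      have "real k powr (real ?m - s) = real k ^ ?m / real k powr s"
        using k by (simp add: powr_diff powr_realpow)
      moreover have "(L * real ?m / real k) powr s = (L * real ?m) powr s / real k powr s"
        by (rule powr_divide)
      ultimately show ?thesis by (simp add: c_def power_mult_distrib)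
    qed
    finally show ?thesis .
  qed
  have "(\<lambda>k. c * real k powr (real ?m - s)) \<longlonglongrightarrow> c * 0"
    using s by (intro tendsto_intros tendsto_neg_powr filterlim_real_sequentially) auto
  then have "(measure M X)\<^sup>2 \<le> c * 0"
    by (rule LIMSEQ_le_const) (use le in \<open>auto intro!: exI[of _ 1]\<close>)
  then show ?thesis by simp
qed

text \<open>The transform of the projected measure is the restriction of the transform of
  \<open>M\<close> to frequencies with last coordinate 0, so it inherits the decay. All chart pieces
  are then null, which contradicts positive total mass.\<close>

lemma cylinder_decay_exponent_le:
  fixes S :: "(real^'n) set"
  assumes card: "CARD('n) = CARD('m) + 1" and S: "smooth_hypersurface TYPE('m::finite) S"
    and M: "M \<in> finite_measures_on (S \<times> (UNIV :: real set))"
    and decay: "\<And>\<xi>. norm \<xi> powr (s / 2) * norm (fourier_transform M \<xi>) \<le> C"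
  shows "s \<le> real CARD('m)"
proof (rule ccontr)
  assume "\<not> s \<le> real CARD('m)"
  \<comment> \<open>The exponent must stay above \<open>CARD('m)\<close> for the contradiction and
    below \<open>CARD('n)\<close>, which is \<open>CARD('m) + 1\<close>, for local
    integrability.\<close>
  define t where "t = min s (real CARD('m) + 1 / 2)"
  have t: "real CARD('m) < t" "t < real CARD('n)" "t \<le> s" "0 \<le> t"
    using \<open>\<not> s \<le> real CARD('m)\<close> card by (auto simp: t_def)
  have M': "sets M = sets borel" "emeasure M UNIV \<noteq> 0" "emeasure M UNIV < \<infinity>" "AE z in M. z \<in> S \<times> UNIV"
    using M by (auto simp: finite_measures_on_def)
  have [simp]: "space M = UNIV" using sets_eq_imp_space_eq[OF M'(1)] by simp
  note [measurable_cong] = M'(1)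
  interpret M: finite_measure M by (rule finite_measureI) (use M'(3) in auto)
  have fst[measurable]: "fst \<in> measurable M (borel :: (real^'n) measure)"
    by (subst measurable_cong_sets[OF M'(1) refl]) (intro borel_measurable_continuous_onI continuous_intros)
  define N where "N = distr M borel (fst :: (real^'n) \<times> real \<Rightarrow> real^'n)"
  have N: "finite_measure N" "sets N = sets borel" unfolding N_def by (auto intro: M.finite_measure_distr)
  interpret N: finite_measure N by (rule N(1))
  have emN: "emeasure N B = emeasure M (fst -` B)" if "B \<in> sets borel" for B
    using that by (simp add: N_def emeasure_distr)
  have ftN: "fourier_transform N \<xi> = fourier_transform M (\<xi>, 0)" for \<xi>
  proof -
    have "fourier_transform N \<xi> = (LINT z|M. cis (- (2 * pi * (fst z \<bullet> \<xi>))))"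
      unfolding fourier_transform_def N_def by (subst integral_distr) auto
    also have "\<dots> = fourier_transform M (\<xi>, 0)"
      unfolding fourier_transform_def by (intro Bochner_Integration.integral_cong) (auto simp: inner_prod_def)
    finally show ?thesis .
  qed
  \<comment> \<open>Lowering the exponent weakens the bound only for
    \<open>norm \<xi> \<ge> 1\<close>; inside the unit ball the total mass takes over.\<close>
  define C' where "C' = max C (measure M UNIV)"
  have decayN: "norm \<xi> powr (t / 2) * norm (fourier_transform N \<xi>) \<le> C'" for \<xi>
  proof (cases "norm \<xi> \<ge> 1")
    case True
    have "norm \<xi> powr (t / 2) * norm (fourier_transform N \<xi>) \<le> norm \<xi> powr (s / 2) * norm (fourier_transform N \<xi>)"
      using True t by (intro mult_right_mono powr_mono) auto
    also have "\<dots> \<le> C" using decay[of "(\<xi>, 0)"] by (simp add: ftN norm_Pair)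
    finally show ?thesis by (simp add: C'_def le_max_iff_disj)
  next
    case False
    have "norm (fourier_transform N \<xi>) \<le> (LINT z|M. norm (cis (- (2 * pi * (z \<bullet> (\<xi>, 0))))))"
      unfolding ftN unfolding fourier_transform_def by (rule integral_norm_bound)
    also have "\<dots> = measure M UNIV" by simp
    finally have "norm \<xi> powr (t / 2) * norm (fourier_transform N \<xi>) \<le> 1 * measure M UNIV"
      using False t by (intro mult_mono powr_le1) auto
    then show ?thesis by (simp add: C'_def le_max_iff_disj)
  qed
  \<comment> \<open>The measure is carried by \<open>S\<close> only in the almost-everywhere sense,
    so the argument works with Borel sets disjoint from \<open>S\<close> instead of with
    \<open>S\<close> itself.\<close>
  have off: "B \<in> null_sets N" if B: "B \<in> sets borel" "B \<inter> S = {}" for B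
  proof -
    have "AE z in M. z \<notin> fst -` B" using M'(4) by eventually_elim (use B in auto)
    moreover have "fst -` B \<in> sets M" using measurable_sets[OF fst B(1)] by simp
    ultimately have "emeasure M (fst -` B) = 0"
      by (subst (asm) AE_iff_measurable[of "fst -` B"]) auto
    then show ?thesis using B N by (auto simp: emN null_sets_def)
  qed
  have "\<exists>V. open V \<and> p \<in> V \<and> V \<in> null_sets N" if p: "p \<in> S" for p
  proof -
    obtain V X and \<psi> :: "real^'n \<Rightarrow> real^'m" and R L where V: "open V" "p \<in> V" "S \<inter> V \<subseteq> X"
      and X: "compact X" "continuous_on X \<psi>" "R \<ge> 0" "\<forall>x\<in>X. \<forall>i. \<bar>\<psi> x $ i\<bar> \<le> R" "L > 0"
      "\<forall>x\<in>X. \<forall>y\<in>X. dist x y \<le> L * dist (\<psi> x) (\<psi> y)"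
      by (rule smooth_chart_piece[OF S p])
    have "measure N X = 0" by (rule fourier_decay_null_piece[OF N t(1,2) decayN X])
    then have "X \<in> null_sets N"
      using borel_compact[OF X(1)] N by (auto simp: null_sets_def N.emeasure_eq_measure)
    moreover have "V - X \<in> null_sets N"
      using V borel_compact[OF X(1)] by (intro off) auto
    ultimately have "X \<union> (V - X) \<in> null_sets N" by (rule null_sets.Un)
    moreover have "V \<in> sets N" using V N by auto
    ultimately have "V \<in> null_sets N" by (rule null_sets_subset) auto
    then show ?thesis using V by blast
  qed
  then obtain V where V: "\<And>p. p \<in> S \<Longrightarrow> open (V p)" "\<And>p. p \<in> S \<Longrightarrow> p \<in> V p" "\<And>p. p \<in> S \<Longrightarrow> V p \<in> null_sets N"
    by metis
  \<comment> \<open>Lindelof reduces the null neighbourhoods to countably many. Their union is open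
    and contains \<open>S\<close>, so its complement is a Borel set to which \<open>off\<close>
    applies.\<close>
  obtain F where F: "F \<subseteq> V ` S" "countable F" "\<Union>F = \<Union>(V ` S)"
    using Lindelof[of "V ` S"] V(1) by blast
  have "B \<in> null_sets N" if "B \<in> F" for B using F(1) V(3) that by blast
  then have "\<Union>F \<in> null_sets N"
    using null_sets_UN'[OF F(2), of "\<lambda>x. x" N] by simp
  moreover have "UNIV - \<Union>F \<in> null_sets N"
  proof (rule off)
    have "open (\<Union>F)" using F V(1) by auto
    then show "UNIV - \<Union>F \<in> sets borel" by auto
    show "(UNIV - \<Union>F) \<inter> S = {}" using F V(2) by auto
  qed
  ultimately have "\<Union>F \<union> (UNIV - \<Union>F) \<in> null_sets N" by (rule null_sets.Un)
  then have "emeasure N UNIV = 0" by (simp add: null_sets_def)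
  then show False using M'(2) by (simp add: emN)
qed

theorem mainTheorem2:
  fixes S :: "(real^'n) set"
  assumes "CARD('n) \<ge> 2"
    and "CARD('n) = CARD('m) + 1"
    and "S \<noteq> {}"
    and "smooth_hypersurface TYPE('m::finite) S"
    and "nonvanishing_gauss_interior TYPE('m::finite) S"
  shows "fourier_dim (S \<times> (UNIV :: real set)) = real CARD('n) - 1"
proof -
  have m: "real CARD('n) - 1 = real CARD('m)" using assms(2) by simp
  show ?thesis
    unfolding fourier_dim_def m
  \<comment> \<open>The supremum is attained: the measure built above has decay exponent exactly
    \<open>CARD('m)\<close>.\<close>
  proof (rule cSup_eq_maximum)
    show "real CARD('m) \<in> {s. 0 \<le> s \<and> s \<le> real DIM((real^'n) \<times> real) \<and>
      (\<exists>M\<in>finite_measures_on (S \<times> (UNIV :: real set)). \<exists>C. \<forall>\<xi>. norm \<xi> powr (s / 2) * norm (fourier_transform M \<xi>) \<le> C)}"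
      using cylinder_measure_exists[OF assms(3,4,5)] assms(2) by simp
  qed (use cylinder_decay_exponent_le[OF assms(2,4)] in auto)
qed

end
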